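(* Let $\varphi\notin C^\infty(\mathbb{T})$ be a real-valued function on $\mathbb{T}$ (for which $P_N(\varphi)$ is defined) with $P_N(\varphi)<0$ (resp. $P_N(\varphi)>0$). Then, for any small $T>0$, there does not exist any solution $u$ to $$(\partial_t+\gamma_0\partial_x^5+\gamma_1\partial_x^3+\gamma_2\partial_x)u=N(\partial_x^3u,\partial_x^2u,\partial_xu,u),\qquad u(0,\cdot)=\varphi$$ on $[0,T]$ (resp. $[-T,0]$) satisfying $u\in C([0,T];H^{13}(\mathbb{T}))$ (resp. $u\in C([-T,0];H^{13}(\mathbb{T}))$).
   Context: $\mathbb{T}=\mathbb{R}/2\pi\mathbb{Z}$; the initial data $\varphi$ and the unknown $u$ are real valued; $\gamma_0,\gamma_1,\gamma_2\in\mathbb{R}$ are constants with $\gamma_0\ne0$. The nonlinearity is a fixed polynomial without constant or linear terms: $$N(\partial_x^3u,\partial_x^2u,\partial_xu,u)=\sum_{j=1}^{j_0}N_j(u),\qquad N_j(u)=\lambda_j(\partial_x^3u)^{a_j}(\partial_x^2u)^{b_j}(\partial_xu)^{c_j}u^{d_j},$$ with $\lambda_j\in\mathbb{R}$, $j_0\in\mathbb{N}$, $a_j,b_j,c_j,d_j\in\mathbb{N}\cup\{0\}$ and $p_j:=a_j+b_j+c_j+d_j\ge2$. Define $$P_N(f):=\sum_{j=1}^{j_0}P_{N_j}(f),\qquad P_{N_j}(f):=\frac{\lambda_jb_j}{2\pi}\int_{\mathbb{T}}(\partial_x^3f)^{a_j}(\partial_x^2f)^{b_j-1}(\partial_xf)^{c_j}f^{d_j}\,dx$$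 (with $P_{N_j}=0$ if $b_j=0$). $H^s(\mathbb{T})$ is the $L^2$-based Sobolev space. Solutions are understood in the sense of distributions. *)

theory Defs
  imports "HOL-Analysis.Analysis"
begin

text \<open>
  Functions on the torus (reals modulo \<open>2\<pi>\<close>) are \<open>2\<pi>\<close>-periodic functions on the real line, integrated
  over one period; as usual for Lebesgue and Sobolev spaces they are considered up to equality
  almost everywhere.
\<close>

definition periodic2pi :: "(real \<Rightarrow> real) \<Rightarrow> bool" where
  "periodic2pi f \<longleftrightarrow> (\<forall>x. f (x + 2 * pi) = f x)"

definition smooth_torus :: "(real \<Rightarrow> real) set" where
  "smooth_torus = {f. periodic2pi f \<and> (\<forall>k x. (deriv ^^ k) f field_differentiable (at x))}"

text \<open>Membership in \<open>C\<^sup>\<infinity>\<close> of an almost-everywhere class: some representative is smooth.\<close>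

definition ae_smooth_torus :: "(real \<Rightarrow> real) \<Rightarrow> bool" where
  "ae_smooth_torus f \<longleftrightarrow> (\<exists>g\<in>smooth_torus. AE x in lebesgue. f x = g x)"


definition has_weak_deriv :: "nat \<Rightarrow> (real \<Rightarrow> real) \<Rightarrow> (real \<Rightarrow> real) \<Rightarrow> bool" where
  "has_weak_deriv k f g \<longleftrightarrow>
     f absolutely_integrable_on {0..2*pi} \<and> g absolutely_integrable_on {0..2*pi} \<and>
     (\<forall>\<eta>\<in>smooth_torus.
        (LINT x:{0..2*pi}|lebesgue. f x * (deriv ^^ k) \<eta> x)
          = (-1) ^ k * (LINT x:{0..2*pi}|lebesgue. g x * \<eta> x))"

text \<open>
  The weak derivative is unique only almost everywhere, so this picks a representative. It is
  used below only under integrals over a period. It is unspecified if there is no weak derivative.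
\<close>

definition weak_deriv :: "nat \<Rightarrow> (real \<Rightarrow> real) \<Rightarrow> real \<Rightarrow> real" where
  "weak_deriv k f = (SOME g. has_weak_deriv k f g)"


definition fourier_coeff :: "(real \<Rightarrow> real) \<Rightarrow> int \<Rightarrow> complex" where
  "fourier_coeff f k =
     (LINT x:{0..2*pi}|lebesgue. of_real (f x) * cis (- (of_int k * x))) / of_real (2 * pi)"

text \<open>
  The (real-valued) Sobolev space \<open>H\<^sup>s\<close> on the torus, for \<open>s \<ge> 0\<close>. The norm is meaningful only for
  members of the space (\<open>infsum\<close> is \<open>0\<close> for divergent sums).
\<close>

definition Hs :: "real \<Rightarrow> (real \<Rightarrow> real) set" where
  "Hs s = {f. periodic2pi f \<and> f \<in> borel_measurable lebesgue \<and>
              (\<lambda>x. (f x)\<^sup>2) absolutely_integrable_on {0..2*pi} \<and>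
              (\<lambda>k. (1 + (of_int k)\<^sup>2) powr s * (cmod (fourier_coeff f k))\<^sup>2) summable_on UNIV}"

definition Hs_norm :: "real \<Rightarrow> (real \<Rightarrow> real) \<Rightarrow> real" where
  "Hs_norm s f = sqrt (\<Sum>\<^sub>\<infinity>k\<in>UNIV. (1 + (of_int k)\<^sup>2) powr s * (cmod (fourier_coeff f k))\<^sup>2)"

text \<open>\<open>u \<in> C(I; H\<^sup>s)\<close>, where \<open>u t\<close> is the function at time \<open>t\<close>.\<close>

definition continuous_Hs :: "real set \<Rightarrow> real \<Rightarrow> (real \<Rightarrow> real \<Rightarrow> real) \<Rightarrow> bool" where
  "continuous_Hs I s u \<longleftrightarrow>
     (\<forall>t\<in>I. u t \<in> Hs s) \<and>
     (\<forall>t\<in>I. ((\<lambda>r. Hs_norm s (\<lambda>x. u r x - u t x)) \<longlongrightarrow> 0) (at t within I))"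


primrec Ck_plane :: "nat \<Rightarrow> (real \<Rightarrow> real \<Rightarrow> real) \<Rightarrow> bool" where
  "Ck_plane 0 \<psi> \<longleftrightarrow> continuous_on UNIV (\<lambda>(t, x). \<psi> t x)"
| "Ck_plane (Suc n) \<psi> \<longleftrightarrow>
     (\<forall>t x. (\<lambda>r. \<psi> r x) field_differentiable (at t) \<and> \<psi> t field_differentiable (at x)) \<and>
     Ck_plane n (\<lambda>t x. deriv (\<lambda>r. \<psi> r x) t) \<and> Ck_plane n (\<lambda>t x. deriv (\<psi> t) x)"

text \<open>Test functions on the product of the open time interval \<open>(\<alpha>, \<beta>)\<close> with the torus.\<close>

definition test_functions :: "real \<Rightarrow> real \<Rightarrow> (real \<Rightarrow> real \<Rightarrow> real) set" where
  "test_functions \<alpha> \<beta> =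
     {\<psi>. (\<forall>n. Ck_plane n \<psi>) \<and> (\<forall>t. periodic2pi (\<psi> t)) \<and>
         (\<exists>\<alpha>' \<beta>'. \<alpha> < \<alpha>' \<and> \<beta>' < \<beta> \<and> (\<forall>t x. t \<notin> {\<alpha>'..\<beta>'} \<longrightarrow> \<psi> t x = 0))}"

text \<open>
  The equation \<open>(\<partial>\<^sub>t + \<gamma>0 \<partial>\<^sub>x\<^sup>5 + \<gamma>1 \<partial>\<^sub>x\<^sup>3 + \<gamma>2 \<partial>\<^sub>x) u = F(\<partial>\<^sub>x\<^sup>3 u, \<partial>\<^sub>x\<^sup>2 u, \<partial>\<^sub>x u, u)\<close> in the sense of
  distributions on \<open>(\<alpha>, \<beta>)\<close> times the torus. All derivatives on the left have odd order, hence the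
  minus signs. The integrals are iterated, so that only the almost-everywhere class
  of each \<open>u t\<close> matters and no joint measurability of the chosen representatives is needed.
\<close>

definition distributional_solution ::
    "real \<Rightarrow> real \<Rightarrow> real \<Rightarrow> (real \<Rightarrow> real \<Rightarrow> real \<Rightarrow> real \<Rightarrow> real) \<Rightarrow> real \<Rightarrow> real
      \<Rightarrow> (real \<Rightarrow> real \<Rightarrow> real) \<Rightarrow> bool" where
  "distributional_solution \<gamma>0 \<gamma>1 \<gamma>2 F \<alpha> \<beta> u \<longleftrightarrow>
     (\<forall>\<psi>\<in>test_functions \<alpha> \<beta>.
        (LINT t:{\<alpha>..\<beta>}|lebesgue. LINT x:{0..2*pi}|lebesgue.
           u t x * (- deriv (\<lambda>r. \<psi> r x) t - \<gamma>0 * (deriv ^^ 5) (\<psi> t) x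
                    - \<gamma>1 * (deriv ^^ 3) (\<psi> t) x - \<gamma>2 * deriv (\<psi> t) x))
        = (LINT t:{\<alpha>..\<beta>}|lebesgue. LINT x:{0..2*pi}|lebesgue.
             F (weak_deriv 3 (u t) x) (weak_deriv 2 (u t) x) (weak_deriv 1 (u t) x) (u t x)
               * \<psi> t x))"

definition solution_Hs ::
    "real \<Rightarrow> real \<Rightarrow> real \<Rightarrow> (real \<Rightarrow> real \<Rightarrow> real \<Rightarrow> real \<Rightarrow> real) \<Rightarrow> real \<Rightarrow> (real \<Rightarrow> real)
      \<Rightarrow> real \<Rightarrow> real \<Rightarrow> (real \<Rightarrow> real \<Rightarrow> real) \<Rightarrow> bool" where
  "solution_Hs \<gamma>0 \<gamma>1 \<gamma>2 F s \<phi> \<alpha> \<beta> u \<longleftrightarrow>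
     continuous_Hs {\<alpha>..\<beta>} s u \<and>
     (AE x in lebesgue. u 0 x = \<phi> x) \<and>
     distributional_solution \<gamma>0 \<gamma>1 \<gamma>2 F \<alpha> \<beta> u"


definition nonlinearity ::
    "nat \<Rightarrow> (nat \<Rightarrow> real) \<Rightarrow> (nat \<Rightarrow> nat) \<Rightarrow> (nat \<Rightarrow> nat) \<Rightarrow> (nat \<Rightarrow> nat) \<Rightarrow> (nat \<Rightarrow> nat)
      \<Rightarrow> real \<Rightarrow> real \<Rightarrow> real \<Rightarrow> real \<Rightarrow> real" where
  "nonlinearity j0 lam a b c d w3 w2 w1 w0 =
     (\<Sum>j=1..j0. lam j * w3 ^ a j * w2 ^ b j * w1 ^ c j * w0 ^ d j)"

definition P_integrand :: "nat \<Rightarrow> nat \<Rightarrow> nat \<Rightarrow> nat \<Rightarrow> (real \<Rightarrow> real) \<Rightarrow> real \<Rightarrow> real" where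
  "P_integrand a b c d f x =
     weak_deriv 3 f x ^ a * weak_deriv 2 f x ^ (b - 1) * weak_deriv 1 f x ^ c * f x ^ d"

definition P_term :: "real \<Rightarrow> nat \<Rightarrow> nat \<Rightarrow> nat \<Rightarrow> nat \<Rightarrow> (real \<Rightarrow> real) \<Rightarrow> real" where
  "P_term l a b c d f =
     (if b = 0 then 0
      else l * real b / (2 * pi) * (LINT x:{0..2*pi}|lebesgue. P_integrand a b c d f x))"

definition P_N ::
    "nat \<Rightarrow> (nat \<Rightarrow> real) \<Rightarrow> (nat \<Rightarrow> nat) \<Rightarrow> (nat \<Rightarrow> nat) \<Rightarrow> (nat \<Rightarrow> nat) \<Rightarrow> (nat \<Rightarrow> nat)
      \<Rightarrow> (real \<Rightarrow> real) \<Rightarrow> real" where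
  "P_N j0 lam a b c d f = (\<Sum>j=1..j0. P_term (lam j) (a j) (b j) (c j) (d j) f)"

text \<open>
  \<open>P_N\<close> is defined at \<open>f\<close> if, for every term with \<open>b\<^sub>j \<noteq> 0\<close>, those weak derivatives that occur in the
  integrand with a nonzero exponent exist and the integrand is Lebesgue integrable.
\<close>

definition P_N_defined ::
    "nat \<Rightarrow> (nat \<Rightarrow> nat) \<Rightarrow> (nat \<Rightarrow> nat) \<Rightarrow> (nat \<Rightarrow> nat) \<Rightarrow> (nat \<Rightarrow> nat)
      \<Rightarrow> (real \<Rightarrow> real) \<Rightarrow> bool" where
  "P_N_defined j0 a b c d f \<longleftrightarrow>
     (\<forall>j\<in>{1..j0}. b j \<noteq> 0 \<longrightarrow>
        (a j \<noteq> 0 \<longrightarrow> (\<exists>g. has_weak_deriv 3 f g)) \<and>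
        (b j \<noteq> 1 \<longrightarrow> (\<exists>g. has_weak_deriv 2 f g)) \<and>
        (c j \<noteq> 0 \<longrightarrow> (\<exists>g. has_weak_deriv 1 f g)) \<and>
        P_integrand (a j) (b j) (c j) (d j) f absolutely_integrable_on {0..2*pi})"

end

theory Submission
  imports Defs "HOL-Library.Function_Algebras"
begin

text \<open>
  After a reversal of time the solution lives on \<open>[-T, 0]\<close> and \<open>P\<^sub>N(u(0)) > 0\<close>; then \<open>u(0)\<close> is smooth, because
  the averaged equation is parabolic and regularity is gained one derivative at a time. Suppose that the
  Fourier coefficients of \<open>u(t)\<close> are \<open>O(\<bar>k\<bar>\<^bsup>-s\<^esup>)\<close> uniformly in \<open>t\<close>, with \<open>s \<ge> 13\<close>. Then \<open>v = \<partial>\<^sub>x\<^sup>r u\<close>, \<open>r = s - 7\<close>, solves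
  \<open>v\<^sub>t + \<gamma>0 \<partial>\<^sub>x\<^sup>5 v + \<gamma>1 \<partial>\<^sub>x\<^sup>3 v = A \<partial>\<^sub>x\<^sup>3 v + (r \<partial>\<^sub>x A + B) \<partial>\<^sub>x\<^sup>2 v\<close> up to terms of order one, where \<open>A\<close> and \<open>B\<close> are the
  partial derivatives of the nonlinearity in \<open>\<partial>\<^sub>x\<^sup>3 u\<close> and \<open>\<partial>\<^sub>x\<^sup>2 u\<close>. As \<open>\<gamma>0 \<noteq> 0\<close>, multiplying by a factor
  \<open>1 + \<rho>\<^sub>1 / k + \<rho>\<^sub>2 / k\<^sup>2\<close> at frequency \<open>k\<close> removes the oscillating parts of \<open>A\<close> and \<open>B\<close>, again up to terms of
  order one. The mean of \<open>A\<close> is real and only rotates the phase, \<open>\<partial>\<^sub>x A\<close> has mean zero, and the mean of \<open>B\<close> is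
  \<open>P\<^sub>N(u)\<close>. So the modified coefficient \<open>z\<close> satisfies \<open>z' = \<lambda> z + O(\<bar>k\<bar>\<^bsup>1-(s-r)\<^esup>)\<close> with \<open>Re \<lambda> = - P\<^sub>N(u) k\<^sup>2\<close>, and at
  every later time \<open>z = O(\<bar>k\<bar>\<^bsup>-1-(s-r)\<^esup>)\<close>. Working with single Fourier coefficients in weighted
  sup norms, instead of energies, makes all these manipulations legitimate at the given regularity.
\<close>

text \<open>A corrector is a product with \<rho>1 or \<rho>2 followed by one or two divisions by the
  frequency; its commutator with the fifth-order term has order 3, respectively 2. Cancelling the
  two leading terms thus prescribes the x-derivatives of \<rho>1 and \<rho>2. A periodic primitive
  exists only for functions of mean zero, so exactly the means of \<open>A\<close> and
  \<open>B\<close> survive. The first corrector also meets \<open>A\<close> itself and feeds \<rho>1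
  (A - mean A) into the second equation. This does not spoil the sign condition: by the first
  equation the product is a multiple of the derivative of the square of \<rho>1.

  Constants: differentiated s - 7 times, u keeps 7 powers of decay, so that five more derivatives
  leave 2 powers, enough for summability, and an error of order one means 6 powers. The correctors
  depend on time; a time derivative of \<open>A\<close> costs three derivatives and, by the
  equation, five more, and the remaining 13 - 3 - 5 = 5 powers become the required 6 after one
  division by the frequency.\<close>

no_notation Infinite_Set_Sum.abs_summable_on (infix \<open>abs'_summable'_on\<close> 50)

subsection \<open>The Wiener algebra of the circle\<close>

lemma conv_summable_real:
  fixes f g :: "int \<Rightarrow> real"
  assumes "f summable_on UNIV" "g summable_on UNIV" "\<And>n. f n \<ge> 0" "\<And>n. g n \<ge> 0"
  shows "(\<lambda>(n, m). f m * g (n - m)) summable_on UNIV"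
proof -
  have "(\<lambda>(m, l). f m * g l) abs_summable_on UNIV \<times> UNIV"
    using assms
    by (intro iffD2[OF Infinite_Sum.abs_summable_on_Sigma_iff]) (auto simp: abs_mult infsum_cmult_right' intro!: summable_on_cmult_right summable_on_cmult_left)
  then have "(\<lambda>(m, l). f m * g l) summable_on UNIV \<times> UNIV"
    by (rule abs_summable_summable)
  moreover have "(\<lambda>(n, m). f m * g (n - m)) summable_on UNIV \<times> UNIV \<longleftrightarrow>
                 (\<lambda>(m, l). f m * g l) summable_on UNIV \<times> UNIV"
    by (rule summable_on_reindex_bij_witness[of _ "\<lambda>(m, l). (m + l, m)" "\<lambda>(n, m). (m, n - m)"]) auto
  ultimately show ?thesis
    by simp
qed

lemma conv_abs_summable:
  fixes f g :: "int \<Rightarrow> complex"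
  assumes "f abs_summable_on UNIV" "g abs_summable_on UNIV"
  shows "(\<lambda>(n, m). f m * g (n - m)) abs_summable_on UNIV \<times> UNIV"
  using conv_summable_real[OF assms] by (simp add: case_prod_unfold norm_mult)

text \<open>Absolutely summable sequences form a ring under convolution, so that a differential
  monomial in u is literally a product of ring elements. Values at points enter only through the
  evaluation \<open>ev\<close>.\<close>

typedef wiener = "{f :: int \<Rightarrow> complex. f abs_summable_on UNIV}"
  morphisms wc Abs_wiener
  by (rule exI[of _ "\<lambda>_. 0"]) simp

lemma wc_summable: "wc f abs_summable_on UNIV"
  using wc[of f] by simp

lemma wc_Abs: "f abs_summable_on UNIV \<Longrightarrow> wc (Abs_wiener f) = f"
  by (simp add: Abs_wiener_inverse)

lemma wiener_eqI: "(\<And>n. wc f n = wc g n) \<Longrightarrow> f = g"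
  by (metis ext wc_inject)

lemma delta_summable: "(\<lambda>n::int. if n = 0 then c else (0::complex)) abs_summable_on UNIV"
proof -
  have "(\<lambda>n::int. norm (if n = 0 then c else 0)) summable_on UNIV \<longleftrightarrow> (\<lambda>n::int. norm c) summable_on {0}"
    by (rule summable_on_cong_neutral) auto
  then show ?thesis by simp
qed

definition cst :: "complex \<Rightarrow> wiener" where
  "cst c = Abs_wiener (\<lambda>n. if n = 0 then c else 0)"

lemma wc_cst: "wc (cst c) n = (if n = 0 then c else 0)"
  unfolding cst_def using delta_summable by (subst wc_Abs) auto

instantiation wiener :: comm_ring_1
begin

definition "0 = cst 0"
definition "1 = cst 1"
definition "f + g = Abs_wiener (\<lambda>n. wc f n + wc g n)"
definition "f - g = Abs_wiener (\<lambda>n. wc f n - wc g n)"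
definition "- f = Abs_wiener (\<lambda>n. - wc f n)"
definition "f * g = Abs_wiener (\<lambda>n. \<Sum>\<^sub>\<infinity>m. wc f m * wc g (n - m))"

lemma wc_0 [simp]: "wc 0 n = 0"
  by (simp add: zero_wiener_def wc_cst)

lemma wc_1: "wc 1 n = (if n = 0 then 1 else 0)"
  by (simp add: one_wiener_def wc_cst)

lemma wc_add [simp]: "wc (f + g) n = wc f n + wc g n"
  unfolding plus_wiener_def
  by (subst wc_Abs, rule Infinite_Sum.abs_summable_on_comparison_test[where g = "\<lambda>n. norm (wc f n) + norm (wc g n)"])
     (auto intro!: summable_on_add wc_summable norm_triangle_ineq)

lemma wc_uminus [simp]: "wc (- f) n = - wc f n"
  unfolding uminus_wiener_def using wc_summable[of f] by (subst wc_Abs) auto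

lemma wc_diff [simp]: "wc (f - g) n = wc f n - wc g n"
proof -
  have "f - g = f + (- g)"
    unfolding minus_wiener_def plus_wiener_def by simp
  then show ?thesis by simp
qed

lemma conv_row_summable: "(\<lambda>m. wc f m * wc g (n - m)) abs_summable_on UNIV"
  using iffD1[OF Infinite_Sum.abs_summable_on_Sigma_iff conv_abs_summable[OF wc_summable[of f] wc_summable[of g]]]
  by auto

lemma wc_mult: "wc (f * g) n = (\<Sum>\<^sub>\<infinity>m. wc f m * wc g (n - m))"
proof -
  have *: "(\<lambda>n. \<Sum>\<^sub>\<infinity>m. norm (wc f m * wc g (n - m))) summable_on UNIV"
    using iffD1[OF Infinite_Sum.abs_summable_on_Sigma_iff conv_abs_summable[OF wc_summable[of f] wc_summable[of g]]]
    by (simp add: infsum_nonneg)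
  have "(\<lambda>n. \<Sum>\<^sub>\<infinity>m. wc f m * wc g (n - m)) abs_summable_on UNIV"
    by (rule Infinite_Sum.abs_summable_on_comparison_test'[OF *]) (rule norm_infsum_bound[OF conv_row_summable])
  then show ?thesis
    unfolding times_wiener_def by (simp add: wc_Abs)
qed

lemma wc_cst_mult [simp]: "wc (cst c * f) n = c * wc f n"
proof -
  have "wc (cst c * f) n = (\<Sum>\<^sub>\<infinity>m\<in>{0}. c * wc f (n - m))"
    unfolding wc_mult by (rule infsum_cong_neutral) (auto simp: wc_cst)
  then show ?thesis by simp
qed

instance
proof
  fix f g h :: wiener
  show "f + g + h = f + (g + h)" "f + g = g + f" "0 + f = f" "- f + f = 0" "f - g = f + - g"
    by (auto intro!: wiener_eqI)
  show "1 * f = f"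
    by (rule wiener_eqI) (simp add: one_wiener_def)
  show "(0::wiener) \<noteq> 1"
    using wc_0[of 0] wc_1[of 0] by (metis zero_neq_one)
  show "(f + g) * h = f * h + g * h"
    by (rule wiener_eqI)
       (simp add: wc_mult distrib_right infsum_add abs_summable_summable conv_row_summable)
  show "f * g = g * f"
  proof (rule wiener_eqI)
    fix n
    show "wc (f * g) n = wc (g * f) n"
      unfolding wc_mult
      by (rule infsum_reindex_bij_witness[of _ "\<lambda>m. n - m" "\<lambda>m. n - m"]) auto
  qed
  show "f * g * h = f * (g * h)"
  proof (rule wiener_eqI)
    fix n
    \<comment> \<open>Exchanging the two sums needs absolute summability of the triple product over
      pairs. The pairs already sum for \<open>f\<close> and \<open>g\<close>, so a mere bound for
      \<open>h\<close> suffices.\<close>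
    obtain M where M: "\<And>k. norm (wc h k) \<le> M"
    proof -
      have "norm (wc h k) \<le> (\<Sum>\<^sub>\<infinity>k. norm (wc h k))" for k
        using finite_sum_le_infsum[OF wc_summable[of h], of "{k}"] by simp
      then show ?thesis using that by blast
    qed
    have "(\<lambda>x. norm (case x of (m, j) \<Rightarrow> wc f j * wc g (m - j)) * M) summable_on UNIV \<times> UNIV"
      using conv_abs_summable[OF wc_summable[of f] wc_summable[of g]]
      by (rule summable_on_cmult_left)
    then have "(\<lambda>(m, j). wc f j * wc g (m - j) * wc h (n - m)) abs_summable_on UNIV \<times> UNIV"
      by (rule Infinite_Sum.abs_summable_on_comparison_test') (auto simp: norm_mult intro!: mult_left_mono M)
    then have s: "(\<lambda>(m, j). wc f j * wc g (m - j) * wc h (n - m)) summable_on UNIV \<times> UNIV"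
      by (rule abs_summable_summable)
    have "wc (f * g * h) n = (\<Sum>\<^sub>\<infinity>m. \<Sum>\<^sub>\<infinity>j. wc f j * wc g (m - j) * wc h (n - m))"
      by (simp add: wc_mult infsum_cmult_left')
    also have "\<dots> = (\<Sum>\<^sub>\<infinity>j. \<Sum>\<^sub>\<infinity>m. wc f j * wc g (m - j) * wc h (n - m))"
      by (rule infsum_swap_banach[OF s])
    also have "\<dots> = (\<Sum>\<^sub>\<infinity>j. wc f j * (\<Sum>\<^sub>\<infinity>m. wc g (m - j) * wc h (n - m)))"
      by (simp add: mult.assoc infsum_cmult_right')
    also have "\<dots> = (\<Sum>\<^sub>\<infinity>j. wc f j * (\<Sum>\<^sub>\<infinity>l. wc g l * wc h (n - j - l)))"
    proof (rule infsum_cong, rule arg_cong[where f = "times _"])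
      fix j
      show "(\<Sum>\<^sub>\<infinity>m. wc g (m - j) * wc h (n - m)) = (\<Sum>\<^sub>\<infinity>l. wc g l * wc h (n - j - l))"
        by (rule infsum_reindex_bij_witness[of _ "\<lambda>l. l + j" "\<lambda>m. m - j"]) (auto simp: algebra_simps)
    qed
    finally show "wc (f * g * h) n = wc (f * (g * h)) n"
      by (simp add: wc_mult)
  qed
qed

end

lemma wc_sum: "wc (\<Sum>i\<in>A. f i) n = (\<Sum>i\<in>A. wc (f i) n)"
  by (induction A rule: infinite_finite_induct) auto

lemma cst_0 [simp]: "cst 0 = 0" and cst_1 [simp]: "cst 1 = 1"
  by (simp_all add: zero_wiener_def one_wiener_def)

lemma cst_mult: "cst (a * b) = cst a * cst b"
  by (rule wiener_eqI) (simp add: wc_cst)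

lemma cst_add: "cst (a + b) = cst a + cst b"
  by (rule wiener_eqI) (simp add: wc_cst)

lemma cst_uminus: "cst (- a) = - cst a"
  by (rule wiener_eqI) (simp add: wc_cst)

lemma cst_diff: "cst (a - b) = cst a - cst b"
  by (rule wiener_eqI) (simp add: wc_cst)

lemma cst_of_nat: "cst (of_nat k) = of_nat k"
  by (induction k) (simp_all add: cst_add)

lemma cst_numeral: "cst (numeral k) = numeral k"
  using cst_of_nat[of "numeral k"] by simp

subsection \<open>Decay classes and multipliers\<close>

definition jb :: "int \<Rightarrow> real" where
  "jb n = 1 + \<bar>real_of_int n\<bar>"

lemma jb_ge_1 [simp]: "1 \<le> jb n" and jb_pos [simp]: "0 < jb n" and jb_nonneg [simp]: "0 \<le> jb n"
  and jb_0 [simp]: "jb 0 = 1" and abs_le_jb: "\<bar>real_of_int n\<bar> \<le> jb n"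
  by (auto simp: jb_def)

lemma jb_ne_0 [simp]: "jb n \<noteq> 0"
  using jb_pos[of n] by linarith

lemma jb_triangle: "jb n \<le> jb m + jb (n - m)"
  by (auto simp: jb_def)

lemma summable_on_int:
  fixes f :: "int \<Rightarrow> real"
  assumes "summable (\<lambda>n. f (int n))" "summable (\<lambda>n. f (- int n))" "\<And>n. f n \<ge> 0"
  shows "f summable_on UNIV"
proof -
  have *: "f summable_on (range int)"
    using assms by (subst summable_on_reindex) (auto simp: o_def summable_on_UNIV_nonneg_real_iff)
  have **: "f summable_on (range (\<lambda>n. - int n))"
    using assms by (subst summable_on_reindex) (auto simp: o_def inj_on_def summable_on_UNIV_nonneg_real_iff)
  have "UNIV = range int \<union> range (\<lambda>n. - int n)"
  proof (intro equalityI subsetI)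
    fix n :: int
    show "n \<in> range int \<union> range (\<lambda>n. - int n)"
      by (cases n rule: int_cases2) auto
  qed auto
  then show ?thesis
    using summable_on_union[OF * **] by simp
qed

lemma jb_summable: "s \<ge> 2 \<Longrightarrow> (\<lambda>n. 1 / jb n ^ s) summable_on UNIV"
proof -
  assume s: "s \<ge> 2"
  have "summable (\<lambda>n. inverse (real (n + 1) ^ s))"
    using inverse_power_summable[OF s, where 'a = real] by (subst summable_iff_shift) auto
  then have "summable (\<lambda>n. 1 / (1 + real n) ^ s)"
    by (simp add: inverse_eq_divide add.commute)
  then show ?thesis
    by (intro summable_on_int) (auto simp: jb_def)
qed

text \<open>One of m and n - m is at least half as large as n, measured by \<open>jb\<close>. Its
  weight is traded for the weight at n, and the other weight stays summable; this makes the decay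
  classes closed under convolution.\<close>

lemma jb_conv_bound:
  assumes "s \<ge> 2"
  shows "1 / jb m ^ s * (1 / jb (n - m) ^ s) \<le> 2 ^ s / jb n ^ s * (1 / jb m ^ s + 1 / jb (n - m) ^ s)"
proof -
  define a b where "a = jb m" and "b = jb (n - m)"
  have ab: "a > 0" "b > 0" unfolding a_def b_def by auto
  have "jb n ^ s \<le> (2 * max a b) ^ s"
    using jb_triangle[of n m] jb_nonneg[of n] by (intro power_mono) (auto simp: a_def b_def)
  also have "\<dots> \<le> 2 ^ s * (a ^ s + b ^ s)"
    using ab by (simp add: power_mult_distrib max_def)
  finally have "jb n ^ s \<le> 2 ^ s * (a ^ s + b ^ s)" .
  then show ?thesis
    using ab unfolding a_def[symmetric] b_def[symmetric] by (simp add: field_simps)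
qed

text \<open>The parameter is time, or a single point for a fixed function. One constant serves all
  parameters, so membership is a bound uniform in time.\<close>

definition X :: "nat \<Rightarrow> ('p \<Rightarrow> wiener) \<Rightarrow> bool" where
  "X s f \<longleftrightarrow> (\<exists>c. \<forall>p n. cmod (wc (f p) n) \<le> c / jb n ^ s)"

lemma XI: "(\<And>p n. cmod (wc (f p) n) \<le> c / jb n ^ s) \<Longrightarrow> X s f"
  unfolding X_def by blast

lemma XE:
  assumes "X s f"
  obtains c where "c \<ge> 0" "\<And>p n. cmod (wc (f p) n) \<le> c / jb n ^ s"
proof -
  from assms obtain c where c: "\<And>p n. cmod (wc (f p) n) \<le> c / jb n ^ s"
    unfolding X_def by blast
  have "c \<ge> 0"
    using order_trans[OF norm_ge_zero c[of undefined 0]] by simp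
  with c show ?thesis using that by blast
qed

lemma X_mono: "X s f \<Longrightarrow> s' \<le> s \<Longrightarrow> X s' f"
proof -
  assume "X s f" and s: "s' \<le> s"
  then obtain c where c: "c \<ge> 0" "\<And>p n. cmod (wc (f p) n) \<le> c / jb n ^ s"
    by (elim XE) blast
  have "c / jb n ^ s \<le> c / jb n ^ s'" for n
    using c(1) s by (intro divide_left_mono power_increasing) auto
  then show "X s' f"
    using c(2) by (intro XI[where c = c]) (meson order_trans)
qed

lemma X_add: "X s f \<Longrightarrow> X s g \<Longrightarrow> X s (f + g)"
proof -
  assume a: "X s f" "X s g"
  obtain c where "\<And>p n. cmod (wc (f p) n) \<le> c / jb n ^ s"
    using a(1) by (elim XE) blast
  moreover obtain d where "\<And>p n. cmod (wc (g p) n) \<le> d / jb n ^ s"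
    using a(2) by (elim XE) blast
  ultimately show "X s (f + g)"
    by (intro XI[where c = "c + d"])
       (auto simp: add_divide_distrib intro!: order_trans[OF norm_triangle_ineq] add_mono)
qed

lemma X_uminus: "X s f \<Longrightarrow> X s (- f)"
  by (auto simp: X_def)

lemma X_diff: "X s f \<Longrightarrow> X s g \<Longrightarrow> X s (f - g)"
  using X_add[OF _ X_uminus, of s f g] by simp

lemma X_0 [simp]: "X s 0"
  by (rule XI[where c = 0]) simp

lemma X_sum: "(\<And>i. i \<in> A \<Longrightarrow> X s (f i)) \<Longrightarrow> X s (\<Sum>i\<in>A. f i)"
  by (induction A rule: infinite_finite_induct) (auto intro: X_add)

section \<open>Multipliers: constants, means, division by the frequency, differentiation\<close>

definition Cc :: "complex \<Rightarrow> 'p \<Rightarrow> wiener" where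
  "Cc c = (\<lambda>_. cst c)"

definition mean :: "('p \<Rightarrow> wiener) \<Rightarrow> 'p \<Rightarrow> wiener" where
  "mean f = (\<lambda>p. cst (wc (f p) 0))"

text \<open>As \<open>z / 0 = 0\<close>, the operator \<open>K\<close> annihilates the mean.\<close>

definition K :: "('p \<Rightarrow> wiener) \<Rightarrow> 'p \<Rightarrow> wiener" where
  "K f = (\<lambda>p. Abs_wiener (\<lambda>n. wc (f p) n / of_int n))"

text \<open>
  Differentiation is a total operation with junk value \<open>0\<close> outside the Wiener algebra, so \<open>\<partial>\<^sub>x\<close> has its
  meaning only together with a decay assumption.
\<close>

definition wD :: "wiener \<Rightarrow> wiener" where
  "wD f = Abs_wiener (if (\<lambda>n. \<i> * of_int n * wc f n) abs_summable_on UNIV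
     then (\<lambda>n. \<i> * of_int n * wc f n) else (\<lambda>_. 0))"

definition D :: "('p \<Rightarrow> wiener) \<Rightarrow> 'p \<Rightarrow> wiener" where
  "D f = (\<lambda>p. wD (f p))"

lemma X_Cc: "X s (Cc c)"
  by (rule XI[where c = "cmod c"]) (simp add: Cc_def wc_cst)

lemma X_1: "X s 1"
  using X_Cc[of s 1] by (simp add: Cc_def one_fun_def)

lemma X_mean: "X s' f \<Longrightarrow> X s (mean f)"
proof -
  assume "X s' f"
  then obtain c where c: "c \<ge> 0" "\<And>p n. cmod (wc (f p) n) \<le> c / jb n ^ s'" by (elim XE) blast
  show "X s (mean f)"
    using c(1) c(2)[where n = 0] by (intro XI[where c = c]) (auto simp: mean_def wc_cst)
qed

lemma X_mult:
  assumes "X s f" "X s g" "s \<ge> 2"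
  shows "X s (f * g)"
proof -
  obtain c where c: "c \<ge> 0" "\<And>p n. cmod (wc (f p) n) \<le> c / jb n ^ s"
    using assms(1) by (elim XE) blast
  obtain d where d: "d \<ge> 0" "\<And>p n. cmod (wc (g p) n) \<le> d / jb n ^ s"
    using assms(2) by (elim XE) blast
  define S where "S = (\<Sum>\<^sub>\<infinity>n. 1 / jb n ^ s)"
  note js = jb_summable[OF assms(3)]
  show ?thesis
  proof (rule XI)
    fix p n
    have js': "(\<lambda>m. 1 / jb (n - m) ^ s) summable_on UNIV \<and> (\<Sum>\<^sub>\<infinity>m. 1 / jb (n - m) ^ s) = S"
    proof
      show "(\<lambda>m. 1 / jb (n - m) ^ s) summable_on UNIV"
        using js by (subst summable_on_reindex_bij_witness[of _ "\<lambda>m. n - m" "\<lambda>m. n - m"]) auto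
      show "(\<Sum>\<^sub>\<infinity>m. 1 / jb (n - m) ^ s) = S"
        unfolding S_def by (rule infsum_reindex_bij_witness[of _ "\<lambda>m. n - m" "\<lambda>m. n - m"]) auto
    qed
    have *: "((\<lambda>m. c * d * (2 ^ s / jb n ^ s * (1 / jb m ^ s + 1 / jb (n - m) ^ s))) has_sum
              c * d * (2 ^ s / jb n ^ s * (S + S))) UNIV"
      using js js' unfolding S_def
      by (intro has_sum_cmult_right has_sum_add) (auto simp: has_sum_iff)
    have "cmod (wc ((f * g) p) n) \<le> c * d * (2 ^ s / jb n ^ s * (S + S))"
      unfolding times_fun_apply wc_mult
    proof (rule norm_infsum_le[OF has_sum_infsum[OF abs_summable_summable[OF conv_row_summable]] *])
      fix m
      have "cmod (wc (f p) m * wc (g p) (n - m)) \<le> (c / jb m ^ s) * (d / jb (n - m) ^ s)"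
        unfolding norm_mult by (intro mult_mono c d) (use c d in auto)
      also have "\<dots> = c * d * (1 / jb m ^ s * (1 / jb (n - m) ^ s))"
        by simp
      also have "\<dots> \<le> c * d * (2 ^ s / jb n ^ s * (1 / jb m ^ s + 1 / jb (n - m) ^ s))"
        using c d assms(3) by (intro mult_left_mono jb_conv_bound) auto
      finally show "cmod (wc (f p) m * wc (g p) (n - m)) \<le> \<dots>" .
    qed
    then show "cmod (wc ((f * g) p) n) \<le> (c * d * 2 ^ s * (S + S)) / jb n ^ s"
      by simp
  qed
qed

lemma X_mult': "X s1 f \<Longrightarrow> X s2 g \<Longrightarrow> s \<le> s1 \<Longrightarrow> s \<le> s2 \<Longrightarrow> s \<ge> 2 \<Longrightarrow> X s (f * g)"
  by (meson X_mono X_mult)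

lemma wc_K: "wc (K f p) n = wc (f p) n / of_int n"
proof -
  have "(\<lambda>n. wc (f p) n / of_int n) abs_summable_on UNIV"
  proof (rule Infinite_Sum.abs_summable_on_comparison_test[OF wc_summable])
    fix n :: int
    have "\<bar>real_of_int n\<bar> \<ge> 1" if "n \<noteq> 0" using that by linarith
    then show "norm (wc (f p) n / of_int n) \<le> norm (wc (f p) n)"
      by (cases "n = 0") (auto simp: norm_divide divide_le_eq mult_le_cancel_left1)
  qed
  then show ?thesis unfolding K_def by (simp add: wc_Abs)
qed

lemma X_K: "X s f \<Longrightarrow> X (Suc s) (K f)"
proof -
  assume "X s f"
  then obtain c where c: "c \<ge> 0" "\<And>p n. cmod (wc (f p) n) \<le> c / jb n ^ s" by (elim XE) blast
  show ?thesis
  proof (rule XI)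
    fix p n
    show "cmod (wc (K f p) n) \<le> (2 * c) / jb n ^ Suc s"
    proof (cases "n = 0")
      case False
      then have n: "jb n \<le> 2 * \<bar>real_of_int n\<bar>"
        unfolding jb_def by linarith
      have "cmod (wc (K f p) n) \<le> (c / jb n ^ s) / \<bar>real_of_int n\<bar>"
        unfolding wc_K norm_divide using c(2)[of p n] by (simp only: norm_of_int) (intro divide_right_mono, auto)
      also have "\<dots> \<le> (c / jb n ^ s) / (jb n / 2)"
        using False n c(1) by (intro divide_left_mono) auto
      finally show ?thesis by (simp add: field_simps)
    qed (auto simp: wc_K c)
  qed
qed

lemma wc_wD:
  assumes "\<And>n. cmod (wc f n) \<le> c / jb n ^ 3"
  shows "wc (wD f) n = \<i> * of_int n * wc f n"
proof -
  have "(\<lambda>n. \<i> * of_int n * wc f n) abs_summable_on UNIV"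
  proof (rule Infinite_Sum.abs_summable_on_comparison_test'[OF summable_on_cmult_right[OF jb_summable[of 2]]])
    fix n :: int
    have "norm (\<i> * of_int n * wc f n) \<le> jb n * (c / jb n ^ 3)"
      unfolding norm_mult using assms[of n] by (intro mult_mono) (auto simp: abs_le_jb)
    then show "norm (\<i> * of_int n * wc f n) \<le> c * (1 / jb n ^ 2)"
      by (simp add: power3_eq_cube power2_eq_square)
  qed simp
  then show ?thesis
    unfolding wD_def by (simp add: wc_Abs)
qed

lemma wc_D: "X s f \<Longrightarrow> s \<ge> 3 \<Longrightarrow> wc (D f p) n = \<i> * of_int n * wc (f p) n"
proof -
  assume "X s f" "s \<ge> 3"
  then have "X 3 f" by (rule X_mono)
  then obtain c where "\<And>p n. cmod (wc (f p) n) \<le> c / jb n ^ 3" by (elim XE) blast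
  then show ?thesis unfolding D_def by (rule wc_wD)
qed

lemmas wc_D3 = wc_D[of 3, OF _ order_refl]

lemma X_D: "X (Suc s) f \<Longrightarrow> s \<ge> 2 \<Longrightarrow> X s (D f)"
proof -
  assume a: "X (Suc s) f" "s \<ge> 2"
  then obtain c where c: "c \<ge> 0" "\<And>p n. cmod (wc (f p) n) \<le> c / jb n ^ Suc s" by (elim XE) blast
  show ?thesis
  proof (rule XI)
    fix p n
    have "cmod (wc (D f p) n) \<le> jb n * (c / jb n ^ Suc s)"
      using a c(2)[of p n]
      by (subst wc_D[OF a(1)], simp, unfold norm_mult, intro mult_mono) (auto simp: abs_le_jb)
    then show "cmod (wc (D f p) n) \<le> c / jb n ^ s" by simp
  qed
qed

lemma X_D': "X s' f \<Longrightarrow> s' \<ge> Suc s \<Longrightarrow> s \<ge> 2 \<Longrightarrow> X s (D f)"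
  using X_D X_mono by blast

lemma X_Dpow: "X (s + j) f \<Longrightarrow> s \<ge> 2 \<Longrightarrow> X s ((D ^^ j) f)"
proof (induction j arbitrary: s)
  case (Suc j)
  then have "X (Suc s) ((D ^^ j) f)" by simp
  then show ?case using Suc.prems by (simp add: X_D)
qed simp

text \<open>Division by n recovers f from \<open>D f\<close> except at n = 0, where the second
  assumption supplies the bound. That assumption also ensures that \<open>D f\<close> is the true
  derivative and not the default value.\<close>

lemma X_of_D:
  assumes "X s (D f)" "X 3 f"
  shows "X (Suc s) f"
proof -
  obtain c where c: "c \<ge> 0" "\<And>p n. cmod (wc (D f p) n) \<le> c / jb n ^ s"
    using assms(1) by (elim XE) blast
  obtain d where d: "d \<ge> 0" "\<And>p n. cmod (wc (f p) n) \<le> d / jb n ^ 3"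
    using assms(2) by (elim XE) blast
  show ?thesis
  proof (rule XI)
    fix p n
    show "cmod (wc (f p) n) \<le> (2 * c + d) / jb n ^ Suc s"
    proof (cases "n = 0")
      case False
      then have n: "jb n \<le> 2 * \<bar>real_of_int n\<bar>"
        unfolding jb_def by linarith
      have "jb n * cmod (wc (f p) n) \<le> 2 * (\<bar>real_of_int n\<bar> * cmod (wc (f p) n))"
        using n by (simp add: mult_right_mono flip: mult.assoc)
      also have "\<bar>real_of_int n\<bar> * cmod (wc (f p) n) = cmod (wc (D f p) n)"
        using wc_D[OF assms(2)] by (simp add: norm_mult)
      also have "2 * \<dots> \<le> (2 * c + d) / jb n ^ s"
      proof -
        have "0 \<le> d / jb n ^ s" using d(1) by simp
        then show ?thesis using c(2)[of p n] by (simp add: add_divide_distrib)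
      qed
      finally show ?thesis
        by (simp add: field_simps)
    qed (use c d(2)[of p 0] in auto)
  qed
qed

section \<open>Algebraic rules for the multipliers\<close>

lemma fam_eqI: "(\<And>p n. wc (f p) n = wc (g p) n) \<Longrightarrow> f = g"
  by (intro ext wiener_eqI)

lemma wc_Cc_mult [simp]: "wc (Cc c p * f) n = c * wc f n"
  by (simp add: Cc_def)

lemma wc_mean_mult [simp]: "wc (mean h p * f) n = wc (h p) 0 * wc f n"
  by (simp add: mean_def)

lemma D_add: "X 3 f \<Longrightarrow> X 3 g \<Longrightarrow> D (f + g) = D f + D g"
  by (rule fam_eqI) (simp add: wc_D3 X_add algebra_simps)

lemma D_diff: "X 3 f \<Longrightarrow> X 3 g \<Longrightarrow> D (f - g) = D f - D g"
  by (rule fam_eqI) (simp add: wc_D3 X_diff algebra_simps)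

lemma D_Cc_mult: "X 3 f \<Longrightarrow> D (Cc c * f) = Cc c * D f"
  by (rule fam_eqI) (simp add: wc_D3 X_mult X_Cc)

lemma D_mean: "X 0 h \<Longrightarrow> D (mean h) = 0"
proof (rule fam_eqI)
  fix p n
  assume "X 0 h"
  then have "X 3 (mean h)" by (rule X_mean)
  then show "wc (D (mean h) p) n = wc (0 p) n"
    by (simp add: wc_D3) (simp add: mean_def wc_cst)
qed

lemma D_mult:
  assumes "X 3 f" "X 3 g"
  shows "D (f * g) = D f * g + f * D g"
proof (rule fam_eqI)
  fix p n
  have "wc (D (f * g) p) n = (\<Sum>\<^sub>\<infinity>m. \<i> * of_int n * (wc (f p) m * wc (g p) (n - m)))"
    using assms by (simp add: wc_D3 X_mult wc_mult infsum_cmult_right')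
  also have "\<dots> = (\<Sum>\<^sub>\<infinity>m. wc (D f p) m * wc (g p) (n - m) + wc (f p) m * wc (D g p) (n - m))"
    using assms by (intro infsum_cong) (simp add: wc_D3 algebra_simps)
  also have "\<dots> = wc ((D f * g + f * D g) p) n"
    by (simp add: wc_mult infsum_add abs_summable_summable conv_row_summable)
  finally show "wc (D (f * g) p) n = wc ((D f * g + f * D g) p) n" .
qed

lemma K_add: "K (f + g) = K f + K g"
  by (rule fam_eqI) (simp add: wc_K add_divide_distrib)

lemma K_diff: "K (f - g) = K f - K g"
  by (rule fam_eqI) (simp add: wc_K diff_divide_distrib)

lemma K_Cc_mult: "K (Cc c * f) = Cc c * K f"
  by (rule fam_eqI) (simp add: wc_K)

lemma K_mean_mult: "K (mean h * f) = mean h * K f"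
  by (rule fam_eqI) (simp add: wc_K)

lemma D_K: "X 2 f \<Longrightarrow> D (K f) = Cc \<i> * (f - mean f)"
  using X_K[of 2 f] by (intro fam_eqI) (auto simp: wc_D3 wc_K mean_def wc_cst eval_nat_numeral)

lemma K_D: "X 3 f \<Longrightarrow> K (D f) = Cc \<i> * (f - mean f)"
  by (intro fam_eqI) (auto simp: wc_D3 wc_K mean_def wc_cst)

lemma wc_Dpow: "X (j + 2) f \<Longrightarrow> wc ((D ^^ j) f p) n = (\<i> * of_int n) ^ j * wc (f p) n"
proof (induction j)
  case (Suc j)
  have "X 3 ((D ^^ j) f)"
    using Suc.prems by (intro X_Dpow) (auto simp: eval_nat_numeral)
  then show ?case
    using Suc.IH X_mono[OF Suc.prems] by (simp add: wc_D3)
qed simp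

lemma Dpow_add: "X (j + 2) f \<Longrightarrow> X (j + 2) g \<Longrightarrow> (D ^^ j) (f + g) = (D ^^ j) f + (D ^^ j) g"
  by (rule fam_eqI) (simp add: wc_Dpow X_add algebra_simps)

lemma Dpow_Cc_mult: "X (j + 2) f \<Longrightarrow> (D ^^ j) (Cc c * f) = Cc c * (D ^^ j) f"
  by (rule fam_eqI) (simp add: wc_Dpow X_mult X_Cc)

lemma Dpow_K: "X (j + 2) f \<Longrightarrow> (D ^^ j) (K f) = K ((D ^^ j) f)"
  using X_mono[OF X_K, of "j + 2" f "j + 2"] by (intro fam_eqI) (simp add: wc_Dpow wc_K)

lemma wc_fam_sum: "wc ((\<Sum>i\<in>A. f i) p) n = (\<Sum>i\<in>A. wc (f i p) n)"
  by (induction A rule: infinite_finite_induct) auto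

lemma has_sum_finite_sum:
  fixes f :: "'i \<Rightarrow> 'a \<Rightarrow> 'b :: real_normed_vector"
  assumes "\<And>i. i \<in> A \<Longrightarrow> (f i has_sum s i) S"
  shows "((\<lambda>m. \<Sum>i\<in>A. f i m) has_sum (\<Sum>i\<in>A. s i)) S"
  using assms by (induction A rule: infinite_finite_induct) (auto intro!: has_sum_add)

text \<open>For frequencies m and n - m all the operators are multiplications, and the identity is
  the binomial theorem for \<i> m + \<i> (n - m). The assumed decay keeps every intermediate
  derivative summable.\<close>

lemma Dpow_mult:
  assumes "X (r + 2) f" "X (r + 2) g"
  shows "(D ^^ r) (f * g) = (\<Sum>i\<le>r. Cc (of_nat (r choose i)) * ((D ^^ i) f * (D ^^ (r - i)) g))"
proof (rule fam_eqI)
  fix p n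
  have hs: "((\<lambda>m. wc (F p) m * wc (G p) (n - m)) has_sum wc ((F * G) p) n) UNIV" for F G :: "'a \<Rightarrow> wiener"
    by (simp add: wc_mult has_sum_iff abs_summable_summable conv_row_summable)
  have "((\<lambda>m. \<Sum>i\<le>r. of_nat (r choose i) * (wc ((D ^^ i) f p) m * wc ((D ^^ (r - i)) g p) (n - m))) has_sum
         (\<Sum>i\<le>r. of_nat (r choose i) * wc (((D ^^ i) f * (D ^^ (r - i)) g) p) n)) UNIV"
    by (intro has_sum_finite_sum has_sum_cmult_right hs)
  moreover have "(\<Sum>i\<le>r. of_nat (r choose i) * (wc ((D ^^ i) f p) m * wc ((D ^^ (r - i)) g p) (n - m))) =
      (\<i> * of_int n) ^ r * (wc (f p) m * wc (g p) (n - m))" for m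
  proof -
    have "(\<Sum>i\<le>r. of_nat (r choose i) * (wc ((D ^^ i) f p) m * wc ((D ^^ (r - i)) g p) (n - m))) =
      (\<Sum>i\<le>r. of_nat (r choose i) * (\<i> * of_int m) ^ i * (\<i> * of_int (n - m)) ^ (r - i)) * (wc (f p) m * wc (g p) (n - m))"
      unfolding sum_distrib_right
    proof (intro sum.cong refl)
      fix i assume "i \<in> {..r}"
      then have "X (i + 2) f" "X (r - i + 2) g"
        using assms by (auto elim: X_mono)
      then show "of_nat (r choose i) * (wc ((D ^^ i) f p) m * wc ((D ^^ (r - i)) g p) (n - m)) =
        of_nat (r choose i) * (\<i> * of_int m) ^ i * (\<i> * of_int (n - m)) ^ (r - i) * (wc (f p) m * wc (g p) (n - m))"
        by (simp only: wc_Dpow) (simp add: algebra_simps)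
    qed
    also have "(\<Sum>i\<le>r. of_nat (r choose i) * (\<i> * of_int m) ^ i * (\<i> * of_int (n - m)) ^ (r - i)) =
        (\<i> * of_int m + \<i> * of_int (n - m)) ^ r"
      by (rule binomial_ring[symmetric])
    finally show ?thesis
      by (simp add: algebra_simps)
  qed
  ultimately have "((\<lambda>m. (\<i> * of_int n) ^ r * (wc (f p) m * wc (g p) (n - m))) has_sum
         (\<Sum>i\<le>r. of_nat (r choose i) * wc (((D ^^ i) f * (D ^^ (r - i)) g) p) n)) UNIV"
    by simp
  moreover have "((\<lambda>m. (\<i> * of_int n) ^ r * (wc (f p) m * wc (g p) (n - m))) has_sum
      (\<i> * of_int n) ^ r * wc ((f * g) p) n) UNIV"
    by (intro has_sum_cmult_right hs)
  ultimately have "(\<i> * of_int n) ^ r * wc ((f * g) p) n =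
      (\<Sum>i\<le>r. of_nat (r choose i) * wc (((D ^^ i) f * (D ^^ (r - i)) g) p) n)"
    using has_sum_unique by blast
  then show "wc ((D ^^ r) (f * g) p) n =
      wc ((\<Sum>i\<le>r. Cc (of_nat (r choose i)) * ((D ^^ i) f * (D ^^ (r - i)) g)) p) n"
    using assms by (simp add: wc_Dpow X_mult wc_fam_sum)
qed

subsection \<open>Time derivatives of Fourier coefficients\<close>

text \<open>Turns an unconditional sum over the integers into a series along an enumeration, the
  form in which the Weierstrass test and termwise differentiation apply.\<close>

lemma sums_int_decode:
  fixes f :: "int \<Rightarrow> 'a :: real_normed_vector"
  assumes "f summable_on UNIV"
  shows "(\<lambda>k. f (int_decode k)) sums (\<Sum>\<^sub>\<infinity>m. f m)"
  using has_sum_infsum[OF assms] has_sum_reindex_bij_betw[OF bij_int_decode, of f]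
  by (intro has_sum_imp_sums) blast

lemma
  fixes h d :: "int \<Rightarrow> real \<Rightarrow> complex"
  assumes M: "M summable_on UNIV" and h: "\<And>m t. t \<in> I \<Longrightarrow> norm (h m t) \<le> M m"
  shows continuous_on_infsum_int:
      "(\<And>m. continuous_on I (h m)) \<Longrightarrow> continuous_on I (\<lambda>t. \<Sum>\<^sub>\<infinity>m. h m t)"
    and has_vector_derivative_infsum_int:
      "open I \<Longrightarrow> t \<in> I \<Longrightarrow> (\<And>m t. t \<in> I \<Longrightarrow> (h m has_vector_derivative d m t) (at t)) \<Longrightarrow>
       (\<And>m t. t \<in> I \<Longrightarrow> norm (d m t) \<le> M' m) \<Longrightarrow> M' summable_on UNIV \<Longrightarrow>
       ((\<lambda>t. \<Sum>\<^sub>\<infinity>m. h m t) has_vector_derivative (\<Sum>\<^sub>\<infinity>m. d m t)) (at t)"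
proof -
  have sh: "(\<lambda>k. g (int_decode k) t) sums (\<Sum>\<^sub>\<infinity>m. g m t)"
    if "t \<in> I" "\<And>m t. t \<in> I \<Longrightarrow> norm (g m t) \<le> N m" "N summable_on UNIV" for g :: "int \<Rightarrow> real \<Rightarrow> complex" and N t
    by (rule sums_int_decode[of "\<lambda>m. g m t"], rule abs_summable_summable)
       (rule Infinite_Sum.abs_summable_on_comparison_test'[OF that(3) that(2)[OF that(1)]])
  have ul: "uniform_limit I (\<lambda>k t. \<Sum>i<k. g (int_decode i) t) (\<lambda>t. \<Sum>\<^sub>\<infinity>m. g m t) sequentially"
    if "\<And>m t. t \<in> I \<Longrightarrow> norm (g m t) \<le> N m" "N summable_on UNIV" for g :: "int \<Rightarrow> real \<Rightarrow> complex" and N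
  proof -
    have "uniform_limit I (\<lambda>k t. \<Sum>i<k. g (int_decode i) t) (\<lambda>t. \<Sum>i. g (int_decode i) t) sequentially"
      by (rule Weierstrass_m_test[OF that(1) sums_summable[OF sums_int_decode[OF that(2)]]])
    then show ?thesis
      by (rule uniform_limit_cong'[THEN iffD1, rotated 2]) (auto intro: sums_unique[symmetric] sh[OF _ that])
  qed
  show "continuous_on I (\<lambda>t. \<Sum>\<^sub>\<infinity>m. h m t)" if "\<And>m. continuous_on I (h m)"
    by (rule uniform_limit_theorem[OF _ ul[where g = h, OF h M]]) (auto intro!: always_eventually continuous_on_sum that)
  assume I: "open I" "t \<in> I" and d: "\<And>m t. t \<in> I \<Longrightarrow> (h m has_vector_derivative d m t) (at t)"
    and M': "\<And>m t. t \<in> I \<Longrightarrow> norm (d m t) \<le> M' m" "M' summable_on UNIV"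
  \<comment> \<open>Termwise differentiation is carried out on a convex set, hence on a
    ball.\<close>
  obtain e where e: "e > 0" "ball t e \<subseteq> I"
    using I by (meson open_contains_ball)
  have "\<exists>g. \<forall>x\<in>ball t e. (\<lambda>n. h (int_decode n) x) sums (g x) \<and>
      (g has_derivative (\<lambda>y. y *\<^sub>R (\<Sum>\<^sub>\<infinity>m. d m x))) (at x within ball t e)"
  proof (rule has_derivative_series[where f' = "\<lambda>k x y. y *\<^sub>R d (int_decode k) x"])
    show "((h (int_decode k)) has_derivative (\<lambda>y. y *\<^sub>R d (int_decode k) x)) (at x within ball t e)"
      if "x \<in> ball t e" for k x
    proof -
      have "x \<in> I" using that e by auto
      from d[OF this] show ?thesis
        unfolding has_vector_derivative_def by (rule has_derivative_at_withinI)
    qed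
    show "\<forall>\<^sub>F k in sequentially. \<forall>x\<in>ball t e. \<forall>y.
        norm ((\<Sum>i<k. y *\<^sub>R d (int_decode i) x) - y *\<^sub>R (\<Sum>\<^sub>\<infinity>m. d m x)) \<le> e' * norm y" if "e' > 0" for e'
      using uniform_limitD[OF ul[where g = d, OF M'] that, simplified]
    proof eventually_elim
      case (elim k)
      show ?case
      proof (intro ballI allI)
        fix x y assume "x \<in> ball t e"
        then have "norm ((\<Sum>i<k. d (int_decode i) x) - (\<Sum>\<^sub>\<infinity>m. d m x)) \<le> e'"
          using elim e by (force simp: dist_norm)
        then have "\<bar>y\<bar> * norm ((\<Sum>i<k. d (int_decode i) x) - (\<Sum>\<^sub>\<infinity>m. d m x)) \<le> \<bar>y\<bar> * e'"
          by (intro mult_left_mono) auto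
        then show "norm ((\<Sum>i<k. y *\<^sub>R d (int_decode i) x) - y *\<^sub>R (\<Sum>\<^sub>\<infinity>m. d m x)) \<le> e' * norm y"
          by (simp add: mult.commute flip: scaleR_sum_right scaleR_diff_right)
      qed
    qed
    show "(\<lambda>k. h (int_decode k) t) sums (\<Sum>\<^sub>\<infinity>m. h m t)"
      by (rule sh[where g = h, OF I(2) h M])
  qed (use e in auto)
  then obtain g where g: "\<And>x. x \<in> ball t e \<Longrightarrow> (\<lambda>n. h (int_decode n) x) sums (g x)"
      "\<And>x. x \<in> ball t e \<Longrightarrow> (g has_derivative (\<lambda>y. y *\<^sub>R (\<Sum>\<^sub>\<infinity>m. d m x))) (at x within ball t e)"
    by blast
  have "(g has_vector_derivative (\<Sum>\<^sub>\<infinity>m. d m t)) (at t)"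
    using g(2)[of t] e by (simp add: has_vector_derivative_def at_within_open[of t "ball t e"])
  then show "((\<lambda>t. \<Sum>\<^sub>\<infinity>m. h m t) has_vector_derivative (\<Sum>\<^sub>\<infinity>m. d m t)) (at t)"
  proof (rule has_vector_derivative_transform_within_open)
    show "g x = (\<Sum>\<^sub>\<infinity>m. h m x)" if "x \<in> ball t e" for x
      using sums_unique2[OF g(1)[OF that] sh[where g = h, OF _ h M]] that e by auto
  qed (use e in auto)
qed

text \<open>Differentiability in time is asked of each coefficient separately, not in a norm. The
  uniform bounds needed to differentiate convolution sums termwise are carried by
  \<open>X\<close>.\<close>

definition TD :: "real set \<Rightarrow> (real \<Rightarrow> wiener) \<Rightarrow> (real \<Rightarrow> wiener) \<Rightarrow> bool" where
  "TD I f f' \<longleftrightarrow> (\<forall>t\<in>I. \<forall>n. ((\<lambda>t. wc (f t) n) has_vector_derivative wc (f' t) n) (at t))"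

lemma TD_add: "TD I f f' \<Longrightarrow> TD I g g' \<Longrightarrow> TD I (f + g) (f' + g')"
  by (auto simp: TD_def intro!: has_vector_derivative_add)

lemma TD_Cc_mult: "TD I f f' \<Longrightarrow> TD I (Cc c * f) (Cc c * f')"
  by (auto simp: TD_def intro!: has_vector_derivative_mult_right)

lemma TD_const: "TD I (\<lambda>_. a) 0"
  by (auto simp: TD_def)

lemma TD_K: "TD I f f' \<Longrightarrow> TD I (K f) (K f')"
  by (auto simp: TD_def wc_K intro!: has_vector_derivative_divide)

lemma TD_Dpow: "TD I f f' \<Longrightarrow> X (j + 2) f \<Longrightarrow> X (j + 2) f' \<Longrightarrow> TD I ((D ^^ j) f) ((D ^^ j) f')"
  by (auto simp: TD_def wc_Dpow intro!: has_vector_derivative_mult_right)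

lemma TD_mult:
  assumes "TD I f f'" "TD I g g'" "X 2 f" "X 2 f'" "X 2 g" "X 2 g'" "open I"
  shows "TD I (f * g) (f' * g + f * g')"
  unfolding TD_def
proof (intro ballI allI)
  fix t n assume t: "t \<in> I"
  have *: "\<exists>M. M summable_on UNIV \<and> (\<forall>t m. norm (wc (F t) m * wc (G t) (n - m)) \<le> M m)"
    if FG: "X 2 F" "X 2 G" for F G :: "real \<Rightarrow> wiener"
  proof -
    obtain c where c: "c \<ge> 0" "\<And>p n. cmod (wc (F p) n) \<le> c / jb n ^ 2"
      using FG(1) by (elim XE) blast
    obtain d where d: "d \<ge> 0" "\<And>p n. cmod (wc (G p) n) \<le> d / jb n ^ 2"
      using FG(2) by (elim XE) blast
    have "cmod (wc (F p) m * wc (G p) (n - m)) \<le> c * (1 / jb m ^ 2) * d" for p m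
    proof -
      have "d / jb (n - m) ^ 2 \<le> d / 1"
        using d(1) by (intro divide_left_mono) auto
      then have "cmod (wc (G p) (n - m)) \<le> d"
        using d(2)[of p "n - m"] by simp
      then show ?thesis
        unfolding norm_mult using c(1) c(2)[of p m] by (intro mult_mono) auto
    qed
    moreover have "(\<lambda>m. c * (1 / jb m ^ 2) * d) summable_on UNIV"
      by (intro summable_on_cmult_left summable_on_cmult_right jb_summable) auto
    ultimately show ?thesis by blast
  qed
  obtain M0 where M0: "M0 summable_on UNIV" "\<And>t m. norm (wc (f t) m * wc (g t) (n - m)) \<le> M0 m"
    using *[OF assms(3,5)] by blast
  obtain M1 where M1: "M1 summable_on UNIV" "\<And>t m. norm (wc (f' t) m * wc (g t) (n - m)) \<le> M1 m"
    using *[OF assms(4,5)] by blast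
  obtain M2 where M2: "M2 summable_on UNIV" "\<And>t m. norm (wc (f t) m * wc (g' t) (n - m)) \<le> M2 m"
    using *[OF assms(3,6)] by blast
  have "((\<lambda>t. \<Sum>\<^sub>\<infinity>m. wc (f t) m * wc (g t) (n - m)) has_vector_derivative
      (\<Sum>\<^sub>\<infinity>m. wc (f t) m * wc (g' t) (n - m) + wc (f' t) m * wc (g t) (n - m))) (at t)"
  proof (rule has_vector_derivative_infsum_int[OF M0 assms(7) t])
    show "((\<lambda>t. wc (f t) m * wc (g t) (n - m)) has_vector_derivative
        wc (f t) m * wc (g' t) (n - m) + wc (f' t) m * wc (g t) (n - m)) (at t)" if "t \<in> I" for m t
      using assms(1,2) that unfolding TD_def by (intro has_vector_derivative_mult) auto
    show "norm (wc (f t) m * wc (g' t) (n - m) + wc (f' t) m * wc (g t) (n - m)) \<le> M2 m + M1 m" for t m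
      using norm_triangle_mono[OF M2(2) M1(2)] .
    show "(\<lambda>m. M2 m + M1 m) summable_on UNIV"
      by (intro summable_on_add M1 M2)
  qed
  also have "(\<Sum>\<^sub>\<infinity>m. wc (f t) m * wc (g' t) (n - m) + wc (f' t) m * wc (g t) (n - m)) =
      wc ((f' * g + f * g') t) n"
    by (simp add: wc_mult infsum_add abs_summable_summable conv_row_summable)
  finally show "((\<lambda>t. wc ((f * g) t) n) has_vector_derivative wc ((f' * g + f * g') t) n) (at t)"
    by (simp add: wc_mult)
qed

(* eta-expanded families would otherwise be unfolded pointwise *)
lemmas fam_apply = times_fun_apply plus_fun_apply minus_apply uminus_apply zero_fun_apply
  one_fun_apply numeral_fun_apply of_nat_fun_apply

declare fam_apply [simp del]

subsection \<open>The two leading terms of a high derivative of the nonlinearity\<close>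

locale sobolev_family =
  fixes r :: nat and u :: "'p \<Rightarrow> wiener"
  assumes r: "r \<ge> 6" and u: "X (r + 7) u"
begin

definition v :: "nat \<Rightarrow> 'p \<Rightarrow> wiener" where
  "v j = (D ^^ (r + j)) u"

lemma D_v: "D (v j) = v (Suc j)"
  by (simp add: v_def)

lemma X_v: "j \<le> 5 \<Longrightarrow> s + j \<le> 7 \<Longrightarrow> X s (v j)"
proof -
  assume "j \<le> 5" "s + j \<le> 7"
  then have "X (7 - j) (v j)"
    unfolding v_def using u by (intro X_Dpow) (auto simp: add.commute)
  then show "X s (v j)"
    using \<open>s + j \<le> 7\<close> by (rule_tac X_mono) auto
qed

text \<open>
  Modulo operators of order one, the \<open>r\<close>-th derivative of \<open>f\<close> is that of \<open>A \<partial>\<^sub>x\<^sup>3 u + B \<partial>\<^sub>x\<^sup>2 u\<close>: for a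
  differential polynomial \<open>f\<close>, \<open>A\<close> and \<open>B\<close> are its partial derivatives in \<open>\<partial>\<^sub>x\<^sup>3 u\<close> and \<open>\<partial>\<^sub>x\<^sup>2 u\<close>.
\<close>

definition Lin :: "('p \<Rightarrow> wiener) \<Rightarrow> ('p \<Rightarrow> wiener) \<Rightarrow> ('p \<Rightarrow> wiener) \<Rightarrow> bool" where
  "Lin f A B \<longleftrightarrow> X (r + 4) f \<and> X (r + 4) A \<and> X (r + 4) B \<and>
     X 6 ((D ^^ r) f - A * v 3 - (Cc (of_nat r) * D A + B) * v 2)"

text \<open>The Leibniz rule for a product also contains derivatives of order r - 1, paired with a
  first derivative of the other factor. Their leading part follows by integrating \<open>Lin\<close>
  once: the derivative of the difference has class 5, and \<open>X_of_D\<close> gives class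
  6.\<close>

lemma Lin_lower:
  assumes "Lin f A B"
  shows "X 6 ((D ^^ (r - 1)) f - A * v 2)"
proof -
  have f: "X (r + 4) f" and A: "X (r + 4) A" and B: "X (r + 4) B"
    and R: "X 6 ((D ^^ r) f - A * v 3 - (Cc (of_nat r) * D A + B) * v 2)"
    using assms by (auto simp: Lin_def)
  have 1: "X 5 ((D ^^ (r - 1)) f)"
    using r by (intro X_Dpow X_mono[OF f]) auto
  have 2: "X 5 (A * v 2)"
    using r by (intro X_mult X_v X_mono[OF A]) auto
  have DA: "X 5 (D A)" using r by (intro X_D'[OF A]) auto
  have "D ((D ^^ (r - 1)) f - A * v 2) = D ((D ^^ (r - 1)) f) - D (A * v 2)"
    using 1 2 by (intro D_diff) (auto elim: X_mono)
  also have "D ((D ^^ (r - 1)) f) = (D ^^ r) f"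
    using r by (cases r) auto
  also have "D (A * v 2) = D A * v 2 + A * v 3"
    using r by (subst D_mult) (auto simp: D_v intro: X_mono[OF A] X_v)
  finally have "D ((D ^^ (r - 1)) f - A * v 2) =
      ((D ^^ r) f - A * v 3 - (Cc (of_nat r) * D A + B) * v 2) + (Cc (of_nat r) * D A + B - D A) * v 2"
    by (simp add: algebra_simps)
  moreover have "X 5 \<dots>"
    using r by (intro X_add X_mult X_diff X_mono[OF R] X_v X_Cc DA X_mono[OF B]) auto
  ultimately have "X 5 (D ((D ^^ (r - 1)) f - A * v 2))"
    by simp
  then have "X (Suc 5) ((D ^^ (r - 1)) f - A * v 2)"
    by (rule X_of_D) (intro X_diff X_mono[OF 1] X_mono[OF 2], auto)
  then show ?thesis by simp
qed

text \<open>Only Leibniz terms with at most one derivative on one of the factors reach order two.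
  The cross terms r (D f) A' and r f (D A'), both in front of \<open>v 2\<close>, combine to r D (f
  A'); hence the shape \<open>Cc (of_nat r) * D A + B\<close> in \<open>Lin\<close> is stable under
  products.\<close>

lemma Lin_mult:
  assumes f: "Lin f A B" and g: "Lin g A' B'"
  shows "Lin (f * g) (f * A' + g * A) (f * B' + g * B)"
proof -
  have X: "X (r + 4) f" "X (r + 4) A" "X (r + 4) B" "X (r + 4) g" "X (r + 4) A'" "X (r + 4) B'"
    using f g by (auto simp: Lin_def)
  define S where "S = (D ^^ (r - 1)) f - A * v 2"
  define S' where "S' = (D ^^ (r - 1)) g - A' * v 2"
  define R where "R = (D ^^ r) f - A * v 3 - (Cc (of_nat r) * D A + B) * v 2"
  define R' where "R' = (D ^^ r) g - A' * v 3 - (Cc (of_nat r) * D A' + B') * v 2"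
  have XR: "X 6 S" "X 6 S'" "X 6 R" "X 6 R'"
    using f g Lin_lower[OF f] Lin_lower[OF g] unfolding S_def S'_def R_def R'_def by (auto simp: Lin_def)
  define T where "T i = Cc (of_nat (r choose i)) * ((D ^^ i) f * (D ^^ (r - i)) g)" for i
  \<comment> \<open>Neither factor is differentiated more than r - 2 times, and r + 4 - (r - 2) =
    6.\<close>
  have T: "X 6 (\<Sum>i=2..r-2. T i)"
  proof (rule X_sum)
    fix i assume i: "i \<in> {2..r - 2}"
    show "X 6 (T i)"
      unfolding T_def using i r
      by (intro X_mult X_Cc X_Dpow X_mono[OF X(1)] X_mono[OF X(4)]) auto
  qed
  have "(D ^^ r) (f * g) = (\<Sum>i\<le>r. T i)"
    unfolding T_def by (rule Dpow_mult[OF X_mono[OF X(1)] X_mono[OF X(4)]]) auto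
  also have "{..r} = {0, 1, r - 1, r} \<union> {2..r-2}"
    using r by auto
  also have "(\<Sum>i\<in>\<dots>. T i) = (T 0 + T 1 + T (r - 1) + T r) + (\<Sum>i=2..r-2. T i)"
    using r by (subst sum.union_disjoint) (auto simp: algebra_simps)
  also have "T 0 = f * (R' + A' * v 3 + (Cc (of_nat r) * D A' + B') * v 2)"
    by (simp add: T_def R'_def Cc_def one_fun_def[symmetric])
  also have "T r = g * (R + A * v 3 + (Cc (of_nat r) * D A + B) * v 2)"
    by (simp add: T_def R_def Cc_def one_fun_def[symmetric])
  also have "T 1 = Cc (of_nat r) * (D f * (S' + A' * v 2))"
    by (simp add: T_def S'_def)
  also have "T (r - 1) = Cc (of_nat r) * (D g * (S + A * v 2))"
  proof -
    have "r choose (r - 1) = r" using binomial_symmetric[of "r - 1" r] r by simp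
    moreover have "r - (r - 1) = 1" using r by simp
    ultimately show ?thesis by (simp add: T_def S_def)
  qed
  finally have eq: "(D ^^ r) (f * g) = f * (R' + A' * v 3 + (Cc (of_nat r) * D A' + B') * v 2) +
      Cc (of_nat r) * (D f * (S' + A' * v 2)) + Cc (of_nat r) * (D g * (S + A * v 2)) +
      g * (R + A * v 3 + (Cc (of_nat r) * D A + B) * v 2) + (\<Sum>i=2..r-2. T i)" .
  have D3: "X 3 f" "X 3 A" "X 3 g" "X 3 A'"
    by (rule X_mono, rule X, use r in simp)+
  have "D (f * A' + g * A) = D f * A' + f * D A' + (D g * A + g * D A)"
    by (simp add: D_add D_mult X_mult D3)
  then have "(D ^^ r) (f * g) - (f * A' + g * A) * v 3 - (Cc (of_nat r) * D (f * A' + g * A) + (f * B' + g * B)) * v 2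
      = f * R' + g * R + Cc (of_nat r) * (D f * S' + D g * S) + (\<Sum>i=2..r-2. T i)"
    unfolding eq by (simp add: algebra_simps)
  moreover have "X 6 \<dots>"
    using r by (intro X_add X_mult T XR X_Cc X_mono[OF X(1)] X_mono[OF X(4)] X_D'[OF X(1)] X_D'[OF X(4)]) auto
  ultimately show ?thesis
    unfolding Lin_def using X by (simp add: X_add X_mult)
qed

lemma Lin_1: "Lin 1 0 0"
proof -
  have "(D ^^ r) 1 = (0 :: 'p \<Rightarrow> wiener)"
  proof (rule fam_eqI)
    fix p :: 'p and n
    show "wc ((D ^^ r) 1 p) n = wc (0 p) n"
      using r by (subst wc_Dpow) (auto simp: X_1 wc_1 fam_apply)
  qed
  moreover have "D 0 = (0 :: 'p \<Rightarrow> wiener)"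
    by (rule fam_eqI) (simp add: wc_D3 fam_apply)
  ultimately show ?thesis by (simp add: Lin_def X_1)
qed

lemma Lin_0: "Lin 0 0 0"
proof -
  have "D 0 = (0 :: 'p \<Rightarrow> wiener)"
    by (rule fam_eqI) (simp add: wc_D3 fam_apply)
  moreover from this have "(D ^^ k) 0 = (0 :: 'p \<Rightarrow> wiener)" for k
    by (induction k) simp_all
  ultimately show ?thesis by (simp add: Lin_def)
qed

lemma Lin_add: "Lin f A B \<Longrightarrow> Lin g A' B' \<Longrightarrow> Lin (f + g) (A + A') (B + B')"
proof -
  assume f: "Lin f A B" and g: "Lin g A' B'"
  have X: "X (r + 4) f" "X (r + 4) A" "X (r + 4) B" "X (r + 4) g" "X (r + 4) A'" "X (r + 4) B'"
    using f g by (auto simp: Lin_def)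
  have "(D ^^ r) (f + g) = (D ^^ r) f + (D ^^ r) g"
    by (rule Dpow_add[OF X_mono[OF X(1)] X_mono[OF X(4)]]) auto
  moreover have "D (A + A') = D A + D A'"
    by (rule D_add[OF X_mono[OF X(2)] X_mono[OF X(5)]]) auto
  ultimately have "(D ^^ r) (f + g) - (A + A') * v 3 - (Cc (of_nat r) * D (A + A') + (B + B')) * v 2 =
     ((D ^^ r) f - A * v 3 - (Cc (of_nat r) * D A + B) * v 2) +
     ((D ^^ r) g - A' * v 3 - (Cc (of_nat r) * D A' + B') * v 2)"
    by (simp add: algebra_simps)
  moreover have "X 6 \<dots>"
    using f g by (intro X_add) (auto simp: Lin_def)
  ultimately show ?thesis
    unfolding Lin_def using X by (simp add: X_add)
qed

lemma Lin_Cc_mult: "Lin f A B \<Longrightarrow> Lin (Cc c * f) (Cc c * A) (Cc c * B)"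
proof -
  assume f: "Lin f A B"
  have X: "X (r + 4) f" "X (r + 4) A" "X (r + 4) B"
    using f by (auto simp: Lin_def)
  have "(D ^^ r) (Cc c * f) = Cc c * (D ^^ r) f"
    by (rule Dpow_Cc_mult[OF X_mono[OF X(1)]]) auto
  moreover have "D (Cc c * A) = Cc c * D A"
    by (rule D_Cc_mult[OF X_mono[OF X(2)]]) auto
  ultimately have "(D ^^ r) (Cc c * f) - (Cc c * A) * v 3 - (Cc (of_nat r) * D (Cc c * A) + Cc c * B) * v 2 =
     Cc c * ((D ^^ r) f - A * v 3 - (Cc (of_nat r) * D A + B) * v 2)"
    by (simp add: algebra_simps)
  moreover have "X 6 \<dots>"
    using f by (intro X_mult X_Cc) (auto simp: Lin_def)
  ultimately show ?thesis
    unfolding Lin_def using X by (simp add: X_mult X_Cc)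
qed

lemma Lin_sum: "(\<And>j. j \<in> S \<Longrightarrow> Lin (f j) (A j) (B j)) \<Longrightarrow> Lin (\<Sum>j\<in>S. f j) (\<Sum>j\<in>S. A j) (\<Sum>j\<in>S. B j)"
  by (induction S rule: infinite_finite_induct) (auto intro: Lin_add Lin_0)

text \<open>Base cases: \<open>v 0\<close> and \<open>v 1\<close> have class 6 already, so u and its
  first derivative contribute nothing to \<open>A\<close> and \<open>B\<close>.\<close>

lemma Lin_D:
  assumes "j \<le> 3"
  shows "Lin ((D ^^ j) u) (if j = 3 then 1 else 0) (if j = 2 then 1 else 0)"
proof -
  have *: "X (r + 4) ((D ^^ j) u)"
    by (intro X_Dpow X_mono[OF u]) (use assms in auto)
  have "(D ^^ r) ((D ^^ j) u) = v j"
    by (simp add: v_def funpow_add)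
  moreover have "X 6 (v 1)" "X 6 (v 0)" "D 1 = (0 :: 'p \<Rightarrow> wiener)" "D 0 = (0 :: 'p \<Rightarrow> wiener)"
    by (auto intro!: X_v fam_eqI simp: wc_D3 X_1 wc_1 fam_apply)
  moreover have "j = 0 \<or> j = 1 \<or> j = 2 \<or> j = 3" using assms by auto
  ultimately show ?thesis
    using * by (auto simp: Lin_def X_1)
qed

lemma Lin_power:
  assumes "Lin f A B"
  shows "Lin (f ^ k) (of_nat k * f ^ (k - 1) * A) (of_nat k * f ^ (k - 1) * B)"
proof (induction k)
  case (Suc k)
  have "f * (of_nat k * f ^ (k - 1) * Y) + f ^ k * Y = of_nat (Suc k) * f ^ (Suc k - 1) * Y" for Y
    by (cases k) (simp_all add: algebra_simps)
  then show ?case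
    using Lin_mult[OF assms Suc.IH] by simp
qed (simp add: Lin_1)

lemma Lin_monomial:
  "Lin (Cc l * ((D ^^ 3) u) ^ a * ((D ^^ 2) u) ^ b * (D u) ^ c * u ^ d)
     (Cc l * of_nat a * ((D ^^ 3) u) ^ (a - 1) * ((D ^^ 2) u) ^ b * (D u) ^ c * u ^ d)
     (Cc l * of_nat b * ((D ^^ 3) u) ^ a * ((D ^^ 2) u) ^ (b - 1) * (D u) ^ c * u ^ d)"
proof -
  note L = Lin_D[of 3] Lin_D[of 2] Lin_D[of 1] Lin_D[of 0]
  have "Lin (Cc l * (((D ^^ 3) u) ^ a * (((D ^^ 2) u) ^ b * ((D u) ^ c * u ^ d))))
     (Cc l * (((D ^^ 3) u) ^ a * 0 + (((D ^^ 2) u) ^ b * ((D u) ^ c * u ^ d)) * (of_nat a * ((D ^^ 3) u) ^ (a - 1) * 1)))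
     (Cc l * (((D ^^ 3) u) ^ a * (((D ^^ 2) u) ^ b * 0 + ((D u) ^ c * u ^ d) * (of_nat b * ((D ^^ 2) u) ^ (b - 1) * 1))
       + (((D ^^ 2) u) ^ b * ((D u) ^ c * u ^ d)) * 0))"
  proof (rule Lin_Cc_mult, rule Lin_mult)
    show "Lin (((D ^^ 3) u) ^ a) (of_nat a * ((D ^^ 3) u) ^ (a - 1) * 1) 0"
      using Lin_power[OF L(1), of a] by simp
    have b: "Lin (((D ^^ 2) u) ^ b) 0 (of_nat b * ((D ^^ 2) u) ^ (b - 1) * 1)"
      using Lin_power[OF L(2), of b] by simp
    have c: "Lin ((D u) ^ c) 0 0"
      using Lin_power[OF L(3), of c] by simp
    have d: "Lin (u ^ d) 0 0"
      using Lin_power[OF L(4), of d] by simp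
    have cd: "Lin ((D u) ^ c * u ^ d) 0 0"
      using Lin_mult[OF c d] by simp
    show "Lin (((D ^^ 2) u) ^ b * ((D u) ^ c * u ^ d)) 0
       (((D ^^ 2) u) ^ b * 0 + ((D u) ^ c * u ^ d) * (of_nat b * ((D ^^ 2) u) ^ (b - 1) * 1))"
      using Lin_mult[OF b cd] by simp
  qed
  then show ?thesis
    by (simp add: mult_ac)
qed

end

subsection \<open>Normal form\<close>

lemma Cc_simps: "Cc (a * b) = Cc a * Cc b" "Cc (a + b) = Cc a + Cc b" "Cc (- a) = - Cc a"
    "Cc (a - b) = Cc a - Cc b" "Cc 1 = 1" "Cc 0 = 0"
  by (simp_all add: Cc_def cst_mult cst_add cst_diff cst_uminus fun_eq_iff fam_apply)

lemma D_Cc: "D (Cc c) = 0"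
  by (rule fam_eqI) (simp add: wc_D3 X_Cc, simp add: Cc_def wc_cst fam_apply)

lemma Cc_numeral: "Cc (numeral k) = numeral k"
  by (simp add: Cc_def cst_numeral fun_eq_iff fam_apply)

lemma Cc_i_i: "Cc \<i> * (Cc \<i> * f) = - f"
proof -
  have "Cc \<i> * (Cc \<i> * f) = Cc (\<i> * \<i>) * f"
    by (simp only: Cc_simps mult.assoc)
  then show ?thesis by (simp add: Cc_simps)
qed

lemma Dpow_3_mult:
  assumes "X 5 f" "X 5 g"
  shows "(D ^^ 3) (f * g) = f * (D ^^ 3) g + 3 * (D f * (D ^^ 2) g) + 3 * ((D ^^ 2) f * D g) + (D ^^ 3) f * g"
  using Dpow_mult[of 3 f g] assms
  by (simp add: eval_nat_numeral Cc_simps Cc_numeral[symmetric])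

lemma Dpow_5_mult:
  assumes "X 7 f" "X 7 g"
  shows "(D ^^ 5) (f * g) = f * (D ^^ 5) g + 5 * (D f * (D ^^ 4) g) + 10 * ((D ^^ 2) f * (D ^^ 3) g) +
    10 * ((D ^^ 3) f * (D ^^ 2) g) + 5 * ((D ^^ 4) f * D g) + (D ^^ 5) f * g"
  using Dpow_mult[of 5 f g] assms
  by (simp add: eval_nat_numeral Cc_simps Cc_numeral[symmetric])

text \<open>The normal form sees the nonlinearity only through \<open>Lin\<close>. The time
  derivatives \<open>A'\<close> and \<open>B'\<close> are part of the data because the correctors
  are built from \<open>A\<close> and \<open>B\<close> and vary with time.\<close>

locale dispersive_flow = sobolev_family r u for r :: nat and u :: "real \<Rightarrow> wiener" +
  fixes I :: "real set" and \<gamma>0 \<gamma>1 \<gamma>2 :: real and F A B A' B' :: "real \<Rightarrow> wiener"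
  assumes \<gamma>0: "\<gamma>0 \<noteq> 0" and I: "open I" and Lin: "Lin F A B"
    and A': "X 5 A'" "TD I A A'" and B': "X 5 B'" "TD I B B'"
    and flow: "TD I u (F - Cc (of_real \<gamma>0) * (D ^^ 5) u - Cc (of_real \<gamma>1) * (D ^^ 3) u - Cc (of_real \<gamma>2) * D u)"
begin

text \<open>
  With \<open>\<rho>\<^sub>1\<close>, \<open>\<rho>\<^sub>2\<close> solving the two transport equations below, conjugation by the WKB factor
  \<open>1 + \<rho>\<^sub>1 / k + \<rho>\<^sub>2 / k\<^sup>2\<close> at frequency \<open>k\<close> replaces \<open>A\<close> and \<open>B\<close> by their means, up to operators of order one.
\<close>

definition \<rho>1 :: "real \<Rightarrow> wiener" where
  "\<rho>1 = Cc (of_real (1 / (5 * \<gamma>0))) * K A"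

definition \<rho>2 :: "real \<Rightarrow> wiener" where
  "\<rho>2 = Cc (of_real (1 / (5 * \<gamma>0))) * (Cc (of_nat r - 1) * A - Cc \<i> * K B) + Cc (1 / 2) * (\<rho>1 * \<rho>1)"

definition Z :: "real \<Rightarrow> wiener" where
  "Z = v 0 + K (\<rho>1 * v 0) + K (K (\<rho>2 * v 0))"

lemma XA: "s \<le> 10 \<Longrightarrow> X s A" and XB: "s \<le> 10 \<Longrightarrow> X s B"
  using Lin r by (auto simp: Lin_def elim!: X_mono)

lemma X_D_A: "s \<le> 9 \<Longrightarrow> X s (D A)"
  using X_mono[OF X_D[OF XA, of 9]] by simp

lemma X_\<rho>1: "s \<le> 11 \<Longrightarrow> X s \<rho>1"
  unfolding \<rho>1_def using X_K[OF XA[of 10]] by (intro X_mono[of 11 _ s] X_mult X_Cc) auto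

lemma X_\<rho>2: "s \<le> 10 \<Longrightarrow> X s \<rho>2"
  unfolding \<rho>2_def using X_K[OF XB[of 9]]
  by (intro X_mono[of 10 _ s] X_add X_diff X_mult X_Cc XA X_\<rho>1) auto

lemma X_D\<rho>1: "s + j \<le> 11 \<Longrightarrow> j \<le> 9 \<Longrightarrow> X s ((D ^^ j) \<rho>1)"
  by (rule X_mono[of "11 - j"]) (auto intro!: X_Dpow X_\<rho>1)

lemma X_D\<rho>2: "s + j \<le> 10 \<Longrightarrow> j \<le> 8 \<Longrightarrow> X s ((D ^^ j) \<rho>2)"
  by (rule X_mono[of "10 - j"]) (auto intro!: X_Dpow X_\<rho>2)

lemma five_\<gamma>0: "5 * (Cc (of_real \<gamma>0) * (Cc (of_real (1 / (5 * \<gamma>0))) * f)) = f"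
proof -
  have "5 * (Cc (of_real \<gamma>0) * (Cc (of_real (1 / (5 * \<gamma>0))) * f)) =
      Cc (5 * (of_real \<gamma>0 * of_real (1 / (5 * \<gamma>0)))) * f"
    by (simp only: Cc_simps Cc_numeral mult.assoc)
  also have "5 * (of_real \<gamma>0 * of_real (1 / (5 * \<gamma>0))) = (1::complex)"
    using \<gamma>0 by simp
  finally show ?thesis by (simp add: Cc_simps)
qed

text \<open>Makes the third-order terms cancel: the commutator of the first corrector with the
  fifth-order term contributes \<i> times the left-hand side, and \<i> times the right-hand side is
  - (A - mean A).\<close>

lemma transport1: "5 * (Cc (of_real \<gamma>0) * D \<rho>1) = Cc \<i> * (A - mean A)"
proof -
  have "D \<rho>1 = Cc (of_real (1 / (5 * \<gamma>0))) * (Cc \<i> * (A - mean A))"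
    unfolding \<rho>1_def using X_K[OF XA[of 9]] by (simp add: D_Cc_mult D_K XA X_mono)
  then show ?thesis by (simp only: five_\<gamma>0)
qed

text \<open>The derivative of \<open>transport1\<close>. It evaluates the second-order remainder
  that the first corrector leaves behind, which is - D A after multiplication by \<i>.\<close>

lemma transport1': "5 * (Cc (of_real \<gamma>0) * (D ^^ 2) \<rho>1) = Cc \<i> * D A"
proof -
  have "(D ^^ 2) \<rho>1 = D (Cc (of_real (1 / (5 * \<gamma>0))) * (Cc \<i> * (A - mean A)))"
    unfolding \<rho>1_def using X_K[OF XA[of 9]]
    by (simp add: D_Cc_mult D_K XA X_mono eval_nat_numeral del: Cc_simps)
  also have "\<dots> = Cc (of_real (1 / (5 * \<gamma>0))) * (Cc \<i> * D A)"
    using X_mean[OF XA[of 3], of 3] by (simp add: D_Cc_mult D_diff D_mean[OF XA] XA X_diff X_mult X_Cc)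
  finally show ?thesis by (simp only: five_\<gamma>0)
qed

text \<open>The right-hand side collects the second-order terms: r D A + B from the nonlinearity, -
  D A from \<open>transport1'\<close>, and the product of \<rho>1 with the third-order coefficient.
  By \<open>transport1\<close> the last is 5 \<gamma>0 \<rho>1 D \<rho>1, whose primitive is the
  half square in \<rho>2, so nothing but the mean of \<open>B\<close> has to be subtracted.\<close>

lemma transport2: "5 * (Cc (of_real \<gamma>0) * D \<rho>2) =
    (Cc (of_nat r) - 1) * D A + (B - mean B) + Cc \<i> * (\<rho>1 * (A - mean A))"
proof -
  define c where "c = (Cc (of_real (1 / (5 * \<gamma>0))) :: real \<Rightarrow> wiener)"
  have K3: "X 3 (K B)" using X_K[OF XB[of 2]] by simp
  have "D \<rho>2 = c * ((Cc (of_nat r) - 1) * D A - Cc \<i> * (Cc \<i> * (B - mean B))) + Cc (1 / 2) * (D \<rho>1 * \<rho>1 + \<rho>1 * D \<rho>1)"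
  proof -
    have c1: "X 3 ((Cc (of_nat r) - 1) * A)" and c2: "X 3 (Cc (of_nat r) - 1)"
      by (auto intro!: X_mult X_diff X_Cc X_1 XA)
    have "D (Cc (of_nat r) - 1) = (0 :: real \<Rightarrow> wiener)"
      using D_Cc[of "of_nat r - 1"] by (simp add: Cc_simps)
    then show ?thesis
      unfolding \<rho>2_def c_def
      by (simp add: D_add D_diff D_Cc_mult D_mult D_K K3 XA XB X_\<rho>1 X_add X_diff X_mult X_Cc D_Cc Cc_simps c1 c2)
  qed
  also have "Cc (1 / 2) * (D \<rho>1 * \<rho>1 + \<rho>1 * D \<rho>1) = \<rho>1 * D \<rho>1"
  proof -
    have "Cc (1 / 2) * (D \<rho>1 * \<rho>1 + \<rho>1 * D \<rho>1) = Cc (1 / 2) * Cc 2 * (\<rho>1 * D \<rho>1)"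
      by (simp only: Cc_numeral) (simp add: algebra_simps)
    also have "Cc (1 / 2) * Cc 2 = (1 :: real \<Rightarrow> wiener)"
      by (simp flip: Cc_simps)
    finally show ?thesis by simp
  qed
  finally have "D \<rho>2 = c * ((Cc (of_nat r) - 1) * D A + (B - mean B)) + \<rho>1 * D \<rho>1"
    by (simp only: Cc_i_i diff_minus_eq_add)
  note D\<rho>2 = this
  have "5 * (Cc (of_real \<gamma>0) * D \<rho>2) =
     5 * (Cc (of_real \<gamma>0) * (c * ((Cc (of_nat r) - 1) * D A + (B - mean B)))) + \<rho>1 * (5 * (Cc (of_real \<gamma>0) * D \<rho>1))"
    by (subst D\<rho>2) (simp add: algebra_simps)
  then show ?thesis
    unfolding transport1 c_def five_\<gamma>0 by (simp add: algebra_simps)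
qed

text \<open>Integration by parts: up to the factor \<i> and the mean, \<open>K\<close> inverts
  \<open>D\<close>. Each \<open>K\<close> thus removes a derivative from v, at the price of a term
  with the derivative on g.\<close>

lemma K_mult_v:
  assumes "X 3 g" "j \<le> 4"
  shows "K (g * v (Suc j)) = Cc \<i> * (g * v j) - K (D g * v j) - Cc \<i> * mean (g * v j)"
proof -
  have vj: "X 3 (v j)" using assms by (intro X_v) auto
  have "K (D (g * v j)) = Cc \<i> * (g * v j - mean (g * v j))"
    by (rule K_D[OF X_mult[OF assms(1) vj]]) simp
  moreover have "D (g * v j) = D g * v j + g * v (Suc j)"
    by (simp add: D_mult[OF assms(1) vj] D_v)
  ultimately show ?thesis by (simp add: K_add algebra_simps)
qed

definition v' :: "real \<Rightarrow> wiener" where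
  "v' = (D ^^ r) (F - Cc (of_real \<gamma>0) * (D ^^ 5) u - Cc (of_real \<gamma>1) * (D ^^ 3) u - Cc (of_real \<gamma>2) * D u)"

definition \<rho>1' :: "real \<Rightarrow> wiener" where
  "\<rho>1' = Cc (of_real (1 / (5 * \<gamma>0))) * K A'"

definition \<rho>2' :: "real \<Rightarrow> wiener" where
  "\<rho>2' = Cc (of_real (1 / (5 * \<gamma>0))) * (Cc (of_nat r - 1) * A' - Cc \<i> * K B') + Cc (1 / 2) * (\<rho>1' * \<rho>1 + \<rho>1 * \<rho>1')"

lemma X_\<rho>1': "X 5 \<rho>1'" and X_\<rho>2': "X 5 \<rho>2'"
proof -
  have K: "X 5 (K f)" if "X 5 f" for f :: "real \<Rightarrow> wiener"
    using X_mono[OF X_K[OF that]] by simp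
  show "X 5 \<rho>1'"
    unfolding \<rho>1'_def by (intro X_mult X_Cc K A') simp
  then show "X 5 \<rho>2'"
    unfolding \<rho>2'_def by (intro X_add X_diff X_mult X_Cc K A' B' X_\<rho>1) auto
qed

definition Z' :: "real \<Rightarrow> wiener" where
  "Z' = v' + K (\<rho>1' * v 0 + \<rho>1 * v') + K (K (\<rho>2' * v 0 + \<rho>2 * v'))"

text \<open>Class 6 is the class of \<open>v 1\<close>; the term with \<gamma>2 is therefore
  absorbed into the error.\<close>

lemma v'_eq: "X 6 (v' - (A * v 3 + (Cc (of_nat r) * D A + B) * v 2 - Cc (of_real \<gamma>0) * v 5 - Cc (of_real \<gamma>1) * v 3))"
proof -
  have X: "X (r + 2) F" "X (r + 2) ((D ^^ 5) u)" "X (r + 2) ((D ^^ 3) u)" "X (r + 2) (D u)"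
    using Lin by (auto simp: Lin_def simp del: add_2_eq_Suc' intro!: X_Dpow X_D'[OF u] X_mono[OF u] elim: X_mono)
  have v: "(D ^^ r) ((D ^^ j) u) = v j" for j
    by (simp add: v_def funpow_add)
  have eq: "F - Cc (of_real \<gamma>0) * (D ^^ 5) u - Cc (of_real \<gamma>1) * (D ^^ 3) u - Cc (of_real \<gamma>2) * D u =
    F + (Cc (- of_real \<gamma>0) * (D ^^ 5) u + (Cc (- of_real \<gamma>1) * (D ^^ 3) u + Cc (- of_real \<gamma>2) * (D ^^ 1) u))"
    by (simp add: Cc_simps algebra_simps)
  have "v' = (D ^^ r) F + (Cc (- of_real \<gamma>0) * v 5 + (Cc (- of_real \<gamma>1) * v 3 + Cc (- of_real \<gamma>2) * v 1))"
    unfolding v'_def eq v[symmetric] using X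
    by (simp add: Dpow_add Dpow_Cc_mult X_add X_mult X_Cc del: add_2_eq_Suc')
  then have "v' - (A * v 3 + (Cc (of_nat r) * D A + B) * v 2 - Cc (of_real \<gamma>0) * v 5 - Cc (of_real \<gamma>1) * v 3) =
    ((D ^^ r) F - A * v 3 - (Cc (of_nat r) * D A + B) * v 2) - Cc (of_real \<gamma>2) * v 1"
    by (simp add: Cc_simps algebra_simps)
  moreover have "X 6 \<dots>"
    using Lin by (intro X_diff[OF _ X_mult[OF X_Cc X_v]]) (auto simp: Lin_def)
  ultimately show ?thesis by (simp only:)
qed

lemma X_v': "X 2 v'"
proof -
  have "X 2 (A * v 3 + (Cc (of_nat r) * D A + B) * v 2 - Cc (of_real \<gamma>0) * v 5 - Cc (of_real \<gamma>1) * v 3)"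
    by (intro X_diff X_add X_mult X_Cc X_v XA XB X_D_A) auto
  with X_add[OF X_mono[OF v'_eq, of 2] this] show ?thesis by simp
qed

lemma TD_Z: "TD I Z Z'"
proof -
  have v: "TD I (v 0) v'"
    unfolding v_def v'_def add_0_right
  proof (rule TD_Dpow[OF flow])
    show "X (r + 2) u" by (rule X_mono[OF u]) simp
    have "X (r + 2) F" using Lin by (auto simp: Lin_def elim: X_mono)
    moreover have "X (r + 2) (D u)" by (rule X_D'[OF u]) auto
    ultimately show "X (r + 2) (F - Cc (of_real \<gamma>0) * (D ^^ 5) u - Cc (of_real \<gamma>1) * (D ^^ 3) u - Cc (of_real \<gamma>2) * D u)"
      by (intro X_diff X_mult X_Cc X_Dpow X_mono[OF u]) auto
  qed
  have X2: "X 2 \<rho>1'" "X 2 \<rho>2'"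
    by (auto intro: X_mono[OF X_\<rho>1'] X_mono[OF X_\<rho>2'])
  have \<rho>1': "TD I \<rho>1 \<rho>1'"
    unfolding \<rho>1_def \<rho>1'_def by (intro TD_Cc_mult TD_K A')
  have TD_diff: "TD I (f - g) (f' - g')" if "TD I f f'" "TD I g g'" for f g f' g'
    using TD_add[OF that(1) TD_Cc_mult[OF that(2), of "-1"]] by (simp add: Cc_simps)
  have \<rho>2': "TD I \<rho>2 \<rho>2'"
    unfolding \<rho>2_def \<rho>2'_def Cc_simps(5)[symmetric] Cc_simps(4)[symmetric]
    by (intro TD_add TD_Cc_mult TD_diff TD_K TD_mult A' B' \<rho>1' X2 X_\<rho>1 I) auto
  show ?thesis
    unfolding Z_def Z'_def
    by (intro TD_add TD_K TD_mult v \<rho>1' \<rho>2' X2 X_v' X_\<rho>1 X_\<rho>2 X_v I) auto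
qed

text \<open>Every m below is an error of class 6. Since \<open>K\<close> gains one power, terms with
  \<open>v 2\<close> or lower are errors under one \<open>K\<close>, and terms with
  \<open>v 3\<close> or lower are errors under two. The terms with \<open>v 5\<close> cancel
  identically, and those with \<open>v 4\<close> are reduced by \<open>K_mult_v\<close>.\<close>

lemma Z_flow:
  "X 6 (Z' - (mean B * (D ^^ 2) Z - Cc (of_real \<gamma>0) * (D ^^ 5) Z - (Cc (of_real \<gamma>1) - mean A) * (D ^^ 3) Z))"
proof -
  let ?c0 = "Cc (of_real \<gamma>0)" and ?c1 = "Cc (of_real \<gamma>1)" and ?I = "Cc \<i> :: real \<Rightarrow> wiener"
  let ?A = "A - mean A"
  have KI: "X 6 (K f)" if "X 5 f" for f :: "real \<Rightarrow> wiener"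
    using X_K[OF that] by simp
  have KKI: "X 6 (K (K f))" if "X 4 f" for f :: "real \<Rightarrow> wiener"
    using X_K[OF X_K[OF that]] by simp
  have D2: "D (D f) = (D ^^ 2) f" for f :: "real \<Rightarrow> wiener"
    by (simp add: eval_nat_numeral)
  have v_pow: "(D ^^ j) (v 0) = v j" for j
    by (simp add: v_def add.commute flip: funpow_add[THEN fun_cong, unfolded o_apply])
  have Xmean: "X s (?I * mean f)" if "X 2 f" "s \<ge> 2" for s f
    by (intro X_mult X_Cc X_mean[OF that(1)] that(2))
  have X\<rho>: "X s (D \<rho>1)" if "s \<le> 10" for s using X_D\<rho>1[of s 1] that by simp
  have X\<rho>': "X s (D \<rho>2)" if "s \<le> 9" for s using X_D\<rho>2[of s 1] that by simp
  note Xs = X_v X_\<rho>1 X_\<rho>2 X_D\<rho>1 X_D\<rho>2 X\<rho> X\<rho>' XA XB X_D_A X_Cc X_mean[OF XA[OF order_refl]] X_mean[OF XB[OF order_refl]]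

  \<comment> \<open>A mean has only the zeroth coefficient and hence lies in every class.\<close>
  define m1 where "m1 = - ?I * mean (D \<rho>1 * v 3)"
  have m1: "X 6 m1" "K (D \<rho>1 * v 4) = ?I * (D \<rho>1 * v 3) - K ((D ^^ 2) \<rho>1 * v 3) + m1"
    using K_mult_v[of "D \<rho>1" 3] Xmean[of "D \<rho>1 * v 3" 6] X_mult[of 2 "D \<rho>1" "v 3"] X_uminus
    by (auto simp: m1_def D2 Xs)
  define m2 where "m2 = - K ((D ^^ 3) \<rho>1 * v 2) - ?I * mean ((D ^^ 2) \<rho>1 * v 2)"
  have m2: "X 6 m2" "K ((D ^^ 2) \<rho>1 * v 3) = ?I * ((D ^^ 2) \<rho>1 * v 2) + m2"
  proof -
    have "D ((D ^^ 2) \<rho>1) = (D ^^ 3) \<rho>1" by (simp add: eval_nat_numeral)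
    then show "K ((D ^^ 2) \<rho>1 * v 3) = ?I * ((D ^^ 2) \<rho>1 * v 2) + m2"
      using K_mult_v[of "(D ^^ 2) \<rho>1" 2] by (simp add: m2_def Xs)
    show "X 6 m2"
      unfolding m2_def by (intro X_diff X_uminus KI Xmean X_mult Xs) auto
  qed
  \<comment> \<open>Two integrations by parts, each with a factor \<i>: this is the origin of the
    minus sign in front of \<open>D \<rho>2 * v 2\<close>.\<close>
  define m3 where "m3 = ?I * (- K ((D ^^ 2) \<rho>2 * v 2) - ?I * mean (D \<rho>2 * v 2)) - K (K ((D ^^ 2) \<rho>2 * v 3)) - K (?I * mean (D \<rho>2 * v 3))"
  have m3: "X 6 m3" "K (K (D \<rho>2 * v 4)) = - (D \<rho>2 * v 2) + m3"
  proof -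
    have "K (D \<rho>2 * v 4) = ?I * (D \<rho>2 * v 3) - K ((D ^^ 2) \<rho>2 * v 3) - ?I * mean (D \<rho>2 * v 3)"
      using K_mult_v[of "D \<rho>2" 3] by (simp add: D2 Xs)
    moreover have "K (D \<rho>2 * v 3) = ?I * (D \<rho>2 * v 2) - K ((D ^^ 2) \<rho>2 * v 2) - ?I * mean (D \<rho>2 * v 2)"
      using K_mult_v[of "D \<rho>2" 2] by (simp add: D2 Xs)
    ultimately show "K (K (D \<rho>2 * v 4)) = - (D \<rho>2 * v 2) + m3"
      by (simp add: K_diff K_Cc_mult m3_def right_diff_distrib Cc_i_i)
    show "X 6 m3"
      unfolding m3_def by (intro X_diff X_uminus KI KKI Xmean X_mult Xs) auto
  qed
  define m4 where "m4 = - K (D (\<rho>1 * ?A) * v 2) - ?I * mean (\<rho>1 * ?A * v 2)"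
  have m4: "X 6 m4" "K (\<rho>1 * ?A * v 3) = ?I * (\<rho>1 * ?A * v 2) + m4"
  proof -
    have XA2: "X s (\<rho>1 * ?A)" if "s \<le> 10" "s \<ge> 2" for s
      using that by (intro X_mult X_diff Xs) auto
    then show "K (\<rho>1 * ?A * v 3) = ?I * (\<rho>1 * ?A * v 2) + m4"
      using K_mult_v[of "\<rho>1 * ?A" 2] by (simp add: m4_def)
    show "X 6 m4"
      unfolding m4_def using XA2[of 6] XA2[of 2]
      by (intro X_diff X_uminus KI Xmean X_mult Xs X_D'[of 6]) auto
  qed
  define m5 where "m5 = K (10 * ((D ^^ 3) \<rho>1 * v 2) + 5 * ((D ^^ 4) \<rho>1 * v 1) + (D ^^ 5) \<rho>1 * v 0)"
  have "X 6 m5"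
    unfolding m5_def Cc_numeral[symmetric] by (intro KI X_add X_mult Xs) auto
  note m5 = this
  have K_num: "K (numeral k * f) = numeral k * K f" for k and f :: "real \<Rightarrow> wiener"
    unfolding Cc_numeral[symmetric] by (rule K_Cc_mult)
  have L1: "K ((D ^^ 5) (\<rho>1 * v 0)) = K (\<rho>1 * v 5) + 5 * K (D \<rho>1 * v 4) + 10 * K ((D ^^ 2) \<rho>1 * v 3) + m5"
    by (subst Dpow_5_mult) (auto simp: Xs m5_def v_pow D_v K_add K_num)
  define m6 where "m6 = K (K (10 * ((D ^^ 2) \<rho>2 * v 3) + 10 * ((D ^^ 3) \<rho>2 * v 2) + 5 * ((D ^^ 4) \<rho>2 * v 1) + (D ^^ 5) \<rho>2 * v 0))"
  have m6: "X 6 m6"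
    unfolding m6_def Cc_numeral[symmetric] by (intro KKI X_add X_mult Xs) auto
  have L2: "K (K ((D ^^ 5) (\<rho>2 * v 0))) = K (K (\<rho>2 * v 5)) + 5 * K (K (D \<rho>2 * v 4)) + m6"
    by (subst Dpow_5_mult) (auto simp: Xs m6_def v_pow D_v K_add K_num)
  define m7 where "m7 = K (3 * (D \<rho>1 * v 2) + 3 * ((D ^^ 2) \<rho>1 * v 1) + (D ^^ 3) \<rho>1 * v 0)"
  have m7: "X 6 m7"
    unfolding m7_def Cc_numeral[symmetric] by (intro KI X_add X_mult Xs) auto
  have L3: "K ((D ^^ 3) (\<rho>1 * v 0)) = K (\<rho>1 * v 3) + m7"
    by (subst Dpow_3_mult) (auto simp: Xs m7_def v_pow D_v K_add K_num)
  have XD: "X s ((D ^^ j) (g * v 0))" if "s + j \<le> 7" "s \<ge> 2" "X 7 g" for s j g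
    using that by (intro X_Dpow X_mult' [OF that(3) X_v[of 0 7]]) auto
  define m8 where "m8 = K (K ((D ^^ 3) (\<rho>2 * v 0)))"
  have m8: "X 6 m8"
    unfolding m8_def by (intro KKI XD Xs) auto
  define m9 where "m9 = K ((D ^^ 2) (\<rho>1 * v 0)) + K (K ((D ^^ 2) (\<rho>2 * v 0)))"
  have m9: "X 6 m9"
    unfolding m9_def by (intro X_add KI KKI XD Xs) auto
  have X7: "X 7 (v 0)" "X 7 (\<rho>1 * v 0)" "X 7 (\<rho>2 * v 0)"
    by (auto intro!: X_mult Xs)
  have DZ: "(D ^^ j) Z = v j + K ((D ^^ j) (\<rho>1 * v 0)) + K (K ((D ^^ j) (\<rho>2 * v 0)))" if "j \<le> 5" for j
  proof -
    have s: "X (j + 2) f" if "X 7 f" for f :: "real \<Rightarrow> wiener"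
      using that \<open>j \<le> 5\<close> by (auto elim: X_mono)
    have sK: "X (j + 2) (K f)" if "X (j + 2) f" for f :: "real \<Rightarrow> wiener"
      using X_mono[OF X_K[OF that]] by simp
    show ?thesis
      unfolding Z_def v_pow[of j, symmetric]
      by (simp add: Dpow_add Dpow_K s sK X7 X_add del: add_2_eq_Suc')
  qed
  define m0 where "m0 = v' - (A * v 3 + (Cc (of_nat r) * D A + B) * v 2 - ?c0 * v 5 - ?c1 * v 3)"
  have m0: "X 6 m0" "v' = A * v 3 + (Cc (of_nat r) * D A + B) * v 2 - ?c0 * v 5 - ?c1 * v 3 + m0"
    using v'_eq by (simp_all add: m0_def)
  define m10 where "m10 = K (\<rho>1 * ((Cc (of_nat r) * D A + B) * v 2 + m0))"
  have m10: "X 6 m10" "K (\<rho>1 * v') = K (\<rho>1 * A * v 3) - ?c0 * K (\<rho>1 * v 5) - ?c1 * K (\<rho>1 * v 3) + m10"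
  proof -
    have "\<rho>1 * v' = \<rho>1 * A * v 3 - ?c0 * (\<rho>1 * v 5) - ?c1 * (\<rho>1 * v 3) + \<rho>1 * ((Cc (of_nat r) * D A + B) * v 2 + m0)"
      unfolding m0(2) by (simp add: algebra_simps)
    then show "K (\<rho>1 * v') = K (\<rho>1 * A * v 3) - ?c0 * K (\<rho>1 * v 5) - ?c1 * K (\<rho>1 * v 3) + m10"
      by (simp only: m10_def K_add K_diff K_Cc_mult)
    show "X 6 m10"
      unfolding m10_def by (intro KI X_mult X_add Xs X_mono[OF m0(1)]) auto
  qed
  \<comment> \<open>Under two \<open>K\<close> only the fifth-order part of \<open>v'\<close> is too
    large to be an error.\<close>
  define m11 where "m11 = K (K (\<rho>2 * (A * v 3 + (Cc (of_nat r) * D A + B) * v 2 - ?c1 * v 3 + m0)))"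
  have m11: "X 6 m11" "K (K (\<rho>2 * v')) = - (?c0 * K (K (\<rho>2 * v 5))) + m11"
  proof -
    have "\<rho>2 * v' = \<rho>2 * (A * v 3 + (Cc (of_nat r) * D A + B) * v 2 - ?c1 * v 3 + m0) - ?c0 * (\<rho>2 * v 5)"
      unfolding m0(2) by (simp add: algebra_simps)
    then show "K (K (\<rho>2 * v')) = - (?c0 * K (K (\<rho>2 * v 5))) + m11"
      by (simp add: m11_def K_diff K_Cc_mult)
    show "X 6 m11"
      unfolding m11_def by (intro KKI X_mult X_add X_diff Xs X_mono[OF m0(1)]) auto
  qed
  define m12 where "m12 = Z' - (v' + K (\<rho>1 * v') + K (K (\<rho>2 * v')))"
  have m12: "X 6 m12" "Z' = v' + K (\<rho>1 * v') + K (K (\<rho>2 * v')) + m12"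
  proof -
    have *: "v' + K (x * v 0 + \<rho>1 * v') + K (K (y * v 0 + \<rho>2 * v')) - (v' + K (\<rho>1 * v') + K (K (\<rho>2 * v'))) =
      K (x * v 0) + K (K (y * v 0))" for x y
      by (simp add: K_add)
    have "X 6 (K (\<rho>1' * v 0) + K (K (\<rho>2' * v 0)))"
      by (intro X_add KI KKI X_mult X_\<rho>1' X_mono[OF X_\<rho>2'] Xs) auto
    then show "X 6 m12"
      unfolding m12_def Z'_def by (simp only: *)
  qed (simp add: m12_def)

  define P1 P2 Q1 where "P1 = D \<rho>1" and "P2 = (D ^^ 2) \<rho>1" and "Q1 = D \<rho>2"
  have KA: "K (\<rho>1 * A * v 3) = ?I * (\<rho>1 * ?A * v 2) + m4 + mean A * K (\<rho>1 * v 3)"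
  proof -
    have "\<rho>1 * A * v 3 = \<rho>1 * ?A * v 3 + mean A * (\<rho>1 * v 3)" by (simp add: algebra_simps)
    then show ?thesis by (simp only: K_add K_mean_mult m4(2))
  qed
  \<comment> \<open>What remains are the coefficients of \<open>v 3\<close> and \<open>v 2\<close>,
    which the transport equations annihilate. The factor 5 at \<open>P2\<close> is 10 from the
    Leibniz rule minus 5 from integrating the term with \<open>v 4\<close> by parts.\<close>
  have "Z' - (mean B * (D ^^ 2) Z - ?c0 * (D ^^ 5) Z - (?c1 - mean A) * (D ^^ 3) Z) =
     ?I * (5 * (?c0 * P1)) * v 3 + ?A * v 3 + (?I * (5 * (?c0 * P2)) - 5 * (?c0 * Q1) + Cc (of_nat r) * D A + B - mean B + ?I * (\<rho>1 * ?A)) * v 2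
     + (m0 + m4 + m10 + m11 + m12 + ?c0 * (5 * m1 + 5 * m2 + 5 * m3 + m5 + m6) + (?c1 - mean A) * (m7 + m8) - mean B * m9)"
    unfolding m12(2) DZ[OF order_refl] DZ[of 3, simplified] DZ[of 2, simplified] unfolding m10(2) m11(2)
    unfolding m0(2) KA L1 L2 L3 m8_def[symmetric] unfolding m1(2) m3(2) unfolding m2(2)
    unfolding P1_def[symmetric] P2_def[symmetric] Q1_def[symmetric]
    by (simp add: m9_def algebra_simps)
  also have "?I * (5 * (?c0 * P1)) * v 3 + ?A * v 3 = 0"
    unfolding P1_def transport1 by (simp add: Cc_i_i algebra_simps)
  also have "?I * (5 * (?c0 * P2)) - 5 * (?c0 * Q1) + Cc (of_nat r) * D A + B - mean B + ?I * (\<rho>1 * ?A) = 0"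
    unfolding P2_def Q1_def transport1' transport2 by (simp add: Cc_i_i algebra_simps)
  finally show ?thesis
    using m0(1) m1(1) m2(1) m3(1) m4(1) m5 m6 m7 m8 m9 m10(1) m11(1) m12(1)
    unfolding Cc_numeral[symmetric] by (auto intro!: X_add X_diff X_mult Xs)
qed

end

subsection \<open>Parabolic smoothing\<close>

lemma power_le_exp: "0 \<le> x \<Longrightarrow> x ^ n \<le> fact n * exp (x::real)"
proof -
  assume x: "0 \<le> x"
  have "x ^ n /\<^sub>R fact n = (\<Sum>k\<in>{n}. x ^ k /\<^sub>R fact k)" by simp
  also have "\<dots> \<le> (\<Sum>k. x ^ k /\<^sub>R fact k)"
    using x by (intro sum_le_suminf summable_exp_generic) auto
  also have "\<dots> = exp x"
    by (simp add: exp_def)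
  finally show ?thesis
    by (simp add: field_simps)
qed

text \<open>A Gronwall argument for the squared modulus. Young's inequality 2 |z| E \<le> m |z|^2 +
  E^2 / m spends half of the damping rate 2 m on the forcing; with the other half the function
  \<open>g\<close> of the proof is nonincreasing.\<close>

lemma damped_mode_bound:
  fixes z :: "real \<Rightarrow> complex"
  assumes z: "\<And>t. t \<in> {a<..<b} \<Longrightarrow> (z has_vector_derivative (l t * z t + e t)) (at t)"
    and l: "\<And>t. t \<in> {a<..<b} \<Longrightarrow> Re (l t) \<le> - m" and m: "m > 0"
    and e: "\<And>t. t \<in> {a<..<b} \<Longrightarrow> cmod (e t) \<le> E"
    and t: "a < t0" "t0 \<le> t" "t < b"
  shows "(cmod (z t))\<^sup>2 \<le> E\<^sup>2 / m\<^sup>2 + exp (- m * (t - t0)) * (cmod (z t0))\<^sup>2"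
proof -
  define g where "g = (\<lambda>s. exp (m * s) * (z s \<bullet> z s - E\<^sup>2 / m\<^sup>2))"
  have "g t \<le> g t0"
  proof (rule DERIV_nonpos_imp_nonincreasing[OF t(2)])
    fix s assume "t0 \<le> s" "s \<le> t"
    then have s: "s \<in> {a<..<b}" using t by auto
    let ?w = "l s * z s + e s"
    have E: "E \<ge> 0" using e[OF s] norm_ge_zero order_trans by blast
    have "((\<lambda>s. z s \<bullet> z s) has_derivative (\<lambda>h. z s \<bullet> (h *\<^sub>R ?w) + (h *\<^sub>R ?w) \<bullet> z s)) (at s)"
      using z[OF s] unfolding has_vector_derivative_def by (intro has_derivative_inner)
    then have d: "((\<lambda>s. z s \<bullet> z s) has_field_derivative 2 * (z s \<bullet> ?w)) (at s)"
      unfolding has_field_derivative_def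
      by (rule has_derivative_eq_rhs) (auto simp: inner_commute algebra_simps)
    have "(g has_field_derivative exp (m * s) * (m * (z s \<bullet> z s - E\<^sup>2 / m\<^sup>2) + 2 * (z s \<bullet> ?w))) (at s)"
      unfolding g_def by (rule derivative_eq_intros d refl | simp add: algebra_simps)+
    moreover have "m * (z s \<bullet> z s - E\<^sup>2 / m\<^sup>2) + 2 * (z s \<bullet> ?w) \<le> 0"
    proof -
      have "z s \<bullet> (l s * z s) = Re (l s) * (z s \<bullet> z s)"
        by (simp add: inner_complex_def algebra_simps)
      also have "\<dots> \<le> - m * (z s \<bullet> z s)"
        by (intro mult_right_mono l s) auto
      finally have 1: "z s \<bullet> (l s * z s) \<le> - m * (z s \<bullet> z s)" .
      have "z s \<bullet> e s \<le> cmod (z s) * E"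
        by (rule order_trans[OF norm_cauchy_schwarz mult_left_mono[OF e[OF s] norm_ge_zero]])
      with 1 have "z s \<bullet> ?w \<le> - m * (cmod (z s))\<^sup>2 + cmod (z s) * E"
        by (simp add: inner_add_right dot_square_norm)
      moreover have "2 * (cmod (z s) * E) \<le> m * (cmod (z s))\<^sup>2 + E\<^sup>2 / m"
      proof -
        have "0 \<le> (m * cmod (z s) - E)\<^sup>2 / m" using m by simp
        also have "\<dots> = m * (cmod (z s))\<^sup>2 + E\<^sup>2 / m - 2 * (cmod (z s) * E)"
        proof -
          have "(m * cmod (z s) - E)\<^sup>2 = m * (m * (cmod (z s))\<^sup>2 - 2 * (cmod (z s) * E)) + E\<^sup>2"
            by (simp add: power2_eq_square algebra_simps)
          then show ?thesis using m by (simp add: add_divide_distrib)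
        qed
        finally show ?thesis by simp
      qed
      moreover have "m * (E\<^sup>2 / m\<^sup>2) = E\<^sup>2 / m" using m by (simp add: power2_eq_square)
      ultimately show ?thesis
        by (simp add: dot_square_norm right_diff_distrib)
    qed
    ultimately show "\<exists>y. (g has_real_derivative y) (at s) \<and> y \<le> 0"
      using mult_nonneg_nonpos[OF exp_ge_zero] by blast
  qed
  then have "exp (- (m * t)) * g t \<le> exp (- (m * t)) * g t0"
    by (intro mult_left_mono) auto
  moreover have "exp (- (m * t)) * g t = (cmod (z t))\<^sup>2 - E\<^sup>2 / m\<^sup>2"
    by (simp add: g_def dot_square_norm flip: mult.assoc exp_add)
  moreover have "exp (- (m * t)) * g t0 = exp (- m * (t - t0)) * ((cmod (z t0))\<^sup>2 - E\<^sup>2 / m\<^sup>2)"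
  proof -
    have "exp (- (m * t)) * exp (m * t0) = exp (- m * (t - t0))"
      by (simp add: algebra_simps flip: exp_add)
    then show ?thesis by (simp add: g_def dot_square_norm flip: mult.assoc)
  qed
  moreover have "exp (- m * (t - t0)) * ((cmod (z t0))\<^sup>2 - E\<^sup>2 / m\<^sup>2) \<le> exp (- m * (t - t0)) * (cmod (z t0))\<^sup>2"
    by (intro mult_left_mono) auto
  ultimately show ?thesis by linarith
qed

lemma jb_le_2: "n \<noteq> 0 \<Longrightarrow> jb n \<le> 2 * \<bar>real_of_int n\<bar>"
  unfolding jb_def by linarith

context dispersive_flow
begin

lemma smoothing:
  assumes Iab: "I = {a<..<b}"
    and A0: "\<And>t. t \<in> I \<Longrightarrow> Im (wc (A t) 0) = 0"
    and B0: "\<And>t. t \<in> I \<Longrightarrow> Im (wc (B t) 0) = 0 \<and> Re (wc (B t) 0) \<ge> c" and c: "c > 0"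
    and a': "a < a'"
  shows "\<exists>C. \<forall>t\<in>{a'..<b}. \<forall>n. cmod (wc (u t) n) \<le> C / jb n ^ (r + 8)"
proof -
  define e where "e = Z' - (mean B * (D ^^ 2) Z - Cc (of_real \<gamma>0) * (D ^^ 5) Z - (Cc (of_real \<gamma>1) - mean A) * (D ^^ 3) Z)"
  obtain E where E: "E \<ge> 0" "\<And>p n. cmod (wc (e p) n) \<le> E / jb n ^ 6"
    using Z_flow unfolding e_def by (elim XE) blast
  have X7: "X 7 (v 0)" "X 7 (\<rho>1 * v 0)" "X 7 (\<rho>2 * v 0)"
    by (auto intro!: X_mult X_v X_\<rho>1 X_\<rho>2)
  have XZ: "X 7 Z"
    unfolding Z_def using X7 X_mono[OF X_K[OF X7(2)], of 7] X_mono[OF X_K[OF X_K[OF X7(3)]], of 7]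
    by (intro X_add) auto
  obtain M where M: "M \<ge> 0" "\<And>p n. cmod (wc (Z p) n) \<le> M / jb n ^ 7"
    using XZ by (elim XE) blast
  define lam where "lam t n = wc (B t) 0 * (\<i> * of_int n) ^ 2 - of_real \<gamma>0 * (\<i> * of_int n) ^ 5
      - (of_real \<gamma>1 - wc (A t) 0) * (\<i> * of_int n) ^ 3" for t n
  have ode: "((\<lambda>t. wc (Z t) n) has_vector_derivative (lam t n * wc (Z t) n + wc (e t) n)) (at t)" if "t \<in> I" for t n
  proof -
    have "Z' = e + (mean B * (D ^^ 2) Z - Cc (of_real \<gamma>0) * (D ^^ 5) Z - (Cc (of_real \<gamma>1) - mean A) * (D ^^ 3) Z)"
      by (simp add: e_def)
    then have "wc (Z' t) n = wc (e t) n + (wc (B t) 0 * wc ((D ^^ 2) Z t) n - of_real \<gamma>0 * wc ((D ^^ 5) Z t) n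
        - (of_real \<gamma>1 * wc ((D ^^ 3) Z t) n - wc (A t) 0 * wc ((D ^^ 3) Z t) n))"
      by (simp add: fam_apply left_diff_distrib Cc_def)
    also have "\<dots> = lam t n * wc (Z t) n + wc (e t) n"
      using X_mono[OF XZ, of 4] X_mono[OF XZ, of 5] XZ by (simp add: wc_Dpow lam_def algebra_simps)
    finally have eq: "wc (Z' t) n = lam t n * wc (Z t) n + wc (e t) n" .
    show ?thesis
      using TD_Z that unfolding TD_def eq[symmetric] by blast
  qed
  have lam: "Re (lam t n) \<le> - (c * (of_int n)\<^sup>2)" if "t \<in> I" for t n
  proof -
    have AB: "wc (A t) 0 = of_real (Re (wc (A t) 0))" "wc (B t) 0 = of_real (Re (wc (B t) 0))"
      using A0 B0 that by (auto simp: complex_eq_iff)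
    have "Re (lam t n) = - (Re (wc (B t) 0) * (of_int n)\<^sup>2)"
    proof -
      have "lam t n = of_real (- (Re (wc (B t) 0) * (of_int n)\<^sup>2)) +
          \<i> * of_real (- \<gamma>0 * (of_int n) ^ 5 + (\<gamma>1 - Re (wc (A t) 0)) * (of_int n) ^ 3)"
        unfolding lam_def by (subst AB(1), subst AB(2)) (simp add: eval_nat_numeral algebra_simps)
      then show ?thesis by simp
    qed
    moreover have "c * (of_int n)\<^sup>2 \<le> Re (wc (B t) 0) * (of_int n)\<^sup>2"
      using B0 that by (intro mult_right_mono) auto
    ultimately show ?thesis by simp
  qed
  define \<delta> where "\<delta> = (a' - a) / 2"
  \<comment> \<open>The three summands stem from the forcing divided by the damping, from the
    initial value damped over a time of at least \<delta>, and from the mode n = 0, which is not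
    damped.\<close>
  define Q where "Q = (4 * E / c)\<^sup>2 + fact 8 * (4 / (c * \<delta>)) ^ 8 * M\<^sup>2 + M\<^sup>2"
  have \<delta>: "\<delta> > 0" using a' by (simp add: \<delta>_def)
  have Z8: "cmod (wc (Z t) n) \<le> sqrt Q / jb n ^ 8" if t: "t \<in> {a'..<b}" for t n
  proof (cases "n = 0")
    case True
    have "cmod (wc (Z t) n) \<le> M" using M(2)[of t n] True by simp
    also have "M \<le> sqrt Q"
      using M(1) c \<delta> by (intro real_le_rsqrt) (simp add: Q_def)
    finally show ?thesis using True by simp
  next
    case False
    define N where "N = (real_of_int n)\<^sup>2"
    have N: "(jb n)\<^sup>2 \<le> 4 * N" "N > 0"
      using power_mono[OF jb_le_2[OF False], of 2] False by (auto simp: N_def power_mult_distrib)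
    let ?t0 = "a + \<delta>"
    have t0: "a < ?t0" "?t0 \<le> t" "t < b" "t - ?t0 \<ge> \<delta>" using t \<delta> by (auto simp: \<delta>_def field_simps)
    have "(cmod (wc (Z t) n))\<^sup>2 \<le> (E / jb n ^ 6)\<^sup>2 / (c * N)\<^sup>2 + exp (- (c * N) * (t - ?t0)) * (cmod (wc (Z ?t0) n))\<^sup>2"
      by (rule damped_mode_bound[where l = "\<lambda>t. lam t n" and e = "\<lambda>t. wc (e t) n" and a = a and b = b])
         (use c N ode lam[of _ n] E(2) t0(1-3) in \<open>auto simp: Iab N_def\<close>)
    also have "\<dots> \<le> (4 * E / c)\<^sup>2 / jb n ^ 16 + (fact 8 * (4 / (c * \<delta>)) ^ 8 / jb n ^ 16) * M\<^sup>2"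
    proof (rule add_mono)
      have "E / jb n ^ 6 / (c * N) \<le> E / jb n ^ 6 / (c * ((jb n)\<^sup>2 / 4))"
        using E(1) c N by (intro divide_left_mono mult_left_mono) auto
      also have "\<dots> = (4 * E / c) / jb n ^ 8"
        using c by (simp add: field_simps eval_nat_numeral)
      finally have "(E / jb n ^ 6 / (c * N))\<^sup>2 \<le> ((4 * E / c) / jb n ^ 8)\<^sup>2"
        using E(1) c N by (intro power_mono) auto
      then show "(E / jb n ^ 6)\<^sup>2 / (c * N)\<^sup>2 \<le> (4 * E / c)\<^sup>2 / jb n ^ 16"
        by (simp only: power_divide power_mult[symmetric]) simp
      have "exp (- (c * N) * (t - ?t0)) \<le> exp (- (c * \<delta> * N))"
        using c N t0(4) by (simp add: mult.assoc mult_left_mono)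
      \<comment> \<open>The exponential beats every power of N; the eighth is chosen because N is
        comparable to the square of \<open>jb n\<close>, which gives the same
        \<open>jb n ^ 16\<close> as the forcing.\<close>
      also have "\<dots> \<le> fact 8 / (c * \<delta> * N) ^ 8"
        using power_le_exp[of "c * \<delta> * N" 8] c \<delta> N by (simp add: exp_minus field_simps)
      also have "\<dots> \<le> fact 8 / (c * \<delta> * ((jb n)\<^sup>2 / 4)) ^ 8"
        using c \<delta> N by (intro divide_left_mono power_mono mult_left_mono) auto
      also have "\<dots> = fact 8 * (4 / (c * \<delta>)) ^ 8 / jb n ^ 16"
        by (simp add: power_mult_distrib power_divide field_simps flip: power_mult)
      finally have "exp (- (c * N) * (t - ?t0)) \<le> fact 8 * (4 / (c * \<delta>)) ^ 8 / jb n ^ 16" .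
      moreover have "(cmod (wc (Z ?t0) n))\<^sup>2 \<le> M\<^sup>2"
      proof (intro power_mono order_trans[OF M(2)])
        show "M / jb n ^ 7 \<le> M"
          using M(1) by (simp add: divide_le_eq mult_le_cancel_left1 one_le_power)
      qed auto
      ultimately show "exp (- (c * N) * (t - ?t0)) * (cmod (wc (Z ?t0) n))\<^sup>2 \<le>
          fact 8 * (4 / (c * \<delta>)) ^ 8 / jb n ^ 16 * M\<^sup>2"
        using c \<delta> by (intro mult_mono) auto
    qed
    also have "\<dots> \<le> Q / jb n ^ 16"
      by (simp add: Q_def add_divide_distrib)
    finally have "(cmod (wc (Z t) n))\<^sup>2 \<le> Q / jb n ^ 16" .
    then have "cmod (wc (Z t) n) \<le> sqrt (Q / jb n ^ 16)"
      by (rule real_le_rsqrt)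
    moreover have "sqrt (jb n ^ 16) = jb n ^ 8"
      by (rule real_sqrt_unique) (auto simp flip: power_mult)
    ultimately show ?thesis by (simp add: real_sqrt_divide)
  qed
  obtain M1 where M1: "M1 \<ge> 0" "\<And>p n. cmod (wc (K (\<rho>1 * v 0) p) n) \<le> M1 / jb n ^ 8"
    using X_K[OF X7(2), simplified] by (elim XE) auto
  obtain M2 where M2: "M2 \<ge> 0" "\<And>p n. cmod (wc (K (K (\<rho>2 * v 0)) p) n) \<le> M2 / jb n ^ 8"
    using X_mono[OF X_K[OF X_K[OF X7(3)]], of 8, simplified] by (elim XE) auto
  obtain M3 where M3: "M3 \<ge> 0" "\<And>p n. cmod (wc (u p) n) \<le> M3 / jb n ^ (r + 7)"
    using u by (elim XE) blast
  \<comment> \<open>The normal form is undone without inverting it: both correctors applied to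
    \<open>v 0\<close> have class 8 already, by the powers gained through \<open>K\<close>.\<close>
  have v8: "cmod (wc (v 0 t) n) \<le> (sqrt Q + M1 + M2) / jb n ^ 8" if t: "t \<in> {a'..<b}" for t n
  proof -
    have eq: "wc (v 0 t) n = wc (Z t) n - wc (K (\<rho>1 * v 0) t) n - wc (K (K (\<rho>2 * v 0)) t) n"
      by (simp add: Z_def fam_apply)
    have "cmod (wc (v 0 t) n) \<le> cmod (wc (Z t) n) + cmod (wc (K (\<rho>1 * v 0) t) n) + cmod (wc (K (K (\<rho>2 * v 0)) t) n)"
      unfolding eq by (rule order_trans[OF norm_triangle_ineq4 add_right_mono[OF norm_triangle_ineq4]])
    also have "\<dots> \<le> (sqrt Q + M1 + M2) / jb n ^ 8"
      unfolding add_divide_distrib by (intro add_mono Z8[OF t] M1(2) M2(2))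
    finally show ?thesis .
  qed
  show ?thesis
  proof (intro exI ballI allI)
    fix t n assume t: "t \<in> {a'..<b}"
    have Q: "Q \<ge> 0" unfolding Q_def using c \<delta> by simp
    show "cmod (wc (u t) n) \<le> (2 ^ r * (sqrt Q + M1 + M2) + M3) / jb n ^ (r + 8)"
    proof (cases "n = 0")
      case True
      then show ?thesis using M3(2)[of t n] M1(1) M2(1) Q by (simp add: add_increasing)
    next
      case False
      have "X (r + 2) u" by (rule X_mono[OF u]) simp
      then have "cmod (wc (v 0 t) n) = \<bar>real_of_int n\<bar> ^ r * cmod (wc (u t) n)"
        unfolding v_def by (simp add: wc_Dpow norm_mult norm_power del: add_2_eq_Suc')
      then have *: "\<bar>real_of_int n\<bar> ^ r * cmod (wc (u t) n) \<le> (sqrt Q + M1 + M2) / jb n ^ 8"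
        using v8[OF t, of n] by simp
      have "jb n ^ r * cmod (wc (u t) n) \<le> (2 * \<bar>real_of_int n\<bar>) ^ r * cmod (wc (u t) n)"
        using jb_le_2[OF False] by (intro mult_right_mono power_mono) auto
      also have "\<dots> \<le> 2 ^ r * ((sqrt Q + M1 + M2) / jb n ^ 8)"
        unfolding power_mult_distrib mult.assoc by (rule mult_left_mono[OF *]) simp
      finally have "cmod (wc (u t) n) \<le> 2 ^ r * ((sqrt Q + M1 + M2) / jb n ^ 8) / jb n ^ r"
        by (simp add: pos_le_divide_eq mult_ac)
      also have "\<dots> = 2 ^ r * (sqrt Q + M1 + M2) / jb n ^ (r + 8)"
        by (simp add: power_add)
      also have "\<dots> \<le> (2 ^ r * (sqrt Q + M1 + M2) + M3) / jb n ^ (r + 8)"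
        using M3(1) by (intro divide_right_mono) auto
      finally show ?thesis .
    qed
  qed
qed

end

section \<open>The polynomial nonlinearity on coefficients and the bootstrap in the decay
  rate\<close>

definition monomial :: "real \<Rightarrow> nat \<Rightarrow> nat \<Rightarrow> nat \<Rightarrow> nat \<Rightarrow> wiener \<Rightarrow> wiener" where
  "monomial l a b c d w = cst (of_real l) * (wD ^^ 3) w ^ a * (wD ^^ 2) w ^ b * wD w ^ c * w ^ d"

lemma Dpow_apply: "(D ^^ j) f t = (wD ^^ j) (f t)"
  by (induction j arbitrary: f) (simp_all add: D_def)

lemma power_apply: "(f ^ k) t = f t ^ k" for f :: "'p \<Rightarrow> wiener"
  by (induction k) (simp_all add: fam_apply)

lemma monomial_family:
  "(\<lambda>t. monomial l a b c d (f t)) = Cc (of_real l) * ((D ^^ 3) f) ^ a * ((D ^^ 2) f) ^ b * (D f) ^ c * f ^ d"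
  using Dpow_apply[of 1 f] by (simp add: fun_eq_iff monomial_def fam_apply power_apply Dpow_apply Cc_def)

text \<open>Closed under sums and products, so the time derivatives of \<open>A\<close> and
  \<open>B\<close> required by \<open>dispersive_flow\<close> are obtained with their bounds but
  without being written out.\<close>

definition TX :: "real set \<Rightarrow> (real \<Rightarrow> wiener) \<Rightarrow> bool" where
  "TX I f \<longleftrightarrow> X 5 f \<and> (\<exists>f'. TD I f f' \<and> X 5 f')"

lemma TX_Cc: "TX I (Cc c)"
proof -
  have "TD I (Cc c) 0" unfolding Cc_def by (rule TD_const)
  then show ?thesis unfolding TX_def using X_0 X_Cc by blast
qed

lemma TX_1: "TX I 1"
  using TX_Cc[of I 1] by (simp add: Cc_simps)

lemma TX_mult: "open I \<Longrightarrow> TX I f \<Longrightarrow> TX I g \<Longrightarrow> TX I (f * g)"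
proof -
  assume I: "open I" and "TX I f" "TX I g"
  then obtain f' g' where fg: "X 5 f" "X 5 g" "X 5 f'" "X 5 g'" "TD I f f'" "TD I g g'"
    unfolding TX_def by blast
  then have "TD I (f * g) (f' * g + f * g')"
    using I by (intro TD_mult) (auto elim: X_mono)
  moreover have "X 5 (f * g)" "X 5 (f' * g + f * g')"
    using fg by (auto intro!: X_add X_mult)
  ultimately show ?thesis unfolding TX_def by blast
qed

lemma TX_add: "TX I f \<Longrightarrow> TX I g \<Longrightarrow> TX I (f + g)"
  unfolding TX_def by (blast intro: TD_add X_add)

lemma TX_power: "open I \<Longrightarrow> TX I f \<Longrightarrow> TX I (f ^ k)"
  by (induction k) (auto intro: TX_1 TX_mult)

lemma TX_sum: "(\<And>j. j \<in> S \<Longrightarrow> TX I (f j)) \<Longrightarrow> TX I (\<Sum>j\<in>S. f j)"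
proof (induction S rule: infinite_finite_induct)
  case empty
  then show ?case using TX_Cc[of I 0] by (simp add: Cc_simps)
next
  case (infinite S)
  then show ?case using TX_Cc[of I 0] by (simp add: Cc_simps)
qed (auto intro: TX_add)

lemma sum_apply: "(\<Sum>j\<in>S. f j) t = (\<Sum>j\<in>S. f j t)" for f :: "'i \<Rightarrow> 'p \<Rightarrow> wiener"
  by (induction S rule: infinite_finite_induct) (auto simp: fam_apply)

locale flow =
  fixes \<gamma>0 \<gamma>1 \<gamma>2 :: real and j0 :: nat and lam :: "nat \<Rightarrow> real" and a b c d :: "nat \<Rightarrow> nat"
begin

definition Nw :: "wiener \<Rightarrow> wiener" where
  "Nw w = (\<Sum>j=1..j0. monomial (lam j) (a j) (b j) (c j) (d j) w)"

text \<open>The formal derivative of the nonlinearity in the third derivative of u, as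
  \<open>Bw\<close> is the one in the second. If \<open>a j = 0\<close>, the truncated exponent
  \<open>a j - 1\<close> is harmless, because the factor \<open>a j\<close> removes the
  term.\<close>

definition Aw :: "wiener \<Rightarrow> wiener" where
  "Aw w = (\<Sum>j=1..j0. monomial (lam j * a j) (a j - 1) (b j) (c j) (d j) w)"

definition Bw :: "wiener \<Rightarrow> wiener" where
  "Bw w = (\<Sum>j=1..j0. monomial (lam j * b j) (a j) (b j - 1) (c j) (d j) w)"

definition symb :: "int \<Rightarrow> complex" where
  "symb n = of_real \<gamma>0 * (\<i> * of_int n) ^ 5 + of_real \<gamma>1 * (\<i> * of_int n) ^ 3 + of_real \<gamma>2 * (\<i> * of_int n)"

definition is_flow :: "real set \<Rightarrow> (real \<Rightarrow> wiener) \<Rightarrow> bool" where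
  "is_flow I U \<longleftrightarrow> (\<forall>t\<in>I. \<forall>n. ((\<lambda>t. wc (U t) n) has_vector_derivative
     (wc (Nw (U t)) n - symb n * wc (U t) n)) (at t))"

lemma Lin_N:
  assumes "sobolev_family r u"
  shows "sobolev_family.Lin r u (\<lambda>t. Nw (u t)) (\<lambda>t. Aw (u t)) (\<lambda>t. Bw (u t))"
proof -
  interpret sobolev_family r u by fact
  have eq: "Cc (of_real (l * of_nat k)) = Cc (of_real l) * (of_nat k :: 'a \<Rightarrow> wiener)" for l k
    by (simp add: fun_eq_iff Cc_def fam_apply cst_mult cst_of_nat)
  have "Lin (\<Sum>j=1..j0. (\<lambda>t. monomial (lam j) (a j) (b j) (c j) (d j) (u t)))
     (\<Sum>j=1..j0. (\<lambda>t. monomial (lam j * a j) (a j - 1) (b j) (c j) (d j) (u t)))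
     (\<Sum>j=1..j0. (\<lambda>t. monomial (lam j * b j) (a j) (b j - 1) (c j) (d j) (u t)))"
    unfolding monomial_family[of _ _ _ _ _ u] eq by (intro Lin_sum Lin_monomial)
  moreover have "(\<lambda>t. Nw (u t)) = (\<Sum>j=1..j0. (\<lambda>t. monomial (lam j) (a j) (b j) (c j) (d j) (u t)))"
    "(\<lambda>t. Aw (u t)) = (\<Sum>j=1..j0. (\<lambda>t. monomial (lam j * a j) (a j - 1) (b j) (c j) (d j) (u t)))"
    "(\<lambda>t. Bw (u t)) = (\<Sum>j=1..j0. (\<lambda>t. monomial (lam j * b j) (a j) (b j - 1) (c j) (d j) (u t)))"
    by (simp_all add: fun_eq_iff Nw_def Aw_def Bw_def sum_apply)
  ultimately show ?thesis by simp
qed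

lemma smoothing_step:
  assumes "\<gamma>0 \<noteq> 0" and flow: "is_flow {\<tau>1<..<\<tau>2} U" and s: "s \<ge> 13"
    and bound: "\<And>t n. t \<in> {\<tau>1<..<\<tau>2} \<Longrightarrow> cmod (wc (U t) n) \<le> C / jb n ^ s"
    and AB: "\<And>t. t \<in> {\<tau>1<..<\<tau>2} \<Longrightarrow> Im (wc (Aw (U t)) 0) = 0 \<and> Im (wc (Bw (U t)) 0) = 0 \<and> Re (wc (Bw (U t)) 0) \<ge> e"
    and e: "e > 0" and \<tau>: "\<tau>1 < \<tau>"
  shows "\<exists>C. \<forall>t\<in>{\<tau>..<\<tau>2}. \<forall>n. cmod (wc (U t) n) \<le> C / jb n ^ Suc s"
proof -
  define I where "I = {\<tau>1<..<\<tau>2}"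
  \<comment> \<open>Extended by zero, because membership in \<open>X\<close> asks for a bound at all
    real times.\<close>
  define u where "u t = (if t \<in> I then U t else 0)" for t
  define r where "r = s - 7"
  have I: "open I" by (simp add: I_def)
  have rs: "r + 7 = s" "r \<ge> 6" using s by (auto simp: r_def)
  have X: "X (r + 7) u"
  proof (rule XI)
    fix t n
    have "0 \<le> \<bar>C\<bar> / jb n ^ s" "C / jb n ^ s \<le> \<bar>C\<bar> / jb n ^ s"
      by (auto intro!: divide_right_mono)
    then show "cmod (wc (u t) n) \<le> \<bar>C\<bar> / jb n ^ (r + 7)"
      using bound[of t n] by (auto simp: rs u_def I_def)
  qed
  interpret sobolev_family r u
    by unfold_locales (use rs X in auto)
  define F where "F = (\<lambda>t. Nw (u t)) - Cc (of_real \<gamma>0) * (D ^^ 5) u - Cc (of_real \<gamma>1) * (D ^^ 3) u - Cc (of_real \<gamma>2) * D u"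
  \<comment> \<open>The equation costs five derivatives, 13 - 5 = 8. The three derivatives occurring
    in \<open>A\<close> and \<open>B\<close> leave the class 5 demanded of \<open>A'\<close> and
    \<open>B'\<close>.\<close>
  have X8: "X 8 F"
  proof -
    have "X 8 (\<lambda>t. Nw (u t))"
      using Lin_N[OF sobolev_family_axioms] rs by (auto simp: Lin_def elim!: X_mono)
    moreover have "X 8 (D u)" by (rule X_D'[OF X]) (use rs in auto)
    ultimately show ?thesis
      unfolding F_def using rs by (intro X_diff X_mult X_Cc X_Dpow X_mono[OF X]) auto
  qed
  have TDu: "TD I u F"
    unfolding TD_def
  proof (intro ballI allI)
    fix t n assume t: "t \<in> I"
    have "((\<lambda>t. wc (U t) n) has_vector_derivative
     (wc (Nw (U t)) n - symb n * wc (U t) n)) (at t)"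
      using flow t by (auto simp: is_flow_def I_def)
    then have "((\<lambda>t. wc (u t) n) has_vector_derivative
     (wc (Nw (U t)) n - symb n * wc (U t) n)) (at t)"
      by (rule has_vector_derivative_transform_within_open[OF _ I t]) (simp add: u_def)
    moreover have "wc (F t) n = wc (Nw (U t)) n - symb n * wc (U t) n"
    proof -
      have "X 7 u" "X 5 u" "X 3 u" using X by (auto elim: X_mono)
      then show ?thesis
        using t by (simp add: F_def fam_apply wc_Dpow wc_D3 Cc_def u_def symb_def) (simp add: algebra_simps)
    qed
    ultimately show "((\<lambda>t. wc (u t) n) has_vector_derivative wc (F t) n) (at t)"
      by simp
  qed
  have TXD: "TX I ((D ^^ j) u)" if "j \<le> 3" for j
  proof -
    have "X (j + 2) u" "X (j + 2) F"
      using that rs by (auto intro: X_mono[OF X] X_mono[OF X8])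
    moreover have "X 5 ((D ^^ j) u)" "X 5 ((D ^^ j) F)"
      using that rs by (auto intro!: X_Dpow X_mono[OF X] X_mono[OF X8])
    ultimately show ?thesis
      unfolding TX_def using TD_Dpow[OF TDu] by blast
  qed
  have TXm: "TX I (\<lambda>t. monomial l a b c d (u t))" for l a b c d
    unfolding monomial_family[of _ _ _ _ _ u] using TXD[of 3] TXD[of 2] TXD[of 1] TXD[of 0]
    by (intro TX_mult[OF I] TX_power[OF I] TX_Cc) auto
  have TXA: "TX I (\<lambda>t. Aw (u t))"
    using TX_sum[of "{1..j0}" I "\<lambda>j t. monomial (lam j * a j) (a j - 1) (b j) (c j) (d j) (u t)"] TXm
    by (simp add: Aw_def sum_apply[abs_def])
  have TXB: "TX I (\<lambda>t. Bw (u t))"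
    using TX_sum[of "{1..j0}" I "\<lambda>j t. monomial (lam j * b j) (a j) (b j - 1) (c j) (d j) (u t)"] TXm
    by (simp add: Bw_def sum_apply[abs_def])
  obtain A' where A': "TD I (\<lambda>t. Aw (u t)) A'" "X 5 A'"
    using TXA unfolding TX_def by blast
  obtain B' where B': "TD I (\<lambda>t. Bw (u t)) B'" "X 5 B'"
    using TXB unfolding TX_def by blast
  interpret dispersive_flow r u I \<gamma>0 \<gamma>1 \<gamma>2 "\<lambda>t. Nw (u t)" "\<lambda>t. Aw (u t)" "\<lambda>t. Bw (u t)" A' B'
    by unfold_locales
       (use assms(1) I Lin_N[OF sobolev_family_axioms] A' B' TDu in \<open>auto simp: F_def\<close>)
  have "\<exists>C. \<forall>t\<in>{\<tau>..<\<tau>2}. \<forall>n. cmod (wc (u t) n) \<le> C / jb n ^ (r + 8)"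
    by (rule smoothing[OF I_def _ _ e \<tau>]) (use AB in \<open>auto simp: u_def I_def\<close>)
  moreover have "u t = U t" if "t \<in> {\<tau>..<\<tau>2}" for t
    using that \<tau> by (auto simp: u_def I_def)
  moreover have "r + 8 = Suc s" using rs by simp
  ultimately show ?thesis by metis
qed

text \<open>Each gain of a power costs a little time at the left end, while the right end stays
  fixed. Since the gain starts at an arbitrary later time, halving the waiting time leaves room for
  one more step.\<close>

lemma smoothing_all:
  assumes "\<gamma>0 \<noteq> 0" and flow: "is_flow {\<tau>0<..<\<tau>2} U"
    and bound: "\<And>t n. t \<in> {\<tau>0<..<\<tau>2} \<Longrightarrow> cmod (wc (U t) n) \<le> C / jb n ^ 13"
    and AB: "\<And>t. t \<in> {\<tau>0<..<\<tau>2} \<Longrightarrow> Im (wc (Aw (U t)) 0) = 0 \<and> Im (wc (Bw (U t)) 0) = 0 \<and> Re (wc (Bw (U t)) 0) \<ge> e"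
    and e: "e > 0" and \<tau>: "\<tau>0 < \<tau>"
  shows "\<exists>C. \<forall>t\<in>{\<tau>..<\<tau>2}. \<forall>n. cmod (wc (U t) n) \<le> C / jb n ^ (13 + k)"
  using \<tau>
proof (induction k arbitrary: \<tau>)
  case 0
  then show ?case using bound by (intro exI[of _ C]) auto
next
  case (Suc k)
  define \<tau>1 where "\<tau>1 = (\<tau>0 + \<tau>) / 2"
  have \<tau>1: "\<tau>0 < \<tau>1" "\<tau>1 < \<tau>" using Suc.prems by (auto simp: \<tau>1_def)
  obtain C where C: "\<And>t n. t \<in> {\<tau>1..<\<tau>2} \<Longrightarrow> cmod (wc (U t) n) \<le> C / jb n ^ (13 + k)"
    using Suc.IH[OF \<tau>1(1)] by blast
  have "is_flow {\<tau>1<..<\<tau>2} U"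
    using flow \<tau>1 by (auto simp: is_flow_def)
  then have "\<exists>C. \<forall>t\<in>{\<tau>..<\<tau>2}. \<forall>n. cmod (wc (U t) n) \<le> C / jb n ^ Suc (13 + k)"
    by (rule smoothing_step[OF assms(1) _ _ C AB e]) (use \<tau>1 in auto)
  then show ?case by simp
qed

end

subsection \<open>Uniqueness of Fourier coefficients\<close>

abbreviation "circ \<equiv> lebesgue_on {0..2*pi}"

abbreviation cint :: "(real \<Rightarrow> 'a) \<Rightarrow> 'a :: {banach, second_countable_topology}" where
  "cint \<equiv> integral\<^sup>L circ"

lemma LINT_circ: "(LINT x:{0..2*pi}|lebesgue. f x) = cint f"
  for f :: "real \<Rightarrow> 'a :: {banach, second_countable_topology}"
  by (simp add: integral_restrict_space set_lebesgue_integral_def)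

lemma set_integrable_circ: "set_integrable lebesgue {0..2*pi} f \<longleftrightarrow> integrable circ f"
  for f :: "real \<Rightarrow> 'a :: {banach, second_countable_topology}"
  by (simp add: integrable_restrict_space set_integrable_def)

lemma cont_measurable_circ: "continuous_on UNIV g \<Longrightarrow> g \<in> borel_measurable circ"
  for g :: "real \<Rightarrow> 'a :: real_normed_vector"
  by (intro measurable_restrict_space1 measurable_completion) (auto intro: borel_measurable_continuous_onI)

lemma cont_integrable_circ: "continuous_on UNIV g \<Longrightarrow> integrable circ g"
  for g :: "real \<Rightarrow> 'a :: euclidean_space"
  by (intro continuous_imp_integrable_real) (auto elim: continuous_on_subset)

lemma integrable_mult_bounded:
  fixes f g :: "'a \<Rightarrow> 'b :: {real_normed_field, banach, second_countable_topology}"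
  assumes "integrable M f" "g \<in> borel_measurable M" "\<And>x. norm (g x) \<le> C"
  shows "integrable M (\<lambda>x. f x * g x)"
proof (rule Bochner_Integration.integrable_bound)
  show "integrable M (\<lambda>x. C * norm (f x))"
    using assms(1) by simp
  show "(\<lambda>x. f x * g x) \<in> borel_measurable M"
    using assms by (intro borel_measurable_times) auto
  have "norm (f x) * norm (g x) \<le> \<bar>C\<bar> * norm (f x)" for x
    using mult_right_mono[OF order_trans[OF assms(3)[of x] abs_ge_self] norm_ge_zero[of "f x"]]
    by (simp add: mult.commute)
  then show "AE x in M. norm (f x * g x) \<le> norm (C * norm (f x))"
    by (simp add: norm_mult abs_mult)
qed

definition null_coeffs :: "(real \<Rightarrow> complex) \<Rightarrow> bool" where
  "null_coeffs f \<longleftrightarrow> integrable circ f \<and> (\<forall>k::int. cint (\<lambda>x. f x * cis (of_int k * x)) = 0)"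

lemma cont_cis: "continuous_on UNIV (\<lambda>x. cis (c * x))"
  by (intro continuous_intros)

lemma integrable_mult_cis: "integrable circ f \<Longrightarrow> integrable circ (\<lambda>x. f x * cis (c * x))"
  by (rule integrable_mult_bounded[OF _ cont_measurable_circ[OF cont_cis], where C = 1]) auto

lemma null_coeffs_cis: "null_coeffs f \<Longrightarrow> null_coeffs (\<lambda>x. f x * cis (of_int m * x))"
proof -
  assume f: "null_coeffs f"
  have eq: "f x * cis (of_int m * x) * cis (of_int k * x) = f x * cis (of_int (m + k) * x)" for x and k :: int
    by (simp add: mult.assoc cis_mult algebra_simps)
  then show ?thesis
    using f unfolding null_coeffs_def eq by (blast intro: integrable_mult_cis)
qed

lemma null_coeffs_lincomb:
  assumes "null_coeffs f" "null_coeffs g"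
  shows "null_coeffs (\<lambda>x. \<alpha> * f x + \<beta> * g x)"
proof -
  have "(\<lambda>x. (\<alpha> * f x + \<beta> * g x) * cis (of_int k * x)) =
      (\<lambda>x. \<alpha> * (f x * cis (of_int k * x)) + \<beta> * (g x * cis (of_int k * x)))" for k :: int
    by (simp add: fun_eq_iff algebra_simps)
  then show ?thesis
    using assms unfolding null_coeffs_def by (simp add: integrable_mult_cis)
qed

text \<open>On the unit circle a real linear function of z is a combination of z and its conjugate,
  and these only shift frequencies by 1 and -1. Products are handled by absorbing one factor into f,
  so the induction is over all f.\<close>

lemma null_coeffs_polynomial:
  assumes "real_polynomial_function p" "null_coeffs f"
  shows "null_coeffs (\<lambda>x. f x * of_real (p (cis x)))"
  using assms
proof (induction p arbitrary: f)
  case (linear p)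
  interpret p: bounded_linear p by fact
  have p: "p z = p 1 * Re z + p \<i> * Im z" for z
  proof -
    have "p z = p (Re z *\<^sub>R 1 + Im z *\<^sub>R \<i>)"
      by (rule arg_cong[where f = p]) (simp add: complex_eq_iff)
    then show ?thesis by (simp only: p.add p.scaleR) simp
  qed
  have "f x * of_real (p (cis x)) =
      ((of_real (p 1) - \<i> * of_real (p \<i>)) / 2) * (f x * cis (of_int 1 * x)) +
      ((of_real (p 1) + \<i> * of_real (p \<i>)) / 2) * (f x * cis (of_int (-1) * x))" for x
    by (subst p) (simp add: complex_eq_iff field_simps)
  then show ?case
    by (simp only:) (intro null_coeffs_lincomb null_coeffs_cis linear)
next
  case (const c)
  then show ?case
    using null_coeffs_lincomb[OF const const, of "of_real c" 0] by (simp add: mult.commute)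
next
  case (add p q)
  then show ?case
    using null_coeffs_lincomb[OF add.IH(1)[OF add.prems] add.IH(2)[OF add.prems], of 1 1]
    by (simp add: algebra_simps)
next
  case (mult p q)
  show ?case
    using mult.IH(2)[OF mult.IH(1)[OF mult.prems]] by (simp add: mult_ac)
qed

lemma continuous_on_sphere_bounded:
  fixes H :: "complex \<Rightarrow> real"
  assumes "continuous_on (sphere 0 1) H"
  shows "\<exists>C. \<forall>z\<in>sphere 0 1. \<bar>H z\<bar> \<le> C"
  using compact_imp_bounded[OF compact_continuous_image[OF assms compact_sphere]]
  unfolding bounded_iff by simp

lemma null_coeffs_continuous:
  fixes H :: "complex \<Rightarrow> real"
  assumes f: "null_coeffs f" and H: "continuous_on (sphere 0 1) H"
  shows "cint (\<lambda>x. f x * of_real (H (cis x))) = 0"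
proof -
  have fi: "integrable circ f" using f by (simp add: null_coeffs_def)
  have cisS: "cis x \<in> sphere 0 1" for x by simp
  have "continuous_on UNIV (\<lambda>x. H (cis x))"
    by (rule continuous_on_compose2[OF H]) (auto intro!: continuous_intros)
  then have Hm: "(\<lambda>x. complex_of_real (H (cis x))) \<in> borel_measurable circ"
    by (intro cont_measurable_circ continuous_intros)
  obtain C where C: "\<And>z. z \<in> sphere 0 1 \<Longrightarrow> \<bar>H z\<bar> \<le> C"
    using continuous_on_sphere_bounded[OF H] by blast
  have Hi: "integrable circ (\<lambda>x. f x * of_real (H (cis x)))"
    using C by (intro integrable_mult_bounded[OF fi Hm, of C]) auto
  have "norm (cint (\<lambda>x. f x * of_real (H (cis x)))) \<le> e * (cint (\<lambda>x. norm (f x)))"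
    if e: "e > 0" for e
  proof -
    obtain p where p: "real_polynomial_function p" "\<And>z. z \<in> sphere 0 1 \<Longrightarrow> \<bar>H z - p z\<bar> < e"
      using Stone_Weierstrass_real_polynomial_function[OF compact_sphere H e] by blast
    note pn = null_coeffs_polynomial[OF p(1) f]
    have pi: "integrable circ (\<lambda>x. f x * of_real (p (cis x)))"
      using pn by (simp add: null_coeffs_def)
    have p0: "cint (\<lambda>x. f x * of_real (p (cis x))) = 0"
      using pn unfolding null_coeffs_def by (elim conjE allE[of _ 0]) simp
    have "cint (\<lambda>x. f x * of_real (H (cis x))) =
        cint (\<lambda>x. f x * of_real (H (cis x)) - f x * of_real (p (cis x)))"
      using Hi pi p0 by simp
    also have "norm \<dots> \<le> cint (\<lambda>x. norm (f x * of_real (H (cis x)) - f x * of_real (p (cis x))))"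
      by (rule integral_norm_bound)
    also have "\<dots> \<le> cint (\<lambda>x. e * norm (f x))"
    proof (rule integral_mono)
      fix x
      have "norm (f x * of_real (H (cis x)) - f x * of_real (p (cis x))) = norm (f x) * \<bar>H (cis x) - p (cis x)\<bar>"
        by (simp flip: right_diff_distrib of_real_diff add: norm_mult)
      also have "\<dots> \<le> norm (f x) * e"
        using p(2)[OF cisS, of x] by (intro mult_left_mono) auto
      finally show "norm (f x * of_real (H (cis x)) - f x * of_real (p (cis x))) \<le> e * norm (f x)"
        by (simp add: mult.commute)
    qed (use Hi pi fi in auto)
    finally show ?thesis by simp
  qed
  then have "norm (cint (\<lambda>x. f x * of_real (H (cis x)))) \<le> 0 + e" if "e > 0" for e
  proof -
    define I where "I = cint (\<lambda>x. norm (f x))"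
    have I: "I \<ge> 0" by (simp add: I_def)
    have "norm (cint (\<lambda>x. f x * of_real (H (cis x)))) \<le> (e / (I + 1)) * I"
      unfolding I_def by (rule \<open>\<And>e. e > 0 \<Longrightarrow> _ \<le> _\<close>) (use that I in \<open>simp add: I_def[symmetric]\<close>)
    also have "\<dots> \<le> e"
      using I that by (simp add: field_simps)
    finally show ?thesis by simp
  qed
  then have "norm (cint (\<lambda>x. f x * of_real (H (cis x)))) \<le> 0"
    by (rule field_le_epsilon)
  then show ?thesis by simp
qed

text \<open>Continuous functions on the circle are made to converge to the sign of f almost
  everywhere; by dominated convergence the orthogonality then reads that the integral of |f| is
  0.\<close>

lemma null_orthogonal_real:
  fixes f :: "real \<Rightarrow> real"
  assumes f: "integrable circ f"
    and orth: "\<And>H. continuous_on (sphere (0::complex) 1) H \<Longrightarrow> cint (\<lambda>x. f x * H (cis x)) = 0"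
  shows "AE x in circ. f x = 0"
proof -
  have "set_integrable lebesgue {0..2*pi} f"
    using f by (simp add: set_integrable_circ)
  then have "(\<lambda>x. indicator {0..2*pi} x * f x) \<in> borel_measurable lebesgue"
    by (auto simp: set_integrable_def dest: borel_measurable_integrable)
  then have "(\<lambda>x. sgn (indicator {0..2*pi} x * f x)) \<in> borel_measurable lebesgue"
    by measurable
  then have "(\<lambda>x. sgn (indicator {0..2*pi} x * f x)) measurable_on UNIV"
    by (rule lebesgue_measurable_imp_measurable_on) auto
  then obtain N g where N: "negligible N" and g: "\<And>n. continuous_on UNIV (g n)"
    and lim: "\<And>x. x \<notin> N \<Longrightarrow> (\<lambda>n. g n x) \<longlonglongrightarrow> sgn (indicator {0..2*pi} x * f x)"
    unfolding measurable_on_def by auto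
  \<comment> \<open>Clipping to [-1, 1] provides the dominating function. In \<open>H\<close> the
    factor \<open>min 1 (of_nat n * (1 - Re z))\<close> vanishes at z = 1, where
    \<open>Arg2pi\<close> jumps, and tends to 1 elsewhere on the circle.\<close>
  define G where "G n x = max (-1) (min 1 (g n x))" for n :: nat and x
  define H where "H n z = G n (Arg2pi z) * min 1 (of_nat n * (1 - Re z))" for n z
  have G1: "\<bar>G n x\<bar> \<le> 1" for n x by (auto simp: G_def)
  have contH: "continuous_on (sphere 0 1) (H n)" for n
  proof (rule continuous_at_imp_continuous_on, rule ballI)
    fix z :: complex assume z: "z \<in> sphere 0 1"
    show "isCont (H n) z"
    proof (cases "z = 1")
      case False
      have "z \<notin> \<real>\<^sub>\<ge>\<^sub>0"
        using z False by (auto simp: nonneg_Reals_def)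
      then have A: "isCont Arg2pi z" by (rule continuous_at_Arg2pi)
      have "isCont (g n) (Arg2pi z)"
        using g continuous_on_eq_continuous_at by blast
      then have "isCont (\<lambda>z. g n (Arg2pi z)) z"
        using A isCont_o2 by blast
      then show ?thesis
        unfolding H_def G_def by (intro continuous_intros) auto
    next
      case True
      have "((\<lambda>w. H n w) \<longlongrightarrow> 0) (at z)"
      proof (rule tendsto_rabs_zero_cancel, rule tendsto_sandwich[OF _ _ tendsto_const])
        have "((\<lambda>w. \<bar>min 1 (of_nat n * (1 - Re w))\<bar>) \<longlongrightarrow> \<bar>min 1 (of_nat n * (1 - Re z))\<bar>) (at z)"
          by (intro tendsto_intros)
        then show "((\<lambda>w. \<bar>min 1 (of_nat n * (1 - Re w))\<bar>) \<longlongrightarrow> 0) (at z)"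
          using True by simp
        show "\<forall>\<^sub>F w in at z. \<bar>H n w\<bar> \<le> \<bar>min 1 (of_nat n * (1 - Re w))\<bar>"
          using G1 by (intro always_eventually allI) (auto simp: H_def abs_mult intro: mult_left_le_one_le)
      qed auto
      moreover have "H n z = 0" using True by (simp add: H_def)
      ultimately show ?thesis by (simp add: isCont_def)
    qed
  qed
  have H1: "\<bar>H n (cis x)\<bar> \<le> 1" for n x
  proof -
    have "\<bar>min 1 (real n * (1 - cos x))\<bar> \<le> 1"
      by (auto simp: min_def)
    then show ?thesis
      using G1[of n "Arg2pi (cis x)"] mult_mono[of "\<bar>G n (Arg2pi (cis x))\<bar>" 1 "\<bar>min 1 (real n * (1 - cos x))\<bar>" 1]
      by (simp add: H_def abs_mult)
  qed
  have Hlim: "(\<lambda>n. H n (cis x)) \<longlonglongrightarrow> sgn (f x)" if "x \<notin> N" "0 < x" "x < 2 * pi" for x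
  proof -
    have A: "Arg2pi (cis x) = x"
      using that by (intro Arg2pi_unique[of 1]) (auto simp: cis_conv_exp)
    have l1: "(\<lambda>n. G n x) \<longlonglongrightarrow> sgn (f x)"
    proof -
      have "(\<lambda>n. G n x) \<longlonglongrightarrow> max (-1) (min 1 (sgn (f x)))"
        unfolding G_def using lim[OF that(1)] that(2,3) by (intro tendsto_intros) simp
      moreover have "max (-1) (min 1 (sgn (f x))) = sgn (f x)"
        by (simp add: sgn_if)
      ultimately show ?thesis by simp
    qed
    have cos: "cos x < 1"
    proof -
      have "cos x \<noteq> 1"
      proof
        assume "cos x = 1"
        then obtain k :: int where k: "x = of_int k * (2 * pi)"
          using cos_one_2pi_int by auto
        have "0 < real_of_int k" "real_of_int k < 1"
          using that(2,3) unfolding k by (auto simp: zero_less_mult_iff mult_less_cancel_right1)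
        then show False by simp
      qed
      then show ?thesis using cos_le_one[of x] by (metis less_le)
    qed
    have "eventually (\<lambda>n. min 1 (of_nat n * (1 - cos x)) = 1) sequentially"
    proof -
      obtain n0 :: nat where n0: "1 / (1 - cos x) < of_nat n0"
        using reals_Archimedean2 by blast
      have "1 \<le> of_nat n * (1 - cos x)" if "n \<ge> n0" for n
      proof -
        have "1 / (1 - cos x) \<le> of_nat n" using n0 that by (meson less_imp_le of_nat_mono order_trans)
        then show ?thesis using cos by (simp add: divide_le_eq)
      qed
      then show ?thesis
        by (intro eventually_sequentiallyI[of n0]) simp
    qed
    then have "eventually (\<lambda>n. H n (cis x) = G n x) sequentially"
      by eventually_elim (simp add: H_def A)
    then show ?thesis
      using l1 by (simp add: tendsto_cong)
  qed
  have "(\<lambda>n. cint (\<lambda>x. f x * H n (cis x))) \<longlonglongrightarrow> cint (\<lambda>x. \<bar>f x\<bar>)"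
  proof (rule integral_dominated_convergence)
    show "integrable circ (\<lambda>x. \<bar>f x\<bar>)" using f by simp
    show "(\<lambda>x. f x * H n (cis x)) \<in> borel_measurable circ" for n
    proof (intro borel_measurable_times borel_measurable_integrable[OF f] cont_measurable_circ)
      show "continuous_on UNIV (\<lambda>x. H n (cis x))"
        by (rule continuous_on_compose2[OF contH]) (auto intro!: continuous_intros)
    qed
    show "AE x in circ. norm (f x * H n (cis x)) \<le> \<bar>f x\<bar>" for n
      using H1 by (auto simp: abs_mult intro!: always_eventually mult_left_le)
    have "N \<union> {0, 2 * pi} \<in> null_sets lebesgue"
      using N by (auto simp flip: negligible_iff_null_sets)
    then have "AE x in lebesgue. x \<notin> N \<union> {0, 2 * pi}"
      by (rule AE_not_in)
    then have "AE x in circ. x \<notin> N \<union> {0, 2 * pi} \<and> x \<in> {0..2*pi}"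
      by (subst AE_restrict_space_iff) auto
    then show "AE x in circ. (\<lambda>n. f x * H n (cis x)) \<longlonglongrightarrow> \<bar>f x\<bar>"
    proof eventually_elim
      case (elim x)
      then have "(\<lambda>n. f x * H n (cis x)) \<longlonglongrightarrow> f x * sgn (f x)"
        by (intro tendsto_mult tendsto_const Hlim) auto
      then show ?case by (simp add: abs_sgn)
    qed
  qed (use f in auto)
  then have "cint (\<lambda>x. \<bar>f x\<bar>) = 0"
    using orth[OF contH] by (simp add: LIMSEQ_const_iff)
  then have "AE x in circ. \<bar>f x\<bar> = 0"
    using f by (subst (asm) integral_nonneg_eq_0_iff_AE) auto
  then show ?thesis by simp
qed

lemma null_coeffs_AE_0:
  assumes "null_coeffs f"
  shows "AE x in circ. f x = 0"
proof -
  have f: "integrable circ f" using assms by (simp add: null_coeffs_def)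
  have H: "integrable circ (\<lambda>x. f x * of_real (H (cis x)))" "cint (\<lambda>x. f x * of_real (H (cis x))) = 0"
    if H: "continuous_on (sphere (0::complex) 1) H" for H
  proof -
    have "continuous_on UNIV (\<lambda>x. H (cis x))"
      by (rule continuous_on_compose2[OF H]) (auto intro!: continuous_intros)
    then have "(\<lambda>x. complex_of_real (H (cis x))) \<in> borel_measurable circ"
      by (intro cont_measurable_circ continuous_intros)
    moreover obtain C where C: "\<And>z. z \<in> sphere 0 1 \<Longrightarrow> \<bar>H z\<bar> \<le> C"
      using continuous_on_sphere_bounded[OF H] by blast
    ultimately show "integrable circ (\<lambda>x. f x * of_real (H (cis x)))"
      by (intro integrable_mult_bounded[OF f, of _ C]) auto
  qed (rule null_coeffs_continuous[OF assms H])
  have "AE x in circ. Re (f x) = 0"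
  proof (rule null_orthogonal_real)
    fix H :: "complex \<Rightarrow> real" assume "continuous_on (sphere 0 1) H"
    from integral_Re[OF H(1)[OF this]] H(2)[OF this]
    show "cint (\<lambda>x. Re (f x) * H (cis x)) = 0" by simp
  qed (use f in auto)
  moreover have "AE x in circ. Im (f x) = 0"
  proof (rule null_orthogonal_real)
    fix H :: "complex \<Rightarrow> real" assume "continuous_on (sphere 0 1) H"
    from integral_Im[OF H(1)[OF this]] H(2)[OF this]
    show "cint (\<lambda>x. Im (f x) * H (cis x)) = 0" by simp
  qed (use f in auto)
  ultimately show ?thesis
    by eventually_elim (simp add: complex_eq_iff)
qed

subsection \<open>Functions with absolutely convergent Fourier series\<close>

definition ev :: "wiener \<Rightarrow> real \<Rightarrow> complex" where
  "ev w x = (\<Sum>\<^sub>\<infinity>n. wc w n * cis (of_int n * x))"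

lemma ev_abs_summable: "(\<lambda>n. wc w n * cis (of_int n * x)) abs_summable_on UNIV"
  using wc_summable[of w] by (simp add: norm_mult)

lemma ev_summable: "(\<lambda>n. wc w n * cis (of_int n * x)) summable_on UNIV"
  by (rule abs_summable_summable[OF ev_abs_summable])

lemma ev_add: "ev (f + g) x = ev f x + ev g x"
  unfolding ev_def by (simp add: distrib_right infsum_add ev_summable)

lemma ev_cst: "ev (cst c) x = c"
proof -
  have "ev (cst c) x = (\<Sum>\<^sub>\<infinity>n\<in>{0::int}. c)"
    unfolding ev_def by (rule infsum_cong_neutral) (auto simp: wc_cst)
  then show ?thesis by simp
qed

lemma ev_mult: "ev (f * g) x = ev f x * ev g x"
proof -
  have "(\<lambda>(n, m). wc f m * wc g (n - m) * cis (of_int n * x)) abs_summable_on UNIV \<times> UNIV"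
    using conv_abs_summable[OF wc_summable[of f] wc_summable[of g]]
    by (simp add: case_prod_unfold norm_mult)
  then have s: "(\<lambda>(n, m). wc f m * wc g (n - m) * cis (of_int n * x)) summable_on UNIV \<times> UNIV"
    by (rule abs_summable_summable)
  have "ev (f * g) x = (\<Sum>\<^sub>\<infinity>n. \<Sum>\<^sub>\<infinity>m. wc f m * wc g (n - m) * cis (of_int n * x))"
    by (simp add: ev_def wc_mult infsum_cmult_left')
  also have "\<dots> = (\<Sum>\<^sub>\<infinity>m. \<Sum>\<^sub>\<infinity>n. wc f m * wc g (n - m) * cis (of_int n * x))"
    by (rule infsum_swap_banach[OF s])
  also have "\<dots> = (\<Sum>\<^sub>\<infinity>m. wc f m * cis (of_int m * x) * ev g x)"
  proof (rule infsum_cong)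
    fix m
    have "(\<Sum>\<^sub>\<infinity>n. wc f m * wc g (n - m) * cis (of_int n * x)) =
        (\<Sum>\<^sub>\<infinity>l. wc f m * cis (of_int m * x) * (wc g l * cis (of_int l * x)))"
      by (rule infsum_reindex_bij_witness[of _ "\<lambda>l. l + m" "\<lambda>n. n - m"])
         (auto simp: cis_mult algebra_simps)
    then show "(\<Sum>\<^sub>\<infinity>n. wc f m * wc g (n - m) * cis (of_int n * x)) = wc f m * cis (of_int m * x) * ev g x"
      by (simp add: ev_def infsum_cmult_right')
  qed
  finally show ?thesis
    by (simp add: ev_def infsum_cmult_left')
qed

lemma ev_power: "ev (f ^ k) x = ev f x ^ k"
  using ev_cst[of 1] by (induction k) (simp_all add: ev_mult)

lemma ev_sum: "ev (\<Sum>i\<in>A. f i) x = (\<Sum>i\<in>A. ev (f i) x)"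
  using ev_cst[of 0] by (induction A rule: infinite_finite_induct) (simp_all add: ev_add)

lemma continuous_ev: "continuous_on UNIV (ev w)"
  unfolding ev_def[abs_def]
  by (rule continuous_on_infsum_int[OF wc_summable[of w]]) (auto simp: norm_mult intro!: continuous_intros)

lemma ev_periodic: "ev w (x + 2 * pi) = ev w x"
proof -
  have "cis (of_int n * (x + 2 * pi)) = cis (of_int n * x)" for n :: int
    by (simp add: algebra_simps flip: cis_mult) (metis cis_multiple_2pi mult.commute mult.left_commute mult_cancel_left1 Ints_of_int)
  then show ?thesis by (simp add: ev_def)
qed

abbreviation dec :: "nat \<Rightarrow> wiener \<Rightarrow> bool" where
  "dec s w \<equiv> X s (\<lambda>_::unit. w)"

lemma wc_wDpow: "dec (j + 2) w \<Longrightarrow> wc ((wD ^^ j) w) n = (\<i> * of_int n) ^ j * wc w n"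
  using wc_Dpow[of j "\<lambda>_::unit. w" "()" n] by (simp add: Dpow_apply)

lemma dec_wDpow: "dec (s + j) w \<Longrightarrow> s \<ge> 2 \<Longrightarrow> dec s ((wD ^^ j) w)"
proof -
  assume "dec (s + j) w" "s \<ge> 2"
  then have "X s ((D ^^ j) (\<lambda>_::unit. w))" by (rule X_Dpow)
  also have "(D ^^ j) (\<lambda>_::unit. w) = (\<lambda>_. (wD ^^ j) w)"
    by (simp add: fun_eq_iff Dpow_apply)
  finally show ?thesis .
qed

lemma ev_deriv: "dec 3 w \<Longrightarrow> (ev w has_vector_derivative ev (wD w) x) (at x)"
proof -
  assume w: "dec 3 w"
  have wD: "wc (wD w) n = \<i> * of_int n * wc w n" for n
    using wc_wDpow[of 1 w n] w by (simp add: eval_nat_numeral)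
  show ?thesis
    unfolding ev_def[abs_def]
  proof (rule has_vector_derivative_infsum_int[where I = UNIV and M' = "\<lambda>n. norm (wc (wD w) n)", OF wc_summable[of w]])
    show "((\<lambda>x. wc w n * cis (of_int n * x)) has_vector_derivative wc (wD w) n * cis (of_int n * x)) (at x)" for n x
      unfolding wD by (auto intro!: derivative_eq_intros has_vector_derivative_mult_right
        simp: cis.ctr has_vector_derivative_complex_iff complex_eq_iff)
  qed (auto simp: norm_mult wc_summable)
qed

lemma integral_cis: "cint (\<lambda>x. cis (of_int k * x)) = (if k = 0 then of_real (2 * pi) else 0)"
proof -
  have eq: "cint (\<lambda>x. cis (of_int k * x)) = integral {0..2*pi} (\<lambda>x. cis (of_int k * x))"
    by (intro lebesgue_integral_eq_integral cont_integrable_circ cont_cis) auto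
  show ?thesis
  proof (cases "k = 0")
    case True
    then show ?thesis unfolding eq by (simp add: scaleR_conv_of_real)
  next
    case False
    have "((\<lambda>x. cis (of_int k * x)) has_integral
        (cis (of_int k * (2 * pi)) / (\<i> * of_int k) - cis (of_int k * 0) / (\<i> * of_int k))) {0..2*pi}"
      using False
      by (intro fundamental_theorem_of_calculus)
         (auto intro!: derivative_eq_intros simp: has_vector_derivative_complex_iff complex_eq_iff Re_divide Im_divide power2_eq_square)
    moreover have "cis (of_int k * (2 * pi)) = 1"
      by (metis cis_multiple_2pi Ints_of_int mult.commute mult.assoc)
    ultimately show ?thesis
      using False unfolding eq by (simp add: integral_unique)
  qed
qed

lemma ev_coeff: "cint (\<lambda>x. ev w x * cis (of_int k * x)) = of_real (2 * pi) * wc w (- k)"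
proof -
  let ?f = "\<lambda>i x. wc w (int_decode i) * cis (of_int (int_decode i) * x) * cis (of_int k * x)"
  have f: "?f i x = wc w (int_decode i) * cis (of_int (int_decode i + k) * x)" for i x
    by (simp add: cis_mult algebra_simps)
  have sm: "summable (\<lambda>i. norm (wc w (int_decode i)))"
    by (rule sums_summable[OF sums_int_decode[OF wc_summable[of w]]])
  have "ev w x * cis (of_int k * x) = (\<Sum>i. ?f i x)" for x
    unfolding ev_def using sums_unique[OF sums_int_decode[OF ev_summable[of w x]]] sums_summable[OF sums_int_decode[OF ev_summable[of w x]]]
    by (simp add: suminf_mult2)
  then have "cint (\<lambda>x. ev w x * cis (of_int k * x)) = cint (\<lambda>x. \<Sum>i. ?f i x)"
    by simp
  also have "\<dots> = (\<Sum>i. cint (?f i))"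
  proof (rule integral_suminf)
    show "integrable circ (?f i)" for i
      by (intro cont_integrable_circ continuous_intros)
    show "AE x in circ. summable (\<lambda>i. norm (?f i x))"
      using sm by (simp add: norm_mult)
    show "summable (\<lambda>i. cint (\<lambda>x. norm (?f i x)))"
      using sm by (simp add: norm_mult)
  qed
  also have "\<dots> = (\<Sum>i. wc w (int_decode i) * (if int_decode i = - k then of_real (2 * pi) else 0))"
    unfolding f by (simp add: integral_cis add_eq_0_iff2 del: of_int_add)
  also have "\<dots> = (\<Sum>i\<in>{int_encode (- k)}. wc w (int_decode i) * (if int_decode i = - k then of_real (2 * pi) else 0))"
    by (rule suminf_finite) (auto, metis int_decode_inverse)
  finally show ?thesis by simp
qed

lemma fourier_coeff_circ: "fourier_coeff f k = cint (\<lambda>x. of_real (f x) * cis (- (of_int k * x))) / of_real (2 * pi)"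
  by (simp add: fourier_coeff_def LINT_circ)

text \<open>The bridge from functions to coefficients: it is applied both to Sobolev functions and
  to the representatives chosen by \<open>weak_deriv\<close>.\<close>

lemma AE_eq_ev:
  assumes f: "integrable circ f" and w: "\<And>k. fourier_coeff f k = wc w k"
  shows "AE x in circ. of_real (f x) = ev w x"
proof -
  have "null_coeffs (\<lambda>x. of_real (f x) - ev w x)"
    unfolding null_coeffs_def
  proof (intro conjI allI)
    have f': "integrable circ (\<lambda>x. complex_of_real (f x))" using f by simp
    have e: "integrable circ (ev w)" by (rule cont_integrable_circ[OF continuous_ev])
    show "integrable circ (\<lambda>x. of_real (f x) - ev w x)" using f' e by simp
    fix k :: int
    have "cint (\<lambda>x. of_real (f x) * cis (of_int k * x)) = of_real (2 * pi) * wc w (- k)"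
      using w[of "- k"] by (simp add: fourier_coeff_circ field_simps)
    then show "cint (\<lambda>x. (of_real (f x) - ev w x) * cis (of_int k * x)) = 0"
      using integrable_mult_cis[OF f'] integrable_mult_cis[OF e] ev_coeff[of w k]
      by (simp add: left_diff_distrib)
  qed
  from null_coeffs_AE_0[OF this] show ?thesis by eventually_elim simp
qed

text \<open>Varying \<open>\<alpha>\<close> gives all phases, and differentiation becomes multiplication of \<open>\<alpha>\<close>.\<close>

definition trig :: "complex \<Rightarrow> int \<Rightarrow> real \<Rightarrow> real" where
  "trig \<alpha> k x = Re (\<alpha> * cis (of_int k * x))"

lemma trig_deriv: "(trig \<alpha> k has_field_derivative trig (\<alpha> * (\<i> * of_int k)) k x) (at x)"
  unfolding trig_def[abs_def] by (auto intro!: derivative_eq_intros simp: algebra_simps)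

lemma deriv_trig: "(deriv ^^ j) (trig \<alpha> k) = trig (\<alpha> * (\<i> * of_int k) ^ j) k"
proof (induction j)
  case (Suc j)
  have "deriv (trig \<beta> k) = trig (\<beta> * (\<i> * of_int k)) k" for \<beta>
    by (rule ext) (rule DERIV_imp_deriv[OF trig_deriv])
  with Suc show ?case
    by (simp add: mult_ac)
qed simp

lemma continuous_trig: "continuous_on UNIV (trig \<alpha> k)"
  unfolding trig_def[abs_def] by (intro continuous_intros)

lemma trig_smooth: "trig \<alpha> k \<in> smooth_torus"
proof -
  have "trig \<alpha> k (x + 2 * pi) = trig \<alpha> k x" for x
  proof -
    have "cis (of_int k * (x + 2 * pi)) = cis (of_int k * x) * cis (of_int k * (2 * pi))"
      by (simp add: cis_mult algebra_simps)
    also have "cis (of_int k * (2 * pi)) = 1"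
      by (metis cis_multiple_2pi Ints_of_int mult.commute mult.assoc)
    finally show ?thesis by (simp add: trig_def)
  qed
  moreover have "(deriv ^^ j) (trig \<alpha> k) field_differentiable at x" for j x
    unfolding deriv_trig field_differentiable_def by (rule exI, rule trig_deriv)
  ultimately show ?thesis
    by (simp add: smooth_torus_def periodic2pi_def)
qed

lemma integral_trig:
  assumes f: "integrable circ f"
  shows "cint (\<lambda>x. f x * trig \<alpha> k x) = Re (\<alpha> * of_real (2 * pi) * fourier_coeff f (- k))"
proof -
  have "integrable circ (\<lambda>x. complex_of_real (f x))" using f by simp
  then have i: "integrable circ (\<lambda>x. \<alpha> * (of_real (f x) * cis (of_int k * x)))"
    by (intro integrable_mult_right integrable_mult_cis)
  have "f x * trig \<alpha> k x = Re (\<alpha> * (of_real (f x) * cis (of_int k * x)))" for x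
    by (simp add: trig_def algebra_simps)
  then have "cint (\<lambda>x. f x * trig \<alpha> k x) = Re (cint (\<lambda>x. \<alpha> * (of_real (f x) * cis (of_int k * x))))"
    using integral_Re[OF i] by simp
  also have "cint (\<lambda>x. \<alpha> * (of_real (f x) * cis (of_int k * x))) = \<alpha> * (of_real (2 * pi) * fourier_coeff f (- k))"
    by (simp add: fourier_coeff_circ)
  finally show ?thesis by (simp add: mult.assoc)
qed


subsection \<open>Weak derivatives and Sobolev functions\<close>

lemma smooth_torusD:
  assumes "\<eta> \<in> smooth_torus"
  shows "\<eta> (2 * pi) = \<eta> 0" "(\<eta> has_field_derivative deriv \<eta> x) (at x)"
    "deriv \<eta> \<in> smooth_torus" "continuous_on UNIV \<eta>"
proof -
  have p: "\<eta> (x + 2 * pi) = \<eta> x" for x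
    using assms by (simp add: smooth_torus_def periodic2pi_def)
  then show "\<eta> (2 * pi) = \<eta> 0"
    using p[of 0] by simp
  have d: "(deriv ^^ k) \<eta> field_differentiable (at x)" for k x
    using assms by (simp add: smooth_torus_def)
  show der: "(\<eta> has_field_derivative deriv \<eta> x) (at x)" for x
    using d[of 0 x] by (simp add: DERIV_deriv_iff_field_differentiable)
  then show "continuous_on UNIV \<eta>"
    by (meson DERIV_isCont continuous_at_imp_continuous_on)
  have "deriv \<eta> (x + 2 * pi) = deriv \<eta> x" for x
  proof (rule DERIV_imp_deriv[symmetric])
    have "((\<lambda>y. \<eta> (y + 2 * pi)) has_field_derivative deriv \<eta> (x + 2 * pi)) (at x)"
      using der[of "x + 2 * pi"] by (simp add: DERIV_shift)
    then show "(\<eta> has_field_derivative deriv \<eta> (x + 2 * pi)) (at x)"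
      by (simp add: p)
  qed
  moreover have "(deriv ^^ k) (deriv \<eta>) field_differentiable (at x)" for k x
    using d[of "Suc k" x] by (simp add: funpow_swap1)
  ultimately show "deriv \<eta> \<in> smooth_torus"
    by (simp add: smooth_torus_def periodic2pi_def)
qed

lemma smooth_torus_derivs: "\<eta> \<in> smooth_torus \<Longrightarrow> (deriv ^^ j) \<eta> \<in> smooth_torus"
  by (induction j) (auto intro: smooth_torusD(3))

lemma Re_ev_deriv: "dec 3 w \<Longrightarrow> ((\<lambda>x. Re (ev w x)) has_field_derivative Re (ev (wD w) x)) (at x)"
  using ev_deriv[of w x] by (simp add: has_vector_derivative_complex_iff has_real_derivative_iff_has_vector_derivative)

lemma continuous_Re_ev: "continuous_on UNIV (\<lambda>x. Re (ev w x))"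
  by (intro continuous_on_Re continuous_ev)

lemma integral_by_parts_ev:
  assumes w: "dec 3 w" and \<eta>: "\<eta> \<in> smooth_torus"
  shows "cint (\<lambda>x. Re (ev w x) * deriv \<eta> x) = - cint (\<lambda>x. Re (ev (wD w) x) * \<eta> x)"
proof -
  note c = smooth_torusD(4)[OF \<eta>] smooth_torusD(4)[OF smooth_torusD(3)[OF \<eta>]] continuous_Re_ev
  have i: "integrable circ (\<lambda>x. Re (ev w x) * deriv \<eta> x)" "integrable circ (\<lambda>x. Re (ev (wD w) x) * \<eta> x)"
    by (intro cont_integrable_circ continuous_on_mult c)+
  have "((\<lambda>x. Re (ev w x) * deriv \<eta> x + Re (ev (wD w) x) * \<eta> x) has_integral
      Re (ev w (2 * pi)) * \<eta> (2 * pi) - Re (ev w 0) * \<eta> 0) {0..2*pi}"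
  proof (rule fundamental_theorem_of_calculus)
    fix x
    have "((\<lambda>x. Re (ev w x) * \<eta> x) has_field_derivative (Re (ev w x) * deriv \<eta> x + Re (ev (wD w) x) * \<eta> x)) (at x)"
      by (rule derivative_eq_intros Re_ev_deriv[OF w] smooth_torusD(2)[OF \<eta>] refl)+ simp
    then show "((\<lambda>x. Re (ev w x) * \<eta> x) has_vector_derivative (Re (ev w x) * deriv \<eta> x + Re (ev (wD w) x) * \<eta> x)) (at x within {0..2*pi})"
      by (simp add: has_real_derivative_iff_has_vector_derivative has_vector_derivative_at_within)
  qed simp
  moreover have "ev w (2 * pi) = ev w 0"
    using ev_periodic[of w 0] by simp
  ultimately have "integral {0..2*pi} (\<lambda>x. Re (ev w x) * deriv \<eta> x + Re (ev (wD w) x) * \<eta> x) = 0"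
    by (simp add: smooth_torusD(1)[OF \<eta>] integral_unique)
  moreover have "cint (\<lambda>x. Re (ev w x) * deriv \<eta> x + Re (ev (wD w) x) * \<eta> x) =
      integral {0..2*pi} (\<lambda>x. Re (ev w x) * deriv \<eta> x + Re (ev (wD w) x) * \<eta> x)"
    using i by (intro lebesgue_integral_eq_integral) auto
  ultimately show ?thesis
    using i by simp
qed

lemma integral_by_parts_ev_pow:
  assumes "dec (j + 2) w" "\<eta> \<in> smooth_torus"
  shows "cint (\<lambda>x. Re (ev w x) * (deriv ^^ j) \<eta> x) = (-1) ^ j * cint (\<lambda>x. Re (ev ((wD ^^ j) w) x) * \<eta> x)"
  using assms
proof (induction j arbitrary: \<eta>)
  case (Suc j)
  have "dec 3 ((wD ^^ j) w)"
    using Suc.prems(1) by (intro dec_wDpow) (auto simp: eval_nat_numeral)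
  note p = integral_by_parts_ev[OF this Suc.prems(2)]
  have "dec (j + 2) w" using Suc.prems(1) by (rule X_mono) simp
  from Suc.IH[OF this smooth_torusD(3)[OF Suc.prems(2)]] show ?case
    by (simp add: p funpow_swap1)
qed simp

lemma trig_eqI:
  assumes "\<And>\<alpha>. Re (\<alpha> * z) = Re (\<alpha> * w)"
  shows "z = w"
  using assms[of 1] assms[of "\<i>"] by (simp add: complex_eq_iff)

text \<open>Test functions are real, so real trigonometric functions of every phase are used, and
  the complex identity is recovered by \<open>trig_eqI\<close>. It holds for any weak derivative,
  whichever representative is picked.\<close>

lemma fourier_coeff_weak_deriv:
  assumes "has_weak_deriv j f g"
  shows "fourier_coeff g n = (\<i> * of_int n) ^ j * fourier_coeff f n"
proof -
  define k where "k = - n"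
  have fg: "integrable circ f" "integrable circ g"
    using assms by (auto simp: has_weak_deriv_def set_integrable_circ)
  have "(-1) ^ j * ((\<i> * of_int k) ^ j * (of_real (2 * pi) * fourier_coeff f (- k))) = of_real (2 * pi) * fourier_coeff g (- k)"
  proof (rule trig_eqI)
    fix \<alpha>
    have "cint (\<lambda>x. f x * trig (\<alpha> * (\<i> * of_int k) ^ j) k x) = (-1) ^ j * cint (\<lambda>x. g x * trig \<alpha> k x)"
      using assms trig_smooth[of \<alpha> k] unfolding has_weak_deriv_def LINT_circ by (auto simp: deriv_trig)
    then have "Re ((\<alpha> * (\<i> * of_int k) ^ j) * of_real (2 * pi) * fourier_coeff f (- k)) = (-1) ^ j * Re (\<alpha> * of_real (2 * pi) * fourier_coeff g (- k))"
      unfolding integral_trig[OF fg(1)] integral_trig[OF fg(2)] .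
    then have "(-1) ^ j * Re ((\<alpha> * (\<i> * of_int k) ^ j) * of_real (2 * pi) * fourier_coeff f (- k)) = Re (\<alpha> * of_real (2 * pi) * fourier_coeff g (- k))"
      by (simp flip: mult.assoc power_mult_distrib)
    moreover have "(-1) ^ j * Re z = Re ((-1) ^ j * z)" for z
      by (cases "even j") auto
    moreover have "\<alpha> * ((-1) ^ j * ((\<i> * of_int k) ^ j * (of_real (2 * pi) * fourier_coeff f (- k)))) =
        (-1) ^ j * ((\<alpha> * (\<i> * of_int k) ^ j) * of_real (2 * pi) * fourier_coeff f (- k))"
      by (simp only: mult_ac)
    ultimately show "Re (\<alpha> * ((-1) ^ j * ((\<i> * of_int k) ^ j * (of_real (2 * pi) * fourier_coeff f (- k))))) = Re (\<alpha> * (of_real (2 * pi) * fourier_coeff g (- k)))"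
      by (simp only: mult.assoc)
  qed
  then have "(-1) ^ j * (\<i> * of_int k) ^ j * fourier_coeff f (- k) = fourier_coeff g (- k)"
    by (simp add: mult_ac)
  moreover have "(-1) ^ j * (\<i> * of_int k) ^ j = (\<i> * of_int n) ^ j"
    by (simp add: k_def flip: power_mult_distrib)
  ultimately show ?thesis by (simp add: k_def)
qed

section \<open>Sobolev functions as elements of the Wiener algebra\<close>

definition fser :: "(real \<Rightarrow> real) \<Rightarrow> wiener" where
  "fser f = Abs_wiener (fourier_coeff f)"

lemma Hs_integrable: "f \<in> Hs s \<Longrightarrow> integrable circ f"
proof -
  assume f: "f \<in> Hs s"
  have m: "f \<in> borel_measurable circ"
    using f by (auto simp: Hs_def intro: measurable_restrict_space1)
  have "integrable circ (\<lambda>x. (f x)\<^sup>2)"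
    using f by (simp add: Hs_def set_integrable_circ)
  then have "integrable circ (\<lambda>x. 1 + (f x)\<^sup>2)"
    by (rule Bochner_Integration.integrable_add[OF cont_integrable_circ[OF continuous_on_const]])
  then show ?thesis
  proof (rule Bochner_Integration.integrable_bound[OF _ m])
    have "\<bar>y\<bar> \<le> 1 + y\<^sup>2" for y :: real
      using zero_le_power2[of "\<bar>y\<bar> - 1"] by (simp add: power2_diff)
    then show "AE x in circ. norm (f x) \<le> norm (1 + (f x)\<^sup>2)"
      by (simp add: abs_of_nonneg)
  qed
qed

lemma jb_power_le: "jb n ^ 26 \<le> 2 ^ 13 * (1 + (real_of_int n)\<^sup>2) powr 13"
proof -
  have "jb n ^ 2 \<le> 2 * (1 + (real_of_int n)\<^sup>2)"
    using zero_le_power2[of "\<bar>real_of_int n\<bar> - 1"] by (simp add: jb_def power2_sum power2_diff)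
  then have "(jb n ^ 2) ^ 13 \<le> (2 * (1 + (real_of_int n)\<^sup>2)) ^ 13"
    by (intro power_mono) auto
  also have "(1 + (real_of_int n)\<^sup>2) powr 13 = (1 + (real_of_int n)\<^sup>2) ^ 13"
    by (subst powr_realpow[symmetric]) (auto simp: add_pos_nonneg)
  ultimately show ?thesis
    unfolding power_mult_distrib power_mult[symmetric] by simp
qed

text \<open>A single term is bounded by the whole sum. Summability has to be assumed, since
  \<open>Hs_norm\<close> of a divergent sum would be 0.\<close>

lemma coeff_le_Hs_norm:
  assumes "(\<lambda>k. (1 + (of_int k)\<^sup>2) powr 13 * (cmod (fourier_coeff f k))\<^sup>2) summable_on UNIV"
  shows "cmod (fourier_coeff f n) \<le> 2 ^ 7 * Hs_norm 13 f / jb n ^ 13"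
proof -
  define S where "S = (\<Sum>\<^sub>\<infinity>k. (1 + (of_int k)\<^sup>2) powr 13 * (cmod (fourier_coeff f k))\<^sup>2)"
  have "(1 + (of_int n)\<^sup>2) powr 13 * (cmod (fourier_coeff f n))\<^sup>2 \<le> S"
    unfolding S_def using finite_sum_le_infsum[OF assms, of "{n}"] by simp
  then have "2 ^ 13 * ((1 + (of_int n)\<^sup>2) powr 13 * (cmod (fourier_coeff f n))\<^sup>2) \<le> 2 ^ 13 * S"
    by simp
  then have "jb n ^ 26 * (cmod (fourier_coeff f n))\<^sup>2 \<le> 2 ^ 13 * S"
    using mult_right_mono[OF jb_power_le[of n] zero_le_power2[of "cmod (fourier_coeff f n)"]] by (simp add: mult.assoc)
  \<comment> \<open>Rounding up to an even exponent makes the square root the integer power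
    \<open>2 ^ 7\<close>.\<close>
  also have "\<dots> \<le> 2 ^ 14 * S"
    using infsum_nonneg[of UNIV "\<lambda>k. (1 + (of_int k)\<^sup>2) powr 13 * (cmod (fourier_coeff f k))\<^sup>2"] by (simp add: S_def)
  finally have "(jb n ^ 13 * cmod (fourier_coeff f n))\<^sup>2 \<le> 2 ^ 14 * S"
    by (simp add: power_mult_distrib flip: power_mult)
  then have "jb n ^ 13 * cmod (fourier_coeff f n) \<le> sqrt (2 ^ 14 * S)"
    by (rule real_le_rsqrt)
  also have "\<dots> = 2 ^ 7 * Hs_norm 13 f"
  proof -
    have "sqrt (2 ^ 14) = (2 ^ 7 :: real)" by (rule real_sqrt_unique) auto
    then show ?thesis by (simp add: Hs_norm_def S_def real_sqrt_mult)
  qed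
  finally show ?thesis
    by (simp add: pos_le_divide_eq mult.commute)
qed

lemma Hs_fser:
  assumes "f \<in> Hs 13"
  shows "wc (fser f) = fourier_coeff f" "dec 13 (fser f)"
proof -
  have b: "cmod (fourier_coeff f n) \<le> (2 ^ 7 * Hs_norm 13 f) / jb n ^ 13" for n
    using assms by (intro coeff_le_Hs_norm) (simp add: Hs_def)
  have "fourier_coeff f abs_summable_on UNIV"
    using b summable_on_cmult_right[OF jb_summable[of 13], of "2 ^ 7 * Hs_norm 13 f"]
    by (intro Infinite_Sum.abs_summable_on_comparison_test'[where g = "\<lambda>n. 2 ^ 7 * Hs_norm 13 f * (1 / jb n ^ 13)"]) auto
  then show 1: "wc (fser f) = fourier_coeff f"
    unfolding fser_def by (rule wc_Abs)
  show "dec 13 (fser f)"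
    by (rule XI[where c = "2 ^ 7 * Hs_norm 13 f"]) (use b 1 in simp)
qed

lemma Hs_AE_ev: "f \<in> Hs 13 \<Longrightarrow> AE x in circ. of_real (f x) = ev (fser f) x"
  by (rule AE_eq_ev) (simp_all add: Hs_integrable Hs_fser)

text \<open>The termwise derivative of the Fourier series is a weak derivative, so the choice in
  \<open>weak_deriv\<close> is not vacuous; equality of the Fourier coefficients then identifies the
  chosen function almost everywhere.\<close>

lemma weak_deriv_Hs:
  assumes f: "f \<in> Hs 13" and j: "j \<le> 3"
  shows "integrable circ (weak_deriv j f)" "AE x in circ. of_real (weak_deriv j f x) = ev ((wD ^^ j) (fser f)) x"
proof -
  have d: "dec (j + 2) (fser f)"
    using Hs_fser(2)[OF f] by (rule X_mono) (use j in simp)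
  let ?g = "\<lambda>x. Re (ev ((wD ^^ j) (fser f)) x)"
  have "has_weak_deriv j f ?g"
    unfolding has_weak_deriv_def set_integrable_circ LINT_circ
  proof (intro conjI ballI)
    show "integrable circ ?g" by (intro cont_integrable_circ continuous_Re_ev)
    fix \<eta> assume \<eta>: "\<eta> \<in> smooth_torus"
    have "cint (\<lambda>x. f x * (deriv ^^ j) \<eta> x) = cint (\<lambda>x. Re (ev (fser f) x) * (deriv ^^ j) \<eta> x)"
    proof (rule integral_cong_AE)
      have m: "(deriv ^^ j) \<eta> \<in> borel_measurable circ"
        by (rule cont_measurable_circ[OF smooth_torusD(4)[OF smooth_torus_derivs[OF \<eta>]]])
      show "(\<lambda>x. f x * (deriv ^^ j) \<eta> x) \<in> borel_measurable circ"
        by (intro borel_measurable_times m borel_measurable_integrable Hs_integrable[OF f])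
      show "(\<lambda>x. Re (ev (fser f) x) * (deriv ^^ j) \<eta> x) \<in> borel_measurable circ"
        by (intro borel_measurable_times m cont_measurable_circ continuous_Re_ev)
      show "AE x in circ. f x * (deriv ^^ j) \<eta> x = Re (ev (fser f) x) * (deriv ^^ j) \<eta> x"
        using Hs_AE_ev[OF f] by eventually_elim (metis Re_complex_of_real)
    qed
    then show "cint (\<lambda>x. f x * (deriv ^^ j) \<eta> x) = (-1) ^ j * cint (\<lambda>x. ?g x * \<eta> x)"
      by (simp add: integral_by_parts_ev_pow[OF d \<eta>])
  qed (rule Hs_integrable[OF f])
  then have w: "has_weak_deriv j f (weak_deriv j f)"
    unfolding weak_deriv_def by (rule someI[of "has_weak_deriv j f"])
  then show i: "integrable circ (weak_deriv j f)"
    by (simp add: has_weak_deriv_def set_integrable_circ)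
  show "AE x in circ. of_real (weak_deriv j f x) = ev ((wD ^^ j) (fser f)) x"
    by (rule AE_eq_ev[OF i]) (simp add: fourier_coeff_weak_deriv[OF w] wc_wDpow[OF d] Hs_fser[OF f])
qed


subsection \<open>The nonlinearity on Fourier coefficients\<close>

lemma AE_monomial:
  assumes f: "f \<in> Hs 13"
  shows "AE x in circ. of_real (l * weak_deriv 3 f x ^ a * weak_deriv 2 f x ^ b * weak_deriv 1 f x ^ c * f x ^ d) =
    ev (monomial l a b c d (fser f)) x"
  using weak_deriv_Hs(2)[OF f, of 3, simplified] weak_deriv_Hs(2)[OF f, of 2, simplified]
    weak_deriv_Hs(2)[OF f, of 1, simplified] Hs_AE_ev[OF f]
  by eventually_elim (simp add: monomial_def ev_mult ev_power ev_cst)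

lemma borel_measurable_Hs_monomial:
  assumes f: "f \<in> Hs 13"
  shows "(\<lambda>x. l * weak_deriv 3 f x ^ a * weak_deriv 2 f x ^ b * weak_deriv 1 f x ^ c * f x ^ d) \<in> borel_measurable circ"
  using weak_deriv_Hs(1)[OF f, THEN borel_measurable_integrable] Hs_integrable[OF f, THEN borel_measurable_integrable]
  by (intro borel_measurable_times borel_measurable_power borel_measurable_const) auto

text \<open>The symmetry of coefficients of real functions. It survives products and derivatives and
  is the reason why the means of \<open>Aw\<close> and \<open>Bw\<close> are real.\<close>

definition herm :: "wiener \<Rightarrow> bool" where
  "herm w \<longleftrightarrow> (\<forall>n. wc w (- n) = cnj (wc w n))"

lemma herm_mult: "herm f \<Longrightarrow> herm g \<Longrightarrow> herm (f * g)"
  unfolding herm_def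
proof
  fix n assume f: "\<forall>n. wc f (- n) = cnj (wc f n)" and g: "\<forall>n. wc g (- n) = cnj (wc g n)"
  have "wc (f * g) (- n) = (\<Sum>\<^sub>\<infinity>m. cnj (wc f m * wc g (n - m)))"
    unfolding wc_mult
  proof (rule infsum_reindex_bij_witness[of _ uminus uminus])
    fix m :: int
    have "wc g (- n - m) = cnj (wc g (n - (- m)))"
      using g[rule_format, of "n + m"] by (simp add: minus_add_distrib)
    moreover have "wc f m = cnj (wc f (- m))"
      using f[rule_format, of "- m"] by simp
    ultimately show "cnj (wc f (- m) * wc g (n - - m)) = wc f m * wc g (- n - m)"
      by simp
  qed auto
  also have "\<dots> = cnj (wc (f * g) n)"
    by (simp only: infsum_cnj wc_mult)
  finally show "wc (f * g) (- n) = cnj (wc (f * g) n)" .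
qed

lemma herm_1: "herm 1"
  by (simp add: herm_def wc_1)

lemma herm_power: "herm f \<Longrightarrow> herm (f ^ k)"
  by (induction k) (auto intro: herm_1 herm_mult)

lemma herm_wDpow: "dec (j + 2) w \<Longrightarrow> herm w \<Longrightarrow> herm ((wD ^^ j) w)"
  by (auto simp: herm_def wc_wDpow)

lemma herm_monomial: "dec 5 w \<Longrightarrow> herm w \<Longrightarrow> herm (monomial l a b c d w)"
proof -
  assume w: "dec 5 w" "herm w"
  have D: "herm ((wD ^^ j) w)" if "j \<le> 3" for j
    using X_mono[OF w(1), of "j + 2"] that by (intro herm_wDpow w) auto
  have "herm (wD w)" using D[of 1] by simp
  then show ?thesis
    unfolding monomial_def using D[of 3] D[of 2]
    by (intro herm_mult herm_power w) (auto simp: herm_def wc_cst)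
qed

lemma herm_sum: "(\<And>i. i \<in> A \<Longrightarrow> herm (f i)) \<Longrightarrow> herm (\<Sum>i\<in>A. f i)"
  by (auto simp: herm_def wc_sum)

lemma herm_Im_0: "herm w \<Longrightarrow> Im (wc w 0) = 0"
  unfolding herm_def by (auto dest!: spec[of _ 0] simp: complex_eq_iff)

lemma herm_fser: "f \<in> Hs 13 \<Longrightarrow> herm (fser f)"
proof -
  assume f: "f \<in> Hs 13"
  show ?thesis
    unfolding herm_def Hs_fser(1)[OF f]
  proof
    fix n
    have "cnj (cint (\<lambda>x. of_real (f x) * cis (- (of_int n * x)))) =
        cint (\<lambda>x. cnj (of_real (f x) * cis (- (of_int n * x))))"
      by (rule integral_bounded_linear'[OF bounded_linear_cnj bounded_linear_cnj, symmetric]) simp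
    also have "(\<lambda>x. cnj (of_real (f x) * cis (- (of_int n * x)))) = (\<lambda>x. of_real (f x) * cis (- (of_int (- n) * x)))"
      by (simp add: cis_cnj)
    finally show "fourier_coeff f (- n) = cnj (fourier_coeff f n)"
      by (simp add: fourier_coeff_circ)
  qed
qed

lemma integral_ev_0: "cint (ev w) = of_real (2 * pi) * wc w 0"
  using ev_coeff[of w 0] by simp

context flow
begin

abbreviation NL :: "(real \<Rightarrow> real) \<Rightarrow> real \<Rightarrow> real" where
  "NL f x \<equiv> nonlinearity j0 lam a b c d (weak_deriv 3 f x) (weak_deriv 2 f x) (weak_deriv 1 f x) (f x)"

lemma AE_N: "f \<in> Hs 13 \<Longrightarrow> AE x in circ. of_real (NL f x) = ev (Nw (fser f)) x"
proof -
  assume f: "f \<in> Hs 13"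
  have "AE x in circ. \<forall>j\<in>{1..j0}. of_real (lam j * weak_deriv 3 f x ^ a j * weak_deriv 2 f x ^ b j * weak_deriv 1 f x ^ c j * f x ^ d j) =
    ev (monomial (lam j) (a j) (b j) (c j) (d j) (fser f)) x"
    using AE_monomial[OF f] by (intro AE_finite_allI) auto
  then show ?thesis
    by eventually_elim (simp only: nonlinearity_def Nw_def ev_sum of_real_sum cong: sum.cong)
qed

lemma borel_measurable_N: "f \<in> Hs 13 \<Longrightarrow> NL f \<in> borel_measurable circ"
  unfolding nonlinearity_def by (intro borel_measurable_sum borel_measurable_Hs_monomial)

lemma integral_N_trig:
  assumes f: "f \<in> Hs 13"
  shows "cint (\<lambda>x. NL f x * trig \<alpha> k x) =
    Re (\<alpha> * of_real (2 * pi) * wc (Nw (fser f)) (- k))"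
proof -
  let ?g = "\<lambda>x. \<alpha> * (ev (Nw (fser f)) x * cis (of_int k * x))"
  have g: "integrable circ ?g"
    by (intro cont_integrable_circ continuous_intros continuous_ev)
  have "cint (\<lambda>x. NL f x * trig \<alpha> k x) = cint (\<lambda>x. Re (?g x))"
  proof (rule integral_cong_AE)
    show "(\<lambda>x. Re (?g x)) \<in> borel_measurable circ"
      by (rule borel_measurable_integrable[OF integrable_Re[OF g]])
    show "(\<lambda>x. NL f x * trig \<alpha> k x) \<in> borel_measurable circ"
      by (intro borel_measurable_times borel_measurable_N[OF f] cont_measurable_circ continuous_trig)
    show "AE x in circ. NL f x * trig \<alpha> k x = Re (?g x)"
      using AE_N[OF f]
    proof eventually_elim
      case (elim x)
      show ?case unfolding elim[symmetric] by (simp add: trig_def algebra_simps)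
    qed
  qed
  also have "\<dots> = Re (cint ?g)"
    by (rule integral_Re[OF g])
  also have "cint ?g = \<alpha> * of_real (2 * pi) * wc (Nw (fser f)) (- k)"
    by (simp add: ev_coeff)
  finally show ?thesis .
qed

text \<open>Connects the sign condition with the damping rate: the integrand of \<open>P_N\<close>,
  with its factor b, is the formal derivative in the second derivative, and the integral over a
  period divided by 2 pi is the zeroth coefficient.\<close>

lemma P_N_eq:
  assumes f: "f \<in> Hs 13"
  shows "P_N j0 lam a b c d f = Re (wc (Bw (fser f)) 0)"
proof -
  have "P_term l a b c d f = Re (wc (monomial (l * b) a (b - 1) c d (fser f)) 0)" for l a b c d
  proof (cases "b = 0")
    case True
    then show ?thesis by (simp add: P_term_def monomial_def)
  next
    case False
    let ?m = "monomial (l * b) a (b - 1) c d (fser f)"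
    have g: "integrable circ (ev ?m)" by (rule cont_integrable_circ[OF continuous_ev])
    have "l * b * cint (P_integrand a b c d f) =
        cint (\<lambda>x. l * b * weak_deriv 3 f x ^ a * weak_deriv 2 f x ^ (b - 1) * weak_deriv 1 f x ^ c * f x ^ d)"
      by (simp add: P_integrand_def[abs_def] mult.assoc)
    also have "\<dots> = cint (\<lambda>x. Re (ev ?m x))"
    proof (rule integral_cong_AE)
      show "(\<lambda>x. l * b * weak_deriv 3 f x ^ a * weak_deriv 2 f x ^ (b - 1) * weak_deriv 1 f x ^ c * f x ^ d) \<in> borel_measurable circ"
        by (rule borel_measurable_Hs_monomial[OF f])
      show "AE x in circ. l * b * weak_deriv 3 f x ^ a * weak_deriv 2 f x ^ (b - 1) * weak_deriv 1 f x ^ c * f x ^ d = Re (ev ?m x)"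
        using AE_monomial[OF f, of "l * b" a "b - 1" c d] by eventually_elim (metis Re_complex_of_real)
    qed (use g in auto)
    also have "\<dots> = 2 * pi * Re (wc ?m 0)"
      using integral_Re[OF g] by (simp add: integral_ev_0)
    finally have "l * b * cint (P_integrand a b c d f) = 2 * pi * Re (wc ?m 0)" .
    then show ?thesis
      using False by (simp add: P_term_def LINT_circ)
  qed
  then show ?thesis
    by (simp add: P_N_def Bw_def wc_sum)
qed

lemma herm_AB: "f \<in> Hs 13 \<Longrightarrow> Im (wc (Aw (fser f)) 0) = 0 \<and> Im (wc (Bw (fser f)) 0) = 0"
  unfolding Aw_def Bw_def
  by (intro conjI herm_Im_0 herm_sum herm_monomial herm_fser X_mono[OF Hs_fser(2)]) auto

end

subsection \<open>Smooth cutoff functions\<close>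

definition flat :: "real poly \<Rightarrow> real \<Rightarrow> real" where
  "flat p x = (if x > 0 then poly p (1 / x) * exp (- (1 / x)) else 0)"

lemma poly_exp_tendsto_0: "((\<lambda>y. poly p y * exp (- y)) \<longlongrightarrow> 0) (at_top :: real filter)"
proof (induction p)
  case (pCons a p)
  have *: "((\<lambda>y. y * (poly p y * exp (- y))) \<longlongrightarrow> 0) at_top" for p :: "real poly"
  proof -
    have "((\<lambda>y::real. \<Sum>i\<le>degree p. coeff p i * (y ^ Suc i / exp y)) \<longlongrightarrow> (\<Sum>i\<le>degree p. coeff p i * 0)) at_top"
      by (intro tendsto_sum tendsto_mult tendsto_const tendsto_power_div_exp_0)
    moreover have "(\<Sum>i\<le>degree p. coeff p i * (y ^ Suc i / exp y)) = y * (poly p y * exp (- y))" for y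
      by (simp add: poly_altdef exp_minus divide_inverse sum_distrib_left sum_distrib_right mult_ac)
    ultimately show ?thesis by simp
  qed
  have "((\<lambda>y::real. a * (y ^ 0 / exp y) + y * (poly p y * exp (- y))) \<longlongrightarrow> a * 0 + 0) at_top"
    by (intro tendsto_add tendsto_mult tendsto_const tendsto_power_div_exp_0 *)
  then show ?case
    by (simp add: exp_minus divide_inverse algebra_simps)
qed simp

text \<open>With y = 1 / x, the x-derivative of p(y) exp (- y) is y^2 (p(y) - p'(y)) exp (- y), and
  \<open>[:0, 0, 1:]\<close> is y^2. So the functions \<open>flat p\<close> are closed under
  differentiation.\<close>

lemma flat_has_derivative: "(flat p has_real_derivative flat ([:0, 0, 1:] * (p - pderiv p)) x) (at x)"
proof (cases x "0::real" rule: linorder_cases)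
  case less
  have "((\<lambda>_. 0) has_real_derivative 0) (at x)" by simp
  then have "(flat p has_real_derivative 0) (at x)"
    by (rule has_field_derivative_transform_within_open[of _ _ _ "{..<0}"]) (use less in \<open>auto simp: flat_def\<close>)
  then show ?thesis using less by (simp add: flat_def)
next
  case greater
  have "((\<lambda>x. poly p (1 / x) * exp (- (1 / x))) has_real_derivative
      poly ([:0, 0, 1:] * (p - pderiv p)) (1 / x) * exp (- (1 / x))) (at x)"
    using greater
    by (auto intro!: derivative_eq_intros poly_DERIV[THEN DERIV_chain2] simp: field_simps power2_eq_square)
  then have "(flat p has_real_derivative poly ([:0, 0, 1:] * (p - pderiv p)) (1 / x) * exp (- (1 / x))) (at x)"
    by (rule has_field_derivative_transform_within_open[of _ _ _ "{0<..}"]) (use greater in \<open>auto simp: flat_def\<close>)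
  then show ?thesis using greater by (simp add: flat_def)
next
  case equal
  have "((\<lambda>y. (flat p y - flat p 0) / (y - 0)) \<longlongrightarrow> 0) (at_left 0)"
    by (rule Lim_transform_eventually[OF tendsto_const])
       (auto simp: flat_def eventually_at_filter intro!: always_eventually)
  moreover have "((\<lambda>y. (flat p y - flat p 0) / (y - 0)) \<longlongrightarrow> 0) (at_right 0)"
  proof (rule Lim_transform_eventually)
    \<comment> \<open>The difference quotient at 0 has an additional factor 1 / y, that is, the
      polynomial is multiplied by its variable: \<open>pCons 0 p\<close>.\<close>
    show "((\<lambda>y. poly (pCons 0 p) (inverse y) * exp (- inverse y)) \<longlongrightarrow> 0) (at_right (0::real))"
      by (rule filterlim_compose[OF poly_exp_tendsto_0 filterlim_inverse_at_top_right])
    show "\<forall>\<^sub>F y in at_right 0. poly (pCons 0 p) (inverse y) * exp (- inverse y) = (flat p y - flat p 0) / (y - 0)"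
      by (auto simp: flat_def eventually_at_filter field_simps intro!: always_eventually)
  qed
  ultimately have "((\<lambda>y. (flat p y - flat p 0) / (y - 0)) \<longlongrightarrow> 0) (at 0)"
    by (simp add: filterlim_split_at)
  then show ?thesis
    using equal by (simp add: has_field_derivative_iff flat_def)
qed

definition bump :: "real \<Rightarrow> real" where
  "bump x = flat 1 x * flat 1 (1 - x)"

lemma bump_nonneg: "bump x \<ge> 0" and bump_pos: "0 < x \<Longrightarrow> x < 1 \<Longrightarrow> bump x > 0"
  and bump_0: "x \<le> 0 \<or> x \<ge> 1 \<Longrightarrow> bump x = 0"
  by (auto simp: bump_def flat_def)

lemma continuous_flat: "continuous_on S (flat p)"
  by (intro continuous_at_imp_continuous_on ballI DERIV_isCont[OF flat_has_derivative])

lemma continuous_bump: "continuous_on S bump"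
  unfolding bump_def[abs_def]
  by (intro continuous_on_mult continuous_flat continuous_on_compose2[OF continuous_flat[of UNIV]] continuous_intros) auto

definition bstep :: "real \<Rightarrow> real" where
  "bstep x = integral {0..x} bump"

lemma bstep_0: "x \<le> 0 \<Longrightarrow> bstep x = 0"
  by (cases "x = 0") (auto simp: bstep_def)

lemma bump_integrable: "bump integrable_on {a..b}"
  by (rule integrable_continuous_real[OF continuous_bump])

text \<open>Moves the base point to the left of x, so that the fundamental theorem of calculus gives
  a two-sided derivative also at x \<le> 0, where \<open>{0..x}\<close> is empty or a point.\<close>

lemma bstep_from: "a \<le> 0 \<Longrightarrow> a \<le> x \<Longrightarrow> bstep x = integral {a..x} bump"
proof -
  assume a: "a \<le> 0" "a \<le> x"
  have 0: "integral {a..y} bump = 0" if "y \<le> 0" for y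
    using integral_cong[of "{a..y}" bump "\<lambda>_. 0"] that by (simp add: bump_0)
  show ?thesis
  proof (cases "x \<le> 0")
    case True
    then show ?thesis using 0[of x] by (simp add: bstep_0)
  next
    case False
    then have "integral {a..0} bump + integral {0..x} bump = integral {a..x} bump"
      using a by (intro Henstock_Kurzweil_Integration.integral_combine bump_integrable) auto
    then show ?thesis using 0[of 0] by (simp add: bstep_def)
  qed
qed

lemma bstep_has_derivative: "(bstep has_real_derivative bump x) (at x)"
proof -
  define a where "a = min 0 x - 1"
  have "((\<lambda>y. integral {a..y} bump) has_real_derivative bump x) (at x within {a..x+1})"
    by (rule integral_has_real_derivative[OF continuous_bump]) (auto simp: a_def)
  then have "((\<lambda>y. integral {a..y} bump) has_real_derivative bump x) (at x)"
    by (simp add: a_def at_within_Icc_at)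
  then show ?thesis
    by (rule has_field_derivative_transform_within_open[of _ _ _ "{a<..}"])
       (auto simp: a_def intro!: bstep_from[symmetric])
qed

lemma bstep_ge_1: "x \<ge> 1 \<Longrightarrow> bstep x = bstep 1"
proof -
  assume x: "x \<ge> 1"
  have "integral {0..1} bump + integral {1..x} bump = integral {0..x} bump"
    using x by (intro Henstock_Kurzweil_Integration.integral_combine bump_integrable) auto
  moreover have "integral {1..x} bump = 0"
    using integral_cong[of "{1..x}" bump "\<lambda>_. 0"] by (simp add: bump_0)
  ultimately show ?thesis by (simp add: bstep_def)
qed

lemma bstep_1_pos: "bstep 1 > 0"
proof -
  have "\<exists>z. 0 < z \<and> z < 1 \<and> bstep 1 - bstep 0 = (1 - 0) * bump z"
    by (rule MVT2) (auto intro: bstep_has_derivative)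
  then show ?thesis using bump_pos by (auto simp: bstep_0)
qed

text \<open>
  The class is closed under differentiation, so that all its members are smooth although no product
  or chain rule for higher derivatives is available.
\<close>

inductive cutoff :: "(real \<Rightarrow> real) \<Rightarrow> bool" where
  flat: "cutoff (\<lambda>x. flat p (m * x + c))"
| bstep: "cutoff (\<lambda>x. bstep (m * x + c))"
| const: "cutoff (\<lambda>x. c)"
| add: "cutoff f \<Longrightarrow> cutoff g \<Longrightarrow> cutoff (\<lambda>x. f x + g x)"
| mult: "cutoff f \<Longrightarrow> cutoff g \<Longrightarrow> cutoff (\<lambda>x. f x * g x)"

lemma cutoff_bump: "cutoff (\<lambda>x. bump (m * x + c))"
  using cutoff.mult[OF cutoff.flat[of 1 m c] cutoff.flat[of 1 "- m" "1 - c"]]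
  by (simp add: bump_def algebra_simps)

lemma cutoff_has_derivative: "cutoff f \<Longrightarrow> \<exists>f'. cutoff f' \<and> (\<forall>x. (f has_real_derivative f' x) (at x))"
proof (induction rule: cutoff.induct)
  case (flat p m c)
  have "((\<lambda>x. flat p (m * x + c)) has_real_derivative m * flat ([:0, 0, 1:] * (p - pderiv p)) (m * x + c)) (at x)" for x
  proof -
    have "((\<lambda>x. m * x + c) has_real_derivative m) (at x)" by (auto intro!: derivative_eq_intros)
    from DERIV_chain2[OF flat_has_derivative this] show ?thesis by (simp only: mult.commute)
  qed
  then show ?case
    using cutoff.mult[OF cutoff.const cutoff.flat] by blast
next
  case (bstep m c)
  have "((\<lambda>x. bstep (m * x + c)) has_real_derivative m * bump (m * x + c)) (at x)" for x
  proof -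
    have "((\<lambda>x. m * x + c) has_real_derivative m) (at x)" by (auto intro!: derivative_eq_intros)
    from DERIV_chain2[OF bstep_has_derivative this] show ?thesis by (simp only: mult.commute)
  qed
  then show ?case
    using cutoff.mult[OF cutoff.const cutoff_bump] by blast
next
  case (const c)
  then show ?case using cutoff.const[of 0] by (intro exI[of _ "\<lambda>_. 0"]) auto
next
  case (add f g)
  then show ?case by (blast intro: cutoff.add DERIV_add)
next
  case (mult f g)
  then obtain f' g' where *: "cutoff f'" "cutoff g'" "\<And>x. (f has_real_derivative f' x) (at x)" "\<And>x. (g has_real_derivative g' x) (at x)"
    by blast
  have "cutoff (\<lambda>x. f' x * g x + g' x * f x)"
    using mult * by (intro cutoff.add cutoff.mult) auto
  then show ?case using DERIV_mult[OF *(3,4)] by blast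
qed

lemma cutoff_deriv: "cutoff f \<Longrightarrow> cutoff (deriv f)" "cutoff f \<Longrightarrow> (f has_real_derivative deriv f x) (at x)"
proof -
  assume "cutoff f"
  then obtain f' where f': "cutoff f'" "\<And>x. (f has_real_derivative f' x) (at x)"
    using cutoff_has_derivative by blast
  then have "deriv f = f'" by (auto simp: fun_eq_iff intro: DERIV_imp_deriv)
  with f' show "cutoff (deriv f)" "(f has_real_derivative deriv f x) (at x)" by auto
qed

lemma cutoff_continuous: "cutoff f \<Longrightarrow> continuous_on S f"
  by (intro continuous_at_imp_continuous_on ballI DERIV_isCont[OF cutoff_deriv(2)])

lemma Ck_plane_product:
  assumes "cutoff \<kappa>" "\<eta> \<in> smooth_torus"
  shows "Ck_plane n (\<lambda>t x. \<kappa> t * \<eta> x)"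
  using assms
proof (induction n arbitrary: \<kappa> \<eta>)
  case 0
  have "continuous_on UNIV (\<lambda>z. \<kappa> (fst z) * \<eta> (snd z))"
    by (intro continuous_on_mult continuous_on_compose2[OF cutoff_continuous[OF 0(1), of UNIV]]
          continuous_on_compose2[OF smooth_torusD(4)[OF 0(2)]] continuous_intros) auto
  then show ?case by (simp add: case_prod_unfold)
next
  case (Suc n)
  have 1: "((\<lambda>r. \<kappa> r * \<eta> x) has_field_derivative deriv \<kappa> t * \<eta> x) (at t)" for t x
    using DERIV_cmult_right[OF cutoff_deriv(2)[OF Suc.prems(1)]] .
  have 2: "((\<lambda>x. \<kappa> t * \<eta> x) has_field_derivative \<kappa> t * deriv \<eta> x) (at x)" for t x
    using DERIV_cmult[OF smooth_torusD(2)[OF Suc.prems(2)]] .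
  have "Ck_plane n (\<lambda>t x. deriv \<kappa> t * \<eta> x)" "Ck_plane n (\<lambda>t x. \<kappa> t * deriv \<eta> x)"
    using Suc.IH[OF cutoff_deriv(1)[OF Suc.prems(1)] Suc.prems(2)]
      Suc.IH[OF Suc.prems(1) smooth_torusD(3)[OF Suc.prems(2)]] by auto
  then show ?case
    unfolding Ck_plane.simps DERIV_imp_deriv[OF 1] DERIV_imp_deriv[OF 2] field_differentiable_def
    using 1 2 by blast
qed

lemma test_function_product:
  assumes "cutoff \<kappa>" "\<eta> \<in> smooth_torus" "\<alpha> < \<alpha>'" "\<beta>' < \<beta>" "\<And>t. t \<notin> {\<alpha>'..\<beta>'} \<Longrightarrow> \<kappa> t = 0"
  shows "(\<lambda>t x. \<kappa> t * \<eta> x) \<in> test_functions \<alpha> \<beta>"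
proof -
  have "\<alpha> < \<alpha>' \<and> \<beta>' < \<beta> \<and> (\<forall>t x. t \<notin> {\<alpha>'..\<beta>'} \<longrightarrow> \<kappa> t * \<eta> x = 0)"
    using assms(3-5) by simp
  moreover have "periodic2pi (\<lambda>x. \<kappa> t * \<eta> x)" for t
    using assms(2) by (simp add: smooth_torus_def periodic2pi_def)
  ultimately show ?thesis
    unfolding test_functions_def using Ck_plane_product[OF assms(1,2)] by blast
qed

subsection \<open>The lemma of du Bois-Reymond\<close>

abbreviation mollifier :: "real \<Rightarrow> real \<Rightarrow> real \<Rightarrow> real" where
  "mollifier e p t \<equiv> bump ((t - p) / e) / e"

text \<open>The mollifier has mass \<open>bstep 1\<close> instead of 1; this positive factor is
  divided out at the end of the argument in \<open>du_Bois_Reymond\<close>.\<close>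

lemma bump_average:
  assumes Y: "continuous_on {p..p+e} Y" and e: "e > 0" and \<epsilon>: "\<And>t. t \<in> {p..p+e} \<Longrightarrow> \<bar>Y t - Y p\<bar> \<le> \<epsilon>"
  shows "\<bar>integral {p..p+e} (\<lambda>t. Y t * mollifier e p t) - bstep 1 * Y p\<bar> \<le> \<epsilon> * bstep 1"
proof -
  let ?b = "\<lambda>t. mollifier e p t"
  have cb: "continuous_on S ?b" for S
    by (intro continuous_intros continuous_on_compose2[OF continuous_bump[of UNIV]]) (use e in auto)
  have "(?b has_integral bstep ((p + e - p) / e) - bstep ((p - p) / e)) {p..p+e}"
  proof (rule fundamental_theorem_of_calculus)
    fix t
    have "((\<lambda>t. bstep ((t - p) / e)) has_real_derivative ?b t) (at t)"
    proof -
      have "((\<lambda>t. (t - p) / e) has_real_derivative 1 / e) (at t)"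
        using e by (auto intro!: derivative_eq_intros)
      from DERIV_chain2[OF bstep_has_derivative this] show ?thesis by simp
    qed
    then show "((\<lambda>t. bstep ((t - p) / e)) has_vector_derivative ?b t) (at t within {p..p+e})"
      by (simp add: has_real_derivative_iff_has_vector_derivative has_vector_derivative_at_within)
  qed (use e in simp)
  then have b: "(?b has_integral bstep 1) {p..p+e}"
    using e by (simp add: bstep_0)
  have i1: "(\<lambda>t. Y t * ?b t) integrable_on {p..p+e}" "(\<lambda>t. (Y t - Y p) * ?b t) integrable_on {p..p+e}"
    by (intro integrable_continuous_real continuous_intros Y cb)+
  have "integral {p..p+e} (\<lambda>t. (Y t - Y p) * ?b t) = integral {p..p+e} (\<lambda>t. Y t * ?b t) - bstep 1 * Y p"
    unfolding left_diff_distrib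
    using integral_unique[OF has_integral_diff[OF integrable_integral[OF i1(1)] has_integral_mult_right[OF b, of "Y p"]]]
    by (simp only: mult.commute[of "bstep 1"])
  moreover have "norm (integral {p..p+e} (\<lambda>t. (Y t - Y p) * ?b t)) \<le> integral {p..p+e} (\<lambda>t. \<epsilon> * ?b t)"
  proof (rule integral_norm_bound_integral[OF i1(2)])
    show "(\<lambda>t. \<epsilon> * ?b t) integrable_on {p..p+e}"
      by (intro integrable_continuous_real continuous_intros cb)
    show "norm ((Y t - Y p) * ?b t) \<le> \<epsilon> * ?b t" if "t \<in> {p..p+e}" for t
      using mult_right_mono[OF \<epsilon>[OF that], of "?b t"] e bump_nonneg[of "(t - p) / e"] by (simp add: abs_mult)
  qed
  moreover have "integral {p..p+e} (\<lambda>t. \<epsilon> * ?b t) = \<epsilon> * bstep 1"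
    using has_integral_mult_right[OF b, of \<epsilon>] by (rule integral_unique)
  ultimately show ?thesis by simp
qed

text \<open>Subtracting a primitive of F leaves a function \<open>Y\<close> orthogonal to
  derivatives of cutoffs. The difference of two mollifiers, at p and at q, is such a derivative;
  shrinking their width gives Y p = Y q.\<close>

lemma du_Bois_Reymond:
  fixes g F :: "real \<Rightarrow> real"
  assumes g: "continuous_on {a..b} g" and F: "continuous_on {a..b} F"
    and weak: "\<And>\<kappa> a' b'. cutoff \<kappa> \<Longrightarrow> a < a' \<Longrightarrow> b' < b \<Longrightarrow> (\<And>t. t \<notin> {a'..b'} \<Longrightarrow> \<kappa> t = 0) \<Longrightarrow>
      integral {a..b} (\<lambda>t. g t * deriv \<kappa> t + F t * \<kappa> t) = 0"
    and t: "t \<in> {a<..<b}"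
  shows "(g has_real_derivative F t) (at t)"
proof -
  define Y where "Y t = g t - integral {a..t} F" for t
  have dF: "((\<lambda>t. integral {a..t} F) has_real_derivative F t) (at t within {a..b})" if "t \<in> {a..b}" for t
    by (rule integral_has_real_derivative[OF F that])
  have cF: "continuous_on {a..b} (\<lambda>t. integral {a..t} F)"
    by (rule DERIV_continuous_on[OF dF])
  have Y: "continuous_on {a..b} Y"
    unfolding Y_def[abs_def] by (intro continuous_intros g cF)
  have Yw: "integral {a..b} (\<lambda>t. Y t * deriv \<kappa> t) = 0"
    if \<kappa>: "cutoff \<kappa>" "a < a'" "b' < b" "\<And>t. t \<notin> {a'..b'} \<Longrightarrow> \<kappa> t = 0" for \<kappa> a' b'
  proof -
    have ab: "a \<le> b" using t by auto
    have "((\<lambda>t. integral {a..t} F * deriv \<kappa> t + F t * \<kappa> t) has_integral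
        integral {a..b} F * \<kappa> b - integral {a..a} F * \<kappa> a) {a..b}"
    proof (rule fundamental_theorem_of_calculus[OF ab])
      fix s assume "s \<in> {a..b}"
      then have "((\<lambda>t. integral {a..t} F * \<kappa> t) has_real_derivative (integral {a..s} F * deriv \<kappa> s + F s * \<kappa> s)) (at s within {a..b})"
        using DERIV_mult[OF dF has_field_derivative_at_within[OF cutoff_deriv(2)[OF \<kappa>(1)]]] by (simp add: add.commute mult.commute)
      then show "((\<lambda>t. integral {a..t} F * \<kappa> t) has_vector_derivative (integral {a..s} F * deriv \<kappa> s + F s * \<kappa> s)) (at s within {a..b})"
        by (simp add: has_real_derivative_iff_has_vector_derivative)
    qed
    moreover have "\<kappa> b = 0" "\<kappa> a = 0" using \<kappa> by auto
    ultimately have 1: "((\<lambda>t. integral {a..t} F * deriv \<kappa> t + F t * \<kappa> t) has_integral 0) {a..b}"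
      by simp
    have "(\<lambda>t. g t * deriv \<kappa> t + F t * \<kappa> t) integrable_on {a..b}"
      by (intro integrable_continuous_real continuous_intros g F cutoff_continuous cutoff_deriv(1) \<kappa>)
    with weak[OF \<kappa>] have 2: "((\<lambda>t. g t * deriv \<kappa> t + F t * \<kappa> t) has_integral 0) {a..b}"
      by (simp add: has_integral_integral)
    have "((\<lambda>t. Y t * deriv \<kappa> t) has_integral 0 - 0) {a..b}"
      by (rule has_integral_eq[OF _ has_integral_diff[OF 2 1]]) (auto simp: Y_def algebra_simps)
    then show ?thesis by (simp add: integral_unique)
  qed
  have Yle: "Y p = Y q" if pq: "a < p" "p < q" "q < b" for p q
  proof -
    have "\<bar>Y p - Y q\<bar> \<le> 0 + \<epsilon>" if \<epsilon>: "\<epsilon> > 0" for \<epsilon>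
    proof -
      have "\<exists>d>0. \<forall>t\<in>{a..b}. dist t s < d \<longrightarrow> dist (Y t) (Y s) < \<epsilon> / 2" if "s \<in> {a..b}" for s
        using Y that \<epsilon> unfolding continuous_on_iff by (meson half_gt_zero)
      from this[of p] this[of q] obtain d1 d2 where d: "d1 > 0" "d2 > 0"
        "\<And>t. t \<in> {a..b} \<Longrightarrow> dist t p < d1 \<Longrightarrow> dist (Y t) (Y p) < \<epsilon> / 2"
        "\<And>t. t \<in> {a..b} \<Longrightarrow> dist t q < d2 \<Longrightarrow> dist (Y t) (Y q) < \<epsilon> / 2"
        using pq by auto
      define e where "e = min (min (d1 / 2) (d2 / 2)) (min ((q - p) / 2) ((b - q) / 2))"
      have e: "e > 0" "e < d1" "e < d2" "p + e < q" "q + e < b"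
        using d(1,2) pq by (auto simp: e_def min_def field_simps)
      \<comment> \<open>Two steps of equal height: their difference vanishes again beyond q + e and
        is thus an admissible cutoff, and its derivative is the difference of the
        mollifiers.\<close>
      define \<kappa> where "\<kappa> t = bstep ((1 / e) * t + (- p / e)) + (-1) * bstep ((1 / e) * t + (- q / e))" for t
      have \<kappa>: "cutoff \<kappa>"
        unfolding \<kappa>_def[abs_def] by (intro cutoff.intros)
      have arg: "(1 / e) * t + (- p / e) = (t - p) / e" for t p
        by (simp add: diff_divide_distrib)
      have \<kappa>': "deriv \<kappa> s = mollifier e p s - mollifier e q s" for s
      proof (rule DERIV_imp_deriv)
        have "((\<lambda>t. bstep ((t - p) / e)) has_real_derivative mollifier e p s) (at s)" for p
        proof -
          have "((\<lambda>t. (t - p) / e) has_real_derivative 1 / e) (at s)"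
            using e by (auto intro!: derivative_eq_intros)
          from DERIV_chain2[OF bstep_has_derivative this] show ?thesis by simp
        qed
        from DERIV_diff[OF this[of p] this[of q]]
        show "(\<kappa> has_real_derivative (mollifier e p s - mollifier e q s)) (at s)"
          unfolding \<kappa>_def[abs_def] arg by simp
      qed
      have "\<kappa> s = 0" if "s \<notin> {p..q+e}" for s
      proof (cases "s < p")
        case True
        then have "(s - p) / e \<le> 0" "(s - q) / e \<le> 0" using pq e by (auto intro!: divide_nonpos_pos)
        then show ?thesis unfolding \<kappa>_def arg using bstep_0[of "(s - p) / e"] bstep_0[of "(s - q) / e"] by linarith
      next
        case False
        then have "(s - p) / e \<ge> 1" "(s - q) / e \<ge> 1" using that pq e by auto
        then show ?thesis unfolding \<kappa>_def arg using bstep_ge_1[of "(s - p) / e"] bstep_ge_1[of "(s - q) / e"] by linarith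
      qed
      from Yw[OF \<kappa> pq(1) e(5) this]
      have 0: "integral {a..b} (\<lambda>t. Y t * mollifier e p t - Y t * mollifier e q t) = 0"
        by (simp add: \<kappa>' right_diff_distrib)
      have loc: "integral {a..b} (\<lambda>t. Y t * mollifier e p t) = integral {p..p+e} (\<lambda>t. Y t * mollifier e p t)"
        if "a < p" "p + e < b" for p
      proof -
        have "integral {a..b} (\<lambda>t. Y t * mollifier e p t) =
            integral {a..b} (\<lambda>t. if t \<in> {p..p+e} then Y t * mollifier e p t else 0)"
        proof (rule integral_cong)
          fix t
          show "Y t * mollifier e p t = (if t \<in> {p..p+e} then Y t * mollifier e p t else 0)"
            using e(1) by (auto simp: bump_0 divide_nonpos_pos)
        qed
        also have "\<dots> = integral {p..p+e} (\<lambda>t. Y t * mollifier e p t)"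
        proof -
          have "{p..p+e} \<inter> {a..b} = {p..p+e}" using that e by auto
          then show ?thesis by (simp only: integral_restrict_Int)
        qed
        finally show ?thesis .
      qed
      have int: "(\<lambda>t. Y t * mollifier e p t) integrable_on {a..b}" for p
        by (intro integrable_continuous_real continuous_intros Y continuous_on_compose2[OF continuous_bump[of UNIV]]) (use e in auto)
      have "integral {p..p+e} (\<lambda>t. Y t * mollifier e p t) = integral {q..q+e} (\<lambda>t. Y t * mollifier e q t)"
        using 0 loc[of p] loc[of q] pq e int by (simp add: Henstock_Kurzweil_Integration.integral_diff)
      moreover have "\<bar>integral {p..p+e} (\<lambda>t. Y t * mollifier e p t) - bstep 1 * Y p\<bar> \<le> \<epsilon> / 2 * bstep 1"
        using d(3) pq e by (intro bump_average continuous_on_subset[OF Y]) (auto simp: dist_real_def intro!: less_imp_le)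
      moreover have "\<bar>integral {q..q+e} (\<lambda>t. Y t * mollifier e q t) - bstep 1 * Y q\<bar> \<le> \<epsilon> / 2 * bstep 1"
        using d(4) pq e by (intro bump_average continuous_on_subset[OF Y]) (auto simp: dist_real_def intro!: less_imp_le)
      ultimately have "\<bar>bstep 1 * Y p - bstep 1 * Y q\<bar> \<le> \<epsilon> * bstep 1"
        by linarith
      then have "bstep 1 * \<bar>Y p - Y q\<bar> \<le> bstep 1 * \<epsilon>"
        using bstep_1_pos by (simp add: abs_mult mult.commute flip: right_diff_distrib)
      then show ?thesis using bstep_1_pos by simp
    qed
    then have "\<bar>Y p - Y q\<bar> \<le> 0" by (rule field_le_epsilon)
    then show ?thesis by simp
  qed
  have Yconst: "Y s = Y t" if "s \<in> {a<..<b}" for s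
    using Yle[of s t] Yle[of t s] that t by (cases s t rule: linorder_cases) auto
  have "((\<lambda>s. Y t + integral {a..s} F) has_real_derivative F t) (at t within {a..b})"
    using dF[of t] t by (auto intro!: derivative_eq_intros)
  then have "((\<lambda>s. Y t + integral {a..s} F) has_real_derivative F t) (at t)"
    using t by (simp add: at_within_Icc_at)
  then show ?thesis
  proof (rule has_field_derivative_transform_within_open[of _ _ _ "{a<..<b}"])
    show "Y t + integral {a..s} F = g s" if "s \<in> {a<..<b}" for s
      unfolding Yconst[OF that, symmetric] by (simp add: Y_def)
  qed (use t in auto)
qed

subsection \<open>Fourier coefficients of a solution\<close>

lemma fourier_coeff_diff:
  assumes "integrable circ f" "integrable circ g"
  shows "fourier_coeff (\<lambda>x. f x - g x) k = fourier_coeff f k - fourier_coeff g k"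
proof -
  have "integrable circ (\<lambda>x. complex_of_real (f x))" "integrable circ (\<lambda>x. complex_of_real (g x))"
    using assms by auto
  from this[THEN integrable_mult_cis, of "- of_int k"] show ?thesis
    by (simp add: fourier_coeff_circ left_diff_distrib diff_divide_distrib)
qed

text \<open>The norm of the difference carries information only once its series is known to
  converge; this follows from |x - y|^2 \<le> 2 |x|^2 + 2 |y|^2 and the membership of f and
  g.\<close>

lemma coeff_diff_le_Hs_norm:
  assumes f: "f \<in> Hs 13" and g: "g \<in> Hs 13"
  shows "cmod (wc (fser f) n - wc (fser g) n) \<le> 2 ^ 7 * Hs_norm 13 (\<lambda>x. f x - g x) / jb n ^ 13"
proof -
  note d = fourier_coeff_diff[OF Hs_integrable[OF f] Hs_integrable[OF g]]
  have "(\<lambda>k. (1 + (of_int k)\<^sup>2) powr 13 * (cmod (fourier_coeff (\<lambda>x. f x - g x) k))\<^sup>2) summable_on UNIV"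
  proof (rule summable_on_comparison_test)
    show "(\<lambda>k. 2 * ((1 + (of_int k)\<^sup>2) powr 13 * (cmod (fourier_coeff f k))\<^sup>2) +
        2 * ((1 + (of_int k)\<^sup>2) powr 13 * (cmod (fourier_coeff g k))\<^sup>2)) summable_on UNIV"
      using f g by (intro summable_on_add summable_on_cmult_right) (auto simp: Hs_def)
    fix k :: int
    have "(cmod (x - y))\<^sup>2 \<le> 2 * (cmod x)\<^sup>2 + 2 * (cmod y)\<^sup>2" for x y :: complex
    proof -
      have "(cmod (x - y))\<^sup>2 \<le> (cmod x + cmod y)\<^sup>2"
        by (intro power_mono norm_triangle_ineq4) auto
      also have "\<dots> \<le> 2 * (cmod x)\<^sup>2 + 2 * (cmod y)\<^sup>2"
        using zero_le_power2[of "cmod x - cmod y"] by (simp add: power2_sum power2_diff)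
      finally show ?thesis .
    qed
    from mult_left_mono[OF this[of "fourier_coeff f k" "fourier_coeff g k"], of "(1 + (of_int k)\<^sup>2) powr 13"]
    show "(1 + (of_int k)\<^sup>2) powr 13 * (cmod (fourier_coeff (\<lambda>x. f x - g x) k))\<^sup>2 \<le>
        2 * ((1 + (of_int k)\<^sup>2) powr 13 * (cmod (fourier_coeff f k))\<^sup>2) +
        2 * ((1 + (of_int k)\<^sup>2) powr 13 * (cmod (fourier_coeff g k))\<^sup>2)"
      unfolding d by (simp add: distrib_left mult_ac)
  qed auto
  from coeff_le_Hs_norm[OF this, of n] show ?thesis
    by (simp add: d Hs_fser(1)[OF f] Hs_fser(1)[OF g])
qed

section \<open>Dependence of the coefficients on time\<close>

lemma continuous_coeff:
  assumes u: "continuous_Hs I 13 u"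
  shows "continuous_on I (\<lambda>t. wc (fser (u t)) n)"
proof (unfold continuous_on_def, rule ballI)
  fix t assume t: "t \<in> I"
  have "((\<lambda>r. wc (fser (u r)) n - wc (fser (u t)) n) \<longlongrightarrow> 0) (at t within I)"
  proof (rule Lim_null_comparison)
    have "((\<lambda>r. 2 ^ 7 * Hs_norm 13 (\<lambda>x. u r x - u t x) / jb n ^ 13) \<longlongrightarrow> 2 ^ 7 * 0 / jb n ^ 13) (at t within I)"
      using u t by (intro tendsto_intros) (auto simp: continuous_Hs_def)
    then show "((\<lambda>r. 2 ^ 7 * Hs_norm 13 (\<lambda>x. u r x - u t x) / jb n ^ 13) \<longlongrightarrow> 0) (at t within I)"
      by simp
    show "\<forall>\<^sub>F r in at t within I. norm (wc (fser (u r)) n - wc (fser (u t)) n) \<le> 2 ^ 7 * Hs_norm 13 (\<lambda>x. u r x - u t x) / jb n ^ 13"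
      unfolding eventually_at_filter using u t
      by (intro always_eventually allI impI coeff_diff_le_Hs_norm) (auto simp: continuous_Hs_def)
  qed
  then show "((\<lambda>t. wc (fser (u t)) n) \<longlongrightarrow> wc (fser (u t)) n) (at t within I)"
    by (simp add: LIM_zero_iff)
qed

text \<open>Continuity at \<open>t0\<close> keeps the norm of the difference below 1 nearby. A bound
  near time 0 is all that is used later, so no compactness of the whole interval enters.\<close>

lemma local_coeff_bound:
  assumes u: "continuous_Hs I 13 u" and t0: "t0 \<in> I"
  shows "\<exists>\<delta>>0. \<exists>C. \<forall>t\<in>I. \<bar>t - t0\<bar> < \<delta> \<longrightarrow> (\<forall>n. cmod (wc (fser (u t)) n) \<le> C / jb n ^ 13)"
proof -
  have H: "u t \<in> Hs 13" if "t \<in> I" for t using u that by (simp add: continuous_Hs_def)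
  obtain C0 where C0: "\<And>n. cmod (wc (fser (u t0)) n) \<le> C0 / jb n ^ 13"
    using Hs_fser(2)[OF H[OF t0]] by (elim XE) blast
  have "((\<lambda>r. Hs_norm 13 (\<lambda>x. u r x - u t0 x)) \<longlongrightarrow> 0) (at t0 within I)"
    using u t0 by (simp add: continuous_Hs_def)
  then have "\<forall>\<^sub>F r in at t0 within I. Hs_norm 13 (\<lambda>x. u r x - u t0 x) < 1"
    by (rule order_tendstoD) simp
  then obtain \<delta> where \<delta>: "\<delta> > 0" "\<And>r. r \<in> I \<Longrightarrow> r \<noteq> t0 \<Longrightarrow> dist r t0 < \<delta> \<Longrightarrow> Hs_norm 13 (\<lambda>x. u r x - u t0 x) < 1"
    unfolding eventually_at by blast
  have "cmod (wc (fser (u t)) n) \<le> (C0 + 2 ^ 7) / jb n ^ 13" if t: "t \<in> I" "\<bar>t - t0\<bar> < \<delta>" for t n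
  proof (cases "t = t0")
    case True
    have "C0 / jb n ^ 13 \<le> (C0 + 2 ^ 7) / jb n ^ 13" by (intro divide_right_mono) auto
    then show ?thesis using C0[of n] True by simp
  next
    case False
    have "cmod (wc (fser (u t)) n) \<le> cmod (wc (fser (u t0)) n) + cmod (wc (fser (u t)) n - wc (fser (u t0)) n)"
      by (rule norm_triangle_sub)
    also have "\<dots> \<le> C0 / jb n ^ 13 + 2 ^ 7 / jb n ^ 13"
    proof (rule add_mono[OF C0])
      have "2 ^ 7 * Hs_norm 13 (\<lambda>x. u t x - u t0 x) / jb n ^ 13 \<le> 2 ^ 7 / jb n ^ 13"
        using \<delta>(2)[OF t(1) False] t(2) by (intro divide_right_mono) (auto simp: dist_real_def)
      then show "cmod (wc (fser (u t)) n - wc (fser (u t0)) n) \<le> 2 ^ 7 / jb n ^ 13"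
        using coeff_diff_le_Hs_norm[OF H[OF t(1)] H[OF t0], of n] by linarith
    qed
    finally show ?thesis by (simp add: add_divide_distrib)
  qed
  with \<delta>(1) show ?thesis by blast
qed

text \<open>The analogue of \<open>TX\<close> with continuity in place of differentiability. It is
  needed at the stage where the solution is only known to be continuous in time and its differential
  equation is still to be derived.\<close>

definition CX :: "real set \<Rightarrow> (real \<Rightarrow> wiener) \<Rightarrow> bool" where
  "CX J f \<longleftrightarrow> X 5 f \<and> (\<forall>n. continuous_on J (\<lambda>t. wc (f t) n))"

lemma CX_Cc: "CX J (Cc c)"
proof -
  have "continuous_on J (\<lambda>t. wc (Cc c t) n)" for n by (simp add: Cc_def)
  then show ?thesis by (simp add: CX_def X_Cc)
qed

lemma CX_mult:
  assumes "CX J f" "CX J g"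
  shows "CX J (f * g)"
proof -
  have X: "X 5 f" "X 5 g" and c: "\<And>n. continuous_on J (\<lambda>t. wc (f t) n)" "\<And>n. continuous_on J (\<lambda>t. wc (g t) n)"
    using assms by (auto simp: CX_def)
  obtain C where C: "C \<ge> 0" "\<And>t n. cmod (wc (f t) n) \<le> C / jb n ^ 5" using X(1) by (elim XE) blast
  obtain E where E: "E \<ge> 0" "\<And>t n. cmod (wc (g t) n) \<le> E / jb n ^ 5" using X(2) by (elim XE) blast
  have "continuous_on J (\<lambda>t. \<Sum>\<^sub>\<infinity>m. wc (f t) m * wc (g t) (n - m))" for n
  proof (rule continuous_on_infsum_int)
    show "(\<lambda>m. C * (1 / jb m ^ 5) * E) summable_on UNIV"
      by (intro summable_on_cmult_left summable_on_cmult_right jb_summable) simp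
    show "norm (wc (f t) m * wc (g t) (n - m)) \<le> C * (1 / jb m ^ 5) * E" for m t
    proof -
      have "E / jb (n - m) ^ 5 \<le> E / 1" using E(1) by (intro divide_left_mono) auto
      then have "cmod (wc (g t) (n - m)) \<le> E" using E(2)[of t "n - m"] by simp
      then show ?thesis unfolding norm_mult using C by (intro mult_mono) auto
    qed
  qed (intro continuous_on_mult c)
  then show ?thesis
    using X by (simp add: CX_def X_mult wc_mult fam_apply)
qed

lemma CX_power: "CX J f \<Longrightarrow> CX J (f ^ k)"
  using CX_Cc[of J 1] by (induction k) (auto simp: Cc_simps intro: CX_mult)

lemma CX_Dpow: "X 13 f \<Longrightarrow> (\<And>n. continuous_on J (\<lambda>t. wc (f t) n)) \<Longrightarrow> j \<le> 3 \<Longrightarrow> CX J ((D ^^ j) f)"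
proof -
  assume f: "X 13 f" "\<And>n. continuous_on J (\<lambda>t. wc (f t) n)" and j: "j \<le> 3"
  have "X (j + 2) f" "X (5 + j) f" using j by (auto intro: X_mono[OF f(1)])
  then show ?thesis
    using f(2) by (auto simp: CX_def wc_Dpow intro!: X_Dpow continuous_intros)
qed

lemma continuous_monomial:
  fixes U :: "real \<Rightarrow> wiener"
  assumes b: "\<And>t n. t \<in> J \<Longrightarrow> cmod (wc (U t) n) \<le> C / jb n ^ 13"
    and c: "\<And>n. continuous_on J (\<lambda>t. wc (U t) n)"
  shows "continuous_on J (\<lambda>t. wc (monomial l a b' c' d (U t)) n)"
proof -
  define f where "f t = (if t \<in> J then U t else 0)" for t
  have X: "X 13 f"
  proof (rule XI)
    fix t n
    have "C / jb n ^ 13 \<le> \<bar>C\<bar> / jb n ^ 13" by (intro divide_right_mono) auto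
    then show "cmod (wc (f t) n) \<le> \<bar>C\<bar> / jb n ^ 13"
      using b[of t n] by (auto simp: f_def)
  qed
  have cf: "continuous_on J (\<lambda>t. wc (f t) n)" for n
    using c[of n] by (rule continuous_on_eq) (simp add: f_def)
  have "CX J (\<lambda>t. monomial l a b' c' d (f t))"
    unfolding monomial_family[of _ _ _ _ _ f]
    using CX_Dpow[OF X cf, of 3] CX_Dpow[OF X cf, of 2] CX_Dpow[OF X cf, of 1] CX_Dpow[OF X cf, of 0]
    by (intro CX_mult CX_power CX_Cc) auto
  then have "continuous_on J (\<lambda>t. wc (monomial l a b' c' d (f t)) n)"
    by (simp add: CX_def)
  then show ?thesis
    by (rule continuous_on_eq) (simp add: f_def)
qed

lemma deriv_cutoff_outside:
  assumes "\<And>t. t \<notin> {a'..b'} \<Longrightarrow> \<kappa> t = 0" "t \<notin> {a'..b'}"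
  shows "deriv \<kappa> t = (0::real)"
proof (rule DERIV_imp_deriv)
  have "((\<lambda>_. 0) has_real_derivative 0) (at t)" by simp
  then show "(\<kappa> has_real_derivative 0) (at t)"
    by (rule has_field_derivative_transform_within_open[of _ _ _ "- {a'..b'}"]) (use assms in auto)
qed

text \<open>The outer integrand is replaced pointwise by a function that is continuous where it does
  not vanish identically, so no measurability in time has to be checked for the given
  representatives.\<close>

lemma LINT_restrict_interval:
  fixes h h' :: "real \<Rightarrow> real"
  assumes h: "\<And>t. t \<in> {\<alpha>..\<beta>} \<Longrightarrow> h t = h' t" and sub: "{p..q} \<subseteq> {\<alpha>..\<beta>}"
    and 0: "\<And>t. t \<in> {\<alpha>..\<beta>} \<Longrightarrow> t \<notin> {p..q} \<Longrightarrow> h' t = 0" and c: "continuous_on {p..q} h'"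
  shows "(LINT t:{\<alpha>..\<beta>}|lebesgue. h t) = integral {p..q} h'"
proof -
  have "(LINT t:{\<alpha>..\<beta>}|lebesgue. h t) = (LINT t:{p..q}|lebesgue. h' t)"
    unfolding set_lebesgue_integral_def
    by (rule Bochner_Integration.integral_cong) (use h sub 0 in \<open>auto simp: indicator_def\<close>)
  also have "\<dots> = integral {p..q} h'"
    by (rule set_lebesgue_integral_eq_integral(2)[OF absolutely_integrable_continuous_real[OF c]])
  finally show ?thesis .
qed

context flow
begin

lemma continuous_N: "continuous_on J (\<lambda>t. wc (Nw (U t)) n)"
  and continuous_B: "continuous_on J (\<lambda>t. wc (Bw (U t)) n)"
  if "\<And>t n. t \<in> J \<Longrightarrow> cmod (wc (U t) n) \<le> C / jb n ^ 13" "\<And>n. continuous_on J (\<lambda>t. wc (U t) n)"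
  for U :: "real \<Rightarrow> wiener"
  unfolding Nw_def Bw_def wc_sum by (intro continuous_on_sum continuous_monomial[OF that]; assumption)+

text \<open>The test function is \<kappa>(t) times a real trigonometric function of frequency k.
  Integration against it reads off the coefficient at - k; as \<open>symb\<close> is odd,
  \<open>+ symb k\<close> is the expected \<open>- symb (- k)\<close>.\<close>

lemma weak_identity:
  assumes sol: "distributional_solution \<gamma>0 \<gamma>1 \<gamma>2 (nonlinearity j0 lam a b c d) \<alpha> \<beta> u"
    and u: "continuous_Hs {\<alpha>..\<beta>} 13 u"
    and pq: "\<alpha> \<le> p" "q \<le> \<beta>" and bd: "\<And>t n. t \<in> {p..q} \<Longrightarrow> cmod (wc (fser (u t)) n) \<le> C / jb n ^ 13"
    and \<kappa>: "cutoff \<kappa>" "p < a'" "b' < q" "\<And>t. t \<notin> {a'..b'} \<Longrightarrow> \<kappa> t = 0"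
  shows "integral {p..q} (\<lambda>t. Re (z * of_real (2 * pi) * wc (fser (u t)) (- k)) * deriv \<kappa> t +
      Re (z * of_real (2 * pi) * (symb k * wc (fser (u t)) (- k)
        + wc (Nw (fser (u t))) (- k))) * \<kappa> t) = 0"
proof -
  have Re_of_real_mult: "Re (of_real s * w) = s * Re w" for s w by simp
  have H: "u t \<in> Hs 13" if "t \<in> {\<alpha>..\<beta>}" for t using u that by (simp add: continuous_Hs_def)
  have sub: "{p..q} \<subseteq> {\<alpha>..\<beta>}" using pq by auto
  define \<eta> where "\<eta> = trig z k"
  define g where "g t = Re (z * of_real (2 * pi) * wc (fser (u t)) (- k))" for t
  define L where "L t = Re (z * of_real (2 * pi) * (symb k * wc (fser (u t)) (- k)))" for t
  define N where "N t = Re (z * of_real (2 * pi) * wc (Nw (fser (u t))) (- k))" for t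
  have cont: "continuous_on {p..q} g" "continuous_on {p..q} L" "continuous_on {p..q} N"
    unfolding g_def L_def N_def using continuous_on_subset[OF continuous_coeff[OF u] sub]
    by (intro continuous_intros continuous_N[OF bd]; simp)+
  note cont\<kappa> = cutoff_continuous[OF \<kappa>(1)] cutoff_continuous[OF cutoff_deriv(1)[OF \<kappa>(1)]]
  have out: "\<kappa> t = 0" "deriv \<kappa> t = 0" if "t \<notin> {p..q}" for t
    using that \<kappa> deriv_cutoff_outside[of a' b' \<kappa> t] by auto
  define \<psi> where "\<psi> t x = \<kappa> t * \<eta> x" for t x
  have \<psi>: "\<psi> \<in> test_functions \<alpha> \<beta>"
    unfolding \<psi>_def[abs_def] \<eta>_def using pq \<kappa> by (intro test_function_product[of _ _ _ a' b'] trig_smooth) auto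
  have d1: "deriv (\<lambda>r. \<psi> r x) t = deriv \<kappa> t * \<eta> x" for t x
    unfolding \<psi>_def by (rule DERIV_imp_deriv[OF DERIV_cmult_right[OF cutoff_deriv(2)[OF \<kappa>(1)]]])
  have \<psi>t: "\<psi> t = trig (of_real (\<kappa> t) * z) k" for t
    by (simp add: \<psi>_def \<eta>_def trig_def fun_eq_iff algebra_simps)
  have dx: "(deriv ^^ j) (\<psi> t) x = \<kappa> t * trig (z * (\<i> * of_int k) ^ j) k x" for j t x
    unfolding \<psi>t deriv_trig by (simp add: trig_def mult.assoc)
  have dx1: "deriv (\<psi> t) x = \<kappa> t * trig (z * (\<i> * of_int k)) k x" for t x
    using dx[of 1 t x] by simp
  let ?L = "\<lambda>t x. - deriv (\<lambda>r. \<psi> r x) t - \<gamma>0 * (deriv ^^ 5) (\<psi> t) x - \<gamma>1 * (deriv ^^ 3) (\<psi> t) x - \<gamma>2 * deriv (\<psi> t) x"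
  have inner1: "(LINT x:{0..2*pi}|lebesgue. u t x * ?L t x) = - (g t * deriv \<kappa> t + L t * \<kappa> t)"
    if t: "t \<in> {\<alpha>..\<beta>}" for t
  proof -
    define W where "W = of_real (- deriv \<kappa> t) * z - of_real (\<kappa> t) * (z * symb k)"
    have "?L t x = trig W k x" for x
      unfolding d1 dx dx1 \<eta>_def W_def trig_def symb_def by (simp add: algebra_simps)
    then have "(LINT x:{0..2*pi}|lebesgue. u t x * ?L t x) = Re (W * of_real (2 * pi) * wc (fser (u t)) (- k))"
      by (simp only: LINT_circ integral_trig[OF Hs_integrable[OF H[OF t]]] Hs_fser(1)[OF H[OF t]])
    also have "W * of_real (2 * pi) * wc (fser (u t)) (- k) =
      of_real (- deriv \<kappa> t) * (z * of_real (2 * pi) * wc (fser (u t)) (- k)) -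
      of_real (\<kappa> t) * (z * of_real (2 * pi) * (symb k * wc (fser (u t)) (- k)))"
      unfolding W_def by (simp add: algebra_simps)
    also have "Re \<dots> = - deriv \<kappa> t * g t - \<kappa> t * L t"
      unfolding g_def L_def by (simp only: minus_complex.simps Re_complex_of_real mult_minus_left Re_of_real_mult)
    finally show ?thesis by (simp add: algebra_simps)
  qed
  have inner2: "(LINT x:{0..2*pi}|lebesgue. NL (u t) x * \<psi> t x) = N t * \<kappa> t"
    if t: "t \<in> {\<alpha>..\<beta>}" for t
  proof -
    have "of_real (\<kappa> t) * z * of_real (2 * pi) * wc (Nw (fser (u t))) (- k) = of_real (\<kappa> t) * (z * of_real (2 * pi) * wc (Nw (fser (u t))) (- k))"
      by simp
    then show ?thesis
      unfolding \<psi>t LINT_circ integral_N_trig[OF H[OF t]] N_def by (simp only: Re_of_real_mult mult.commute)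
  qed
  have e1: "(LINT t:{\<alpha>..\<beta>}|lebesgue. LINT x:{0..2*pi}|lebesgue. u t x * ?L t x) =
     integral {p..q} (\<lambda>t. - (g t * deriv \<kappa> t + L t * \<kappa> t))"
    by (rule LINT_restrict_interval[OF inner1 sub]) (auto simp: out intro!: continuous_intros cont cont\<kappa>)
  have e2: "(LINT t:{\<alpha>..\<beta>}|lebesgue. LINT x:{0..2*pi}|lebesgue. NL (u t) x * \<psi> t x) = integral {p..q} (\<lambda>t. N t * \<kappa> t)"
    by (rule LINT_restrict_interval[OF inner2 sub]) (auto simp: out intro!: continuous_intros cont cont\<kappa>)
  have eq: "integral {p..q} (\<lambda>t. - (g t * deriv \<kappa> t + L t * \<kappa> t)) = integral {p..q} (\<lambda>t. N t * \<kappa> t)"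
    using bspec[OF sol[unfolded distributional_solution_def] \<psi>] unfolding e1 e2 .
  have i: "(\<lambda>t. g t * deriv \<kappa> t + L t * \<kappa> t) integrable_on {p..q}" "(\<lambda>t. N t * \<kappa> t) integrable_on {p..q}"
    by (intro integrable_continuous_real continuous_intros cont cont\<kappa>)+
  have "integral {p..q} (\<lambda>t. g t * deriv \<kappa> t + (L t + N t) * \<kappa> t) =
      integral {p..q} (\<lambda>t. (g t * deriv \<kappa> t + L t * \<kappa> t) + N t * \<kappa> t)"
    by (simp add: algebra_simps)
  also have "\<dots> = integral {p..q} (\<lambda>t. g t * deriv \<kappa> t + L t * \<kappa> t) + integral {p..q} (\<lambda>t. N t * \<kappa> t)"
    by (rule Henstock_Kurzweil_Integration.integral_add[OF i])
  also have "\<dots> = 0"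
    using eq unfolding Henstock_Kurzweil_Integration.integral_neg by linarith
  finally show ?thesis
    unfolding g_def L_def N_def by (simp only: distrib_left plus_complex.simps)
qed

lemma solution_is_flow:
  assumes sol: "distributional_solution \<gamma>0 \<gamma>1 \<gamma>2 (nonlinearity j0 lam a b c d) \<alpha> \<beta> u"
    and u: "continuous_Hs {\<alpha>..\<beta>} 13 u"
    and pq: "\<alpha> \<le> p" "q \<le> \<beta>" and bd: "\<And>t n. t \<in> {p..q} \<Longrightarrow> cmod (wc (fser (u t)) n) \<le> C / jb n ^ 13"
  shows "is_flow {p<..<q} (\<lambda>t. fser (u t))"
  unfolding is_flow_def
proof (intro ballI allI)
  fix t :: real and n :: int assume t: "t \<in> {p<..<q}"
  define k where "k = - n"
  define m where "m = symb k"
  have sub: "{p..q} \<subseteq> {\<alpha>..\<beta>}" using pq by auto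
  note cu = continuous_on_subset[OF continuous_coeff[OF u] sub]
  have der: "((\<lambda>t. Re (z * of_real (2 * pi) * wc (fser (u t)) n)) has_real_derivative
      Re (z * of_real (2 * pi) * (m * wc (fser (u t)) n + wc (Nw (fser (u t))) n))) (at t)" for z
    using weak_identity[OF sol u pq bd, of _ _ _ z k]
    by (intro du_Bois_Reymond[OF _ _ _ t] continuous_intros cu continuous_N[OF bd cu]) (auto simp: m_def k_def)
  have m: "m = - symb n"
    by (simp add: m_def k_def symb_def power_minus_odd)
  \<comment> \<open>The two choices of z single out the real and the imaginary part; the factor 1 /
    (2 pi) undoes the normalisation.\<close>
  have "((\<lambda>t. wc (fser (u t)) n) has_vector_derivative (m * wc (fser (u t)) n + wc (Nw (fser (u t))) n)) (at t)"
    unfolding has_vector_derivative_complex_iff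
    using der[of "of_real (1 / (2 * pi))"] der[of "- \<i> * of_real (1 / (2 * pi))"]
    by (simp add: mult.assoc[symmetric]) (simp add: algebra_simps)
  then show "((\<lambda>t. wc (fser (u t)) n) has_vector_derivative
     (wc (Nw (fser (u t))) n - symb n * wc (fser (u t)) n)) (at t)"
    by (rule has_vector_derivative_eq_rhs) (simp add: m algebra_simps)
qed

end

subsection \<open>Smoothness at the end of the time interval\<close>

lemma rapidly_decaying_smooth:
  assumes "\<And>s. dec s w"
  shows "(\<lambda>x. Re (ev w x)) \<in> smooth_torus"
proof -
  have "dec 3 ((wD ^^ k) w)" for k
    by (rule dec_wDpow) (simp_all add: assms)
  then have d: "((\<lambda>x. Re (ev ((wD ^^ k) w) x)) has_field_derivative Re (ev ((wD ^^ Suc k) w) x)) (at x)" for k x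
    using Re_ev_deriv by simp
  have "(deriv ^^ k) (\<lambda>x. Re (ev w x)) = (\<lambda>x. Re (ev ((wD ^^ k) w) x))" for k
  proof (induction k)
    case (Suc k)
    have "deriv (\<lambda>x. Re (ev ((wD ^^ k) w) x)) = (\<lambda>x. Re (ev ((wD ^^ Suc k) w) x))"
      by (rule ext) (rule DERIV_imp_deriv[OF d])
    with Suc show ?case by simp
  qed simp
  moreover have "(\<lambda>x. Re (ev ((wD ^^ k) w) x)) field_differentiable (at x)" for k x
    using d[of k x] unfolding field_differentiable_def by blast
  ultimately show ?thesis
    by (simp add: smooth_torus_def periodic2pi_def ev_periodic)
qed

section \<open>Invariance under changes on null sets\<close>

lemma AE_circ_periodic:
  assumes h: "periodic2pi f" "periodic2pi g" and ae: "AE x in circ. f x = g x"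
  shows "AE x in lebesgue. f x = g x"
proof -
  define N where "N = {x \<in> {0..2*pi}. f x \<noteq> g x}"
  have "AE x in lebesgue. x \<in> {0..2*pi} \<longrightarrow> f x = g x"
    using ae by (subst (asm) AE_restrict_space_iff) auto
  then obtain M where M: "M \<in> null_sets lebesgue" "{x. \<not> (x \<in> {0..2*pi} \<longrightarrow> f x = g x)} \<subseteq> M"
    by (auto simp: eventually_ae_filter)
  then have N: "negligible N"
    by (intro negligible_subset[of M N]) (auto simp: N_def negligible_iff_null_sets)
  have per: "f (x + of_int k * (2 * pi)) = f x" "g (x + of_int k * (2 * pi)) = g x" for x and k :: int
  proof -
    have *: "F (x + of_nat m * (2 * pi)) = F x" if "periodic2pi F" for F :: "real \<Rightarrow> real" and x and m :: nat
    proof (induction m)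
      case (Suc m)
      then show ?case using that[unfolded periodic2pi_def, rule_format, of "x + of_nat m * (2 * pi)"] by (simp add: algebra_simps)
    qed simp
    have "F (x + of_int k * (2 * pi)) = F x" if F: "periodic2pi F" for F :: "real \<Rightarrow> real" and x and k :: int
    proof (cases k rule: int_cases2)
      case (nonneg m)
      then show ?thesis using *[OF F, of x m] by simp
    next
      case (nonpos m)
      then show ?thesis using *[OF F, of "x - of_nat m * (2 * pi)" m] by simp
    qed
    then show "f (x + of_int k * (2 * pi)) = f x" "g (x + of_int k * (2 * pi)) = g x" using h by auto
  qed
  have "{x. f x \<noteq> g x} \<subseteq> (\<Union>k::int. (+) (of_int k * (2 * pi)) ` N)"
  proof
    fix x assume x: "x \<in> {x. f x \<noteq> g x}"
    define k where "k = \<lfloor>x / (2 * pi)\<rfloor>"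
    define y where "y = x - of_int k * (2 * pi)"
    have "of_int k \<le> x / (2 * pi)" "x / (2 * pi) < of_int k + 1"
      unfolding k_def by linarith+
    then have "0 \<le> y" "y \<le> 2 * pi"
      by (simp_all add: y_def field_simps)
    moreover have xy: "x = y + of_int k * (2 * pi)" by (simp add: y_def)
    ultimately have "y \<in> N"
      using x per[of y k] by (auto simp: N_def)
    then show "x \<in> (\<Union>k::int. (+) (of_int k * (2 * pi)) ` N)"
      using xy by (auto simp: add.commute)
  qed
  moreover have "negligible (\<Union>k::int. (+) (of_int k * (2 * pi)) ` N)"
    using N by (intro negligible_countable_Union) (auto intro: negligible_translation)
  ultimately have "negligible {x. f x \<noteq> g x}"
    by (rule negligible_subset[rotated])
  then show ?thesis
    by (intro AE_I'[of "{x. f x \<noteq> g x}"]) (auto simp: negligible_iff_null_sets)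
qed

text \<open>An equality of predicates: the choice operator then returns the same function for f and
  g, so \<open>weak_deriv k\<close> agrees at every point and not merely almost everywhere.\<close>

lemma has_weak_deriv_cong:
  assumes f: "f \<in> borel_measurable lebesgue" and ae: "AE x in lebesgue. f x = g x"
  shows "has_weak_deriv k f = has_weak_deriv k g"
proof -
  have g: "g \<in> borel_measurable lebesgue"
    by (rule borel_measurable_AE[OF f ae])
  have m: "f \<in> borel_measurable circ" "g \<in> borel_measurable circ"
    using f g by (auto intro: measurable_restrict_space1)
  have aec: "AE x in circ. f x = g x"
    using ae by (subst AE_restrict_space_iff) auto
  have "integrable circ f \<longleftrightarrow> integrable circ g"
    by (rule integrable_cong_AE[OF m aec])
  moreover have "cint (\<lambda>x. f x * (deriv ^^ k) \<eta> x) = cint (\<lambda>x. g x * (deriv ^^ k) \<eta> x)"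
    if \<eta>: "\<eta> \<in> smooth_torus" for \<eta>
  proof (rule integral_cong_AE)
    have "(deriv ^^ k) \<eta> \<in> borel_measurable circ"
      by (rule cont_measurable_circ[OF smooth_torusD(4)[OF smooth_torus_derivs[OF \<eta>]]])
    then show "(\<lambda>x. f x * (deriv ^^ k) \<eta> x) \<in> borel_measurable circ" "(\<lambda>x. g x * (deriv ^^ k) \<eta> x) \<in> borel_measurable circ"
      using m by auto
    show "AE x in circ. f x * (deriv ^^ k) \<eta> x = g x * (deriv ^^ k) \<eta> x"
      using aec by eventually_elim simp
  qed
  ultimately show ?thesis
    unfolding has_weak_deriv_def[abs_def] set_integrable_circ LINT_circ by (auto simp: fun_eq_iff)
qed

lemma P_N_cong:
  assumes f: "f \<in> Hs 13" and ae: "AE x in lebesgue. f x = \<phi> x"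
  shows "P_N j0 lam a b c d \<phi> = P_N j0 lam a b c d f"
proof -
  have fm: "f \<in> borel_measurable lebesgue" using f by (simp add: Hs_def)
  have w: "weak_deriv k \<phi> = weak_deriv k f" for k
    unfolding weak_deriv_def has_weak_deriv_cong[OF fm ae] ..
  have m: "f \<in> borel_measurable circ" "\<phi> \<in> borel_measurable circ"
    using fm borel_measurable_AE[OF fm ae] by (auto intro: measurable_restrict_space1)
  have aec: "AE x in circ. f x = \<phi> x"
    using ae by (subst AE_restrict_space_iff) auto
  note wm = weak_deriv_Hs(1)[OF f, THEN borel_measurable_integrable]
  have "cint (P_integrand a b c d \<phi>) = cint (P_integrand a b c d f)" for a b c d
    unfolding P_integrand_def[abs_def] w
  proof (rule integral_cong_AE)
    show "AE x in circ. weak_deriv 3 f x ^ a * weak_deriv 2 f x ^ (b - 1) * weak_deriv 1 f x ^ c * \<phi> x ^ d =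
        weak_deriv 3 f x ^ a * weak_deriv 2 f x ^ (b - 1) * weak_deriv 1 f x ^ c * f x ^ d"
      using aec by eventually_elim simp
  qed (intro borel_measurable_times borel_measurable_power wm m; simp)+
  then show ?thesis
    unfolding P_N_def P_term_def LINT_circ by (simp cong: if_cong)
qed

context flow
begin

text \<open>By continuity the mean of \<open>Bw\<close> stays above half its final value on a short
  interval before 0, which fixes the damping constant. The resulting bounds hold only before time
  0.\<close>

lemma endpoint_decay:
  assumes "\<gamma>0 \<noteq> 0" and T: "T > 0" and fl: "is_flow {-T<..<0} U"
    and bd: "\<And>t n. t \<in> {-T..0} \<Longrightarrow> cmod (wc (U t) n) \<le> C / jb n ^ 13"
    and cont: "\<And>n. continuous_on {-T..0} (\<lambda>t. wc (U t) n)"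
    and real: "\<And>t. t \<in> {-T..0} \<Longrightarrow> Im (wc (Aw (U t)) 0) = 0 \<and> Im (wc (Bw (U t)) 0) = 0"
    and pos: "Re (wc (Bw (U 0)) 0) > 0"
  shows "dec s (U 0)"
proof -
  define e where "e = Re (wc (Bw (U 0)) 0) / 2"
  have e: "e > 0" "e < Re (wc (Bw (U 0)) 0)" using pos by (auto simp: e_def)
  have "continuous_on {-T..0} (\<lambda>t. Re (wc (Bw (U t)) 0))"
    by (intro continuous_on_Re continuous_B[OF bd cont])
  then have "((\<lambda>t. Re (wc (Bw (U t)) 0)) \<longlongrightarrow> Re (wc (Bw (U 0)) 0)) (at 0 within {-T..0})"
    using T by (auto simp: continuous_on_def)
  then have "\<forall>\<^sub>F t in at 0 within {-T..0}. e < Re (wc (Bw (U t)) 0)"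
    using e(2) by (rule order_tendstoD)
  then obtain \<delta> where \<delta>: "\<delta> > 0" "\<And>t. t \<in> {-T..0} \<Longrightarrow> t \<noteq> 0 \<Longrightarrow> dist t 0 < \<delta> \<Longrightarrow> e < Re (wc (Bw (U t)) 0)"
    unfolding eventually_at by blast
  define S where "S = min T \<delta>"
  have S: "0 < S" "S \<le> T" "S \<le> \<delta>" using T \<delta>(1) by (auto simp: S_def)
  have fl': "is_flow {-S<..<0} U"
    using fl S by (auto simp: is_flow_def)
  have "\<exists>C. \<forall>t\<in>{- S / 2..<0}. \<forall>n. cmod (wc (U t) n) \<le> C / jb n ^ (13 + s)"
  proof (rule smoothing_all[OF assms(1) fl' _ _ e(1)])
    show "cmod (wc (U t) n) \<le> C / jb n ^ 13" if "t \<in> {-S<..<0}" for t n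
      using that S by (intro bd) auto
    show "Im (wc (Aw (U t)) 0) = 0 \<and> Im (wc (Bw (U t)) 0) = 0 \<and> Re (wc (Bw (U t)) 0) \<ge> e" if "t \<in> {-S<..<0}" for t
      using that S real[of t] \<delta>(2)[of t] by (auto simp: dist_real_def)
  qed (use S in auto)
  then obtain C' where C': "\<And>t n. t \<in> {- S / 2..<0} \<Longrightarrow> cmod (wc (U t) n) \<le> C' / jb n ^ (13 + s)"
    by blast
  \<comment> \<open>The constant does not depend on t, so the bound passes to the limit in each
    coefficient.\<close>
  have "cmod (wc (U 0) n) \<le> C' / jb n ^ (13 + s)" for n
  proof (rule tendsto_upperbound)
    have "((\<lambda>t. wc (U t) n) \<longlongrightarrow> wc (U 0) n) (at 0 within {-T..0})"
      using cont[of n] T by (auto simp: continuous_on_def)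
    then have "((\<lambda>t. wc (U t) n) \<longlongrightarrow> wc (U 0) n) (at_left 0)"
      using T at_within_Icc_at_left[of "-T" 0] by simp
    then show "((\<lambda>t. cmod (wc (U t) n)) \<longlongrightarrow> cmod (wc (U 0) n)) (at_left 0)"
      by (rule tendsto_norm)
    show "\<forall>\<^sub>F t in at_left 0. cmod (wc (U t) n) \<le> C' / jb n ^ (13 + s)"
      unfolding eventually_at_left_field using S C' by (intro exI[of _ "- S / 2"]) auto
  qed simp
  then have "dec (13 + s) (U 0)"
    by (rule XI)
  then show ?thesis by (rule X_mono) simp
qed

end

section \<open>Time reversal and conclusion\<close>

lemma monomial_uminus: "monomial (- l) a b c d w = - monomial l a b c d w"
  by (simp add: monomial_def cst_uminus)

lemma flow_reverse:
  "flow.Nw j0 (\<lambda>j. - lam j) a b c d w = - flow.Nw j0 lam a b c d w"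
  "flow.Aw j0 (\<lambda>j. - lam j) a b c d w = - flow.Aw j0 lam a b c d w"
  "flow.Bw j0 (\<lambda>j. - lam j) a b c d w = - flow.Bw j0 lam a b c d w"
  by (simp_all add: flow.Nw_def flow.Aw_def flow.Bw_def monomial_uminus sum_negf)

text \<open>Under t \<mapsto> - t both the linear part and the nonlinearity change sign. The sign of
  the mean of \<open>Bw\<close> flips as well, so the case of negative \<open>P_N\<close> on a
  future interval becomes that of positive \<open>P_N\<close> on a past one.\<close>

lemma is_flow_reverse:
  assumes "flow.is_flow \<gamma>0 \<gamma>1 \<gamma>2 j0 lam a b c d {0<..<T} U"
  shows "flow.is_flow (- \<gamma>0) (- \<gamma>1) (- \<gamma>2) j0 (\<lambda>j. - lam j) a b c d {-T<..<0} (\<lambda>t. U (- t))"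
  unfolding flow.is_flow_def
proof (intro ballI allI)
  fix t :: real and n :: int assume t: "t \<in> {-T<..<0}"
  have 1: "((\<lambda>t. wc (U t) n) has_vector_derivative
     (wc (flow.Nw j0 lam a b c d (U (- t))) n - flow.symb \<gamma>0 \<gamma>1 \<gamma>2 n * wc (U (- t)) n)) (at (- t))"
    using assms t by (auto simp: flow.is_flow_def)
  have 2: "((\<lambda>t::real. - t) has_vector_derivative - 1) (at t)"
    using has_vector_derivative_minus[OF has_vector_derivative_id] by simp
  have "((\<lambda>t. wc (U (- t)) n) has_vector_derivative
     (-1) *\<^sub>R (wc (flow.Nw j0 lam a b c d (U (- t))) n - flow.symb \<gamma>0 \<gamma>1 \<gamma>2 n * wc (U (- t)) n)) (at t)"
    using vector_diff_chain_at[OF 2 1] unfolding o_def .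
  then show "((\<lambda>t. wc (U (- t)) n) has_vector_derivative
     (wc (flow.Nw j0 (\<lambda>j. - lam j) a b c d (U (- t))) n - flow.symb (- \<gamma>0) (- \<gamma>1) (- \<gamma>2) n * wc (U (- t)) n)) (at t)"
    by (rule has_vector_derivative_eq_rhs) (simp add: flow_reverse flow.symb_def algebra_simps)
qed

lemma dec_imp_ae_smooth:
  assumes f: "f \<in> Hs 13" and dec: "\<And>s. dec s (fser f)" and ae: "AE x in lebesgue. f x = \<phi> x"
  shows "ae_smooth_torus \<phi>"
proof -
  let ?g = "\<lambda>x. Re (ev (fser f) x)"
  have g: "?g \<in> smooth_torus" by (rule rapidly_decaying_smooth[OF dec])
  have "AE x in circ. f x = ?g x"
    using Hs_AE_ev[OF f] by eventually_elim (metis Re_complex_of_real)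
  then have "AE x in lebesgue. f x = ?g x"
    using f g by (intro AE_circ_periodic) (auto simp: Hs_def smooth_torus_def)
  with ae have "AE x in lebesgue. \<phi> x = ?g x"
    by eventually_elim (rule trans[OF sym])
  then show ?thesis
    unfolding ae_smooth_torus_def using g by (rule bexI)
qed

text \<open>The length T is arbitrary: the solution is used only on a short interval [-S, 0] with
  uniform coefficient bounds, where the flow is damped towards time 0.\<close>

lemma smooth_of_solution_on_past:
  assumes "\<gamma>0 \<noteq> 0" "T > 0" and P: "P_N j0 lam a b c d \<phi> > 0"
    and sol: "solution_Hs \<gamma>0 \<gamma>1 \<gamma>2 (nonlinearity j0 lam a b c d) 13 \<phi> (-T) 0 u"
  shows "ae_smooth_torus \<phi>"
proof -
  interpret flow \<gamma>0 \<gamma>1 \<gamma>2 j0 lam a b c d .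
  have u: "continuous_Hs {-T..0} 13 u" and ae: "AE x in lebesgue. u 0 x = \<phi> x"
    and ds: "distributional_solution \<gamma>0 \<gamma>1 \<gamma>2 (nonlinearity j0 lam a b c d) (-T) 0 u"
    using sol by (auto simp: solution_Hs_def)
  have H: "u t \<in> Hs 13" if "t \<in> {-T..0}" for t using u that by (simp add: continuous_Hs_def)
  obtain \<delta> C where \<delta>: "\<delta> > 0" "\<And>t n. t \<in> {-T..0} \<Longrightarrow> \<bar>t\<bar> < \<delta> \<Longrightarrow> cmod (wc (fser (u t)) n) \<le> C / jb n ^ 13"
  proof -
    have "0 \<in> {-T..0}" using assms(2) by simp
    from local_coeff_bound[OF u this] show ?thesis using that by (simp only: diff_0_right) blast
  qed
  define S where "S = min T (\<delta> / 2)"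
  have S: "0 < S" "S \<le> T" "S < \<delta>" using assms(2) \<delta>(1) by (auto simp: S_def)
  have bd: "cmod (wc (fser (u t)) n) \<le> C / jb n ^ 13" if "t \<in> {-S..0}" for t n
    using that S by (intro \<delta>(2)) auto
  have "dec s (fser (u 0))" for s
  proof (rule endpoint_decay[OF assms(1) S(1) _ bd])
    show "is_flow {-S<..<0} (\<lambda>t. fser (u t))"
      by (rule solution_is_flow[OF ds u _ _ bd]) (use S in auto)
    show "continuous_on {-S..0} (\<lambda>t. wc (fser (u t)) n)" for n
      by (rule continuous_on_subset[OF continuous_coeff[OF u]]) (use S in auto)
    show "Im (wc (Aw (fser (u t))) 0) = 0 \<and> Im (wc (Bw (fser (u t))) 0) = 0" if "t \<in> {-S..0}" for t
      using that S by (intro herm_AB H) auto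
    show "Re (wc (Bw (fser (u 0))) 0) > 0"
      using P P_N_cong[OF H ae] P_N_eq[OF H, of 0] assms(2) by simp
  qed auto
  then show ?thesis
    using dec_imp_ae_smooth[OF H _ ae] assms(2) by simp
qed

lemma smooth_of_solution_on_future:
  assumes "\<gamma>0 \<noteq> 0" "T > 0" and P: "P_N j0 lam a b c d \<phi> < 0"
    and sol: "solution_Hs \<gamma>0 \<gamma>1 \<gamma>2 (nonlinearity j0 lam a b c d) 13 \<phi> 0 T u"
  shows "ae_smooth_torus \<phi>"
proof -
  interpret flow \<gamma>0 \<gamma>1 \<gamma>2 j0 lam a b c d .
  interpret R: flow "- \<gamma>0" "- \<gamma>1" "- \<gamma>2" j0 "\<lambda>j. - lam j" a b c d .
  have u: "continuous_Hs {0..T} 13 u" and ae: "AE x in lebesgue. u 0 x = \<phi> x"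
    and ds: "distributional_solution \<gamma>0 \<gamma>1 \<gamma>2 (nonlinearity j0 lam a b c d) 0 T u"
    using sol by (auto simp: solution_Hs_def)
  have H: "u t \<in> Hs 13" if "t \<in> {0..T}" for t using u that by (simp add: continuous_Hs_def)
  obtain \<delta> C where \<delta>: "\<delta> > 0" "\<And>t n. t \<in> {0..T} \<Longrightarrow> \<bar>t\<bar> < \<delta> \<Longrightarrow> cmod (wc (fser (u t)) n) \<le> C / jb n ^ 13"
  proof -
    have "0 \<in> {0..T}" using assms(2) by simp
    from local_coeff_bound[OF u this] show ?thesis using that by (simp only: diff_0_right) blast
  qed
  define S where "S = min T (\<delta> / 2)"
  have S: "0 < S" "S \<le> T" "S < \<delta>" using assms(2) \<delta>(1) by (auto simp: S_def)
  have bd: "cmod (wc (fser (u t)) n) \<le> C / jb n ^ 13" if "t \<in> {0..S}" for t n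
    using that S by (intro \<delta>(2)) auto
  have "dec s (fser (u (- 0)))" for s
  proof (rule R.endpoint_decay[where U = "\<lambda>t. fser (u (- t))" and T = S and C = C])
    have "is_flow {0<..<S} (\<lambda>t. fser (u t))"
      by (rule solution_is_flow[OF ds u _ _ bd]) (use S in auto)
    then show "R.is_flow {-S<..<0} (\<lambda>t. fser (u (- t)))"
      by (rule is_flow_reverse)
    have "continuous_on {0..S} (\<lambda>t. wc (fser (u t)) n)" for n
      by (rule continuous_on_subset[OF continuous_coeff[OF u]]) (use S in auto)
    then show "continuous_on {-S..0} (\<lambda>t. wc (fser (u (- t))) n)" for n
      by (rule continuous_on_compose2) (auto intro!: continuous_intros)
    show "Im (wc (R.Aw (fser (u (- t)))) 0) = 0 \<and> Im (wc (R.Bw (fser (u (- t)))) 0) = 0" if "t \<in> {-S..0}" for t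
      using that S by (intro R.herm_AB H) auto
    show "Re (wc (R.Bw (fser (u (- 0)))) 0) > 0"
      using P P_N_cong[OF H ae] P_N_eq[OF H, of 0] assms(2) by (simp add: flow_reverse)
  qed (use S bd assms(1) in auto)
  then show ?thesis
    using dec_imp_ae_smooth[OF H _ ae] assms(2) by simp
qed

theorem theorem1p3:
  fixes \<gamma>0 \<gamma>1 \<gamma>2 :: real and j0 :: nat and lam :: "nat \<Rightarrow> real"
    and a b c d :: "nat \<Rightarrow> nat" and \<phi> :: "real \<Rightarrow> real"
  assumes "\<gamma>0 \<noteq> 0"
    and "j0 \<ge> 1"
    and "\<And>j. j \<in> {1..j0} \<Longrightarrow> a j + b j + c j + d j \<ge> 2"
    and "periodic2pi \<phi>"
    and "\<not> ae_smooth_torus \<phi>"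
    and "P_N_defined j0 a b c d \<phi>"
  shows "(P_N j0 lam a b c d \<phi> < 0 \<longrightarrow>
            (\<forall>T>0. \<nexists>u. solution_Hs \<gamma>0 \<gamma>1 \<gamma>2 (nonlinearity j0 lam a b c d) 13 \<phi> 0 T u)) \<and>
         (P_N j0 lam a b c d \<phi> > 0 \<longrightarrow>
            (\<forall>T>0. \<nexists>u. solution_Hs \<gamma>0 \<gamma>1 \<gamma>2 (nonlinearity j0 lam a b c d) 13 \<phi> (-T) 0 u))"
proof (intro conjI impI allI notI; elim exE)
  fix T u
  assume "P_N j0 lam a b c d \<phi> < 0" "0 < T" "solution_Hs \<gamma>0 \<gamma>1 \<gamma>2 (nonlinearity j0 lam a b c d) 13 \<phi> 0 T u"
  then show False
    using smooth_of_solution_on_future[OF assms(1)] assms(5) by simp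
next
  fix T u
  assume "P_N j0 lam a b c d \<phi> > 0" "0 < T" "solution_Hs \<gamma>0 \<gamma>1 \<gamma>2 (nonlinearity j0 lam a b c d) 13 \<phi> (-T) 0 u"
  then show False
    using smooth_of_solution_on_past[OF assms(1)] assms(5) by simp
qed

end
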